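(* Let $p$ be a prime, let $\rho$ be a shift with $\#T_\rho<\infty$, and let $f$ be a positive integer. Then the set of possible sets of jumps of characters of the free filtered $\mathbb{Z}_p$-module $M_\rho^{f-1}\oplus M_\rho^*$ is exactly $\mathrm{Jump}_\rho^*$. Moreover, two characters of $M_\rho^{f-1}\oplus M_\rho^*$ have the same set of jumps if and only if they are in the same orbit under the group $\mathrm{Aut}_{\mathrm{filt}}(M_\rho^{f-1}\oplus M_\rho^* )$.
   Context: A filtered $\mathbb{Z}_p$-module $M_\bullet$ is a sequence of $\mathbb{Z}_p$-modules $M_1\supseteq M_2\supseteq\cdots$ with $\bigcap_iM_i=\{0\}$; its weight map $w(x)=\sup\{i:x\in M_i\}$ determines the filtration; $M_1$ is topologized with the $M_i$ as a fundamental system of neighbourhoods of $0$. Morphisms are $\mathbb{Z}_p$-linear maps $\phi:M_1\to N_1$ with $\phi(M_i)\subseteq N_i$ for all $i$; $\mathrm{Aut}_{\mathrm{filt}}(M_\bullet)$ is the group of invertible morphisms. Products and sums carry the termwise filtration. A shift is a strictly increasing $\rho:\mathbb{Z}_{\ge1}\to\mathbb{Z}_{\ge1}$ with $\rho(1)>1$; $T_\rho=\mathbb{Z}_{\ge1}\setminus\rho(\mathbb{Z}_{\ge1})$. If $T_\rho$ is finite, $e^*=\max(T_\rho)+1$ and $T_\rho^*=T_\rho\cup\{e^*\}$. $S_i$ is the filtered module $\mathbb{Z}_p$ with weight map $w(x)=\rho^{\mathrm{ord}_p(x)}(i)$ (iterate of $\rho$; $w(0)=\infty$). $M_\rho=\prod_{i\in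 T_\rho}S_i$, $M_\rho^*=\prod_{i\in T_\rho^*}S_i$; $M_\rho^{f-1}$ is the direct sum of $f-1$ copies of $M_\rho$. A character of $M_\bullet$ is a continuous $\mathbb{Z}_p$-linear homomorphism $\chi:M_1\to\mathbb{Q}_p/\mathbb{Z}_p$ (discrete target); its set of jumps is $J_\chi=\{i\in\mathbb{Z}_{\ge1}:\chi(M_i)\ne\chi(M_{i+1})\}$. $\mathrm{Aut}_{\mathrm{filt}}(M_\bullet)$ acts on characters by precomposition. $\mathrm{Jump}_\rho^*$, the set of extended $\rho$-jump sets, is the set of finite subsets $A\subseteq\mathbb{Z}_{\ge1}$ such that (i) if $a,b\in A$ and $a<b$ then $\rho(a)\le b$; (ii) $A\setminus\rho(A)\subseteq T_\rho^*$. *)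

theory Defs
  imports "HOL-Analysis.Abstract_Topology" "HOL-Library.Extended_Nat"
    "HOL-Computational_Algebra.Primes" "HOL-Algebra.AbelCoset" "HOL-Algebra.Module"
    "HOL-Algebra.Group_Action"
begin

section \<open>The rings \<open>\<int>\<^sub>p\<close> and \<open>\<rat>\<^sub>p\<close>\<close>

text \<open>\<open>\<int>\<^sub>p\<close> is the inverse limit of the rings \<open>\<int>/p\<^sup>n\<int>\<close>; the component \<open>x n\<close> is the least nonnegative
  representative of the residue class modulo \<open>p\<^sup>n\<close>.\<close>

definition Zp :: "nat \<Rightarrow> (nat \<Rightarrow> int) ring" where
  "Zp p = \<lparr> carrier = {x. (\<forall>n. 0 \<le> x n \<and> x n < int p ^ n) \<and> (\<forall>n. x (Suc n) mod int p ^ n = x n)},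
            mult = (\<lambda>x y n. (x n * y n) mod int p ^ n),
            one = (\<lambda>n. 1 mod int p ^ n),
            zero = (\<lambda>n. 0),
            add = (\<lambda>x y n. (x n + y n) mod int p ^ n) \<rparr>"

text \<open>The \<open>p\<close>-adic valuation of a nonzero element; the value at zero is irrelevant.\<close>

definition ord_Zp :: "nat \<Rightarrow> (nat \<Rightarrow> int) \<Rightarrow> nat" where
  "ord_Zp p x =
     (GREATEST n. \<exists>y\<in>carrier (Zp p). x = ([p] \<cdot>\<^bsub>Zp p\<^esub> \<one>\<^bsub>Zp p\<^esub>) [^]\<^bsub>Zp p\<^esub> n \<otimes>\<^bsub>Zp p\<^esub> y)"

definition frac_rel :: "('a, 'm) ring_scheme \<Rightarrow> (('a \<times> 'a) \<times> ('a \<times> 'a)) set" where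
  "frac_rel R = {((a, b), (c, d)). a \<in> carrier R \<and> c \<in> carrier R \<and>
      b \<in> carrier R - {\<zero>\<^bsub>R\<^esub>} \<and> d \<in> carrier R - {\<zero>\<^bsub>R\<^esub>} \<and> a \<otimes>\<^bsub>R\<^esub> d = c \<otimes>\<^bsub>R\<^esub> b}"

definition frac_class :: "('a, 'm) ring_scheme \<Rightarrow> 'a \<Rightarrow> 'a \<Rightarrow> ('a \<times> 'a) set" where
  "frac_class R a b = frac_rel R `` {(a, b)}"

definition frac_field :: "('a, 'm) ring_scheme \<Rightarrow> ('a \<times> 'a) set ring" where
  "frac_field R =
     \<lparr> carrier = (carrier R \<times> (carrier R - {\<zero>\<^bsub>R\<^esub>})) // frac_rel R,
       mult = (\<lambda>X Y. \<Union>(a, b)\<in>X. \<Union>(c, d)\<in>Y. frac_class R (a \<otimes>\<^bsub>R\<^esub> c) (b \<otimes>\<^bsub>R\<^esub> d)),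
       one = frac_class R \<one>\<^bsub>R\<^esub> \<one>\<^bsub>R\<^esub>,
       zero = frac_class R \<zero>\<^bsub>R\<^esub> \<one>\<^bsub>R\<^esub>,
       add = (\<lambda>X Y. \<Union>(a, b)\<in>X. \<Union>(c, d)\<in>Y.
                frac_class R (a \<otimes>\<^bsub>R\<^esub> d \<oplus>\<^bsub>R\<^esub> c \<otimes>\<^bsub>R\<^esub> b) (b \<otimes>\<^bsub>R\<^esub> d)) \<rparr>"

definition frac_emb :: "('a, 'm) ring_scheme \<Rightarrow> 'a \<Rightarrow> ('a \<times> 'a) set" where
  "frac_emb R a = frac_class R a \<one>\<^bsub>R\<^esub>"

abbreviation Qp :: "nat \<Rightarrow> ((nat \<Rightarrow> int) \<times> (nat \<Rightarrow> int)) set ring" where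
  "Qp p \<equiv> frac_field (Zp p)"


section \<open>Modules and the \<open>\<int>\<^sub>p\<close>-module \<open>\<rat>\<^sub>p/\<int>\<^sub>p\<close>\<close>

text \<open>The library's \<^typ>\<open>('a, 'b) module\<close> records extend ring records; the multiplication and unit
  of a module are never used and left unspecified.\<close>

definition linear_maps ::
  "('a, 'm) ring_scheme \<Rightarrow> ('a, 'b, 'n) module_scheme \<Rightarrow> ('a, 'c, 'k) module_scheme \<Rightarrow> ('b \<Rightarrow> 'c) set" where
  "linear_maps R M N = {h \<in> carrier M \<rightarrow>\<^sub>E carrier N.
      (\<forall>x\<in>carrier M. \<forall>y\<in>carrier M. h (x \<oplus>\<^bsub>M\<^esub> y) = h x \<oplus>\<^bsub>N\<^esub> h y) \<and>
      (\<forall>r\<in>carrier R. \<forall>x\<in>carrier M. h (r \<odot>\<^bsub>M\<^esub> x) = r \<odot>\<^bsub>N\<^esub> h x)}"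

definition quot_module :: "('a, 'b, 'n) module_scheme \<Rightarrow> 'b set \<Rightarrow> ('a, 'b set) module" where
  "quot_module M N =
     \<lparr> carrier = a_rcosets\<^bsub>M\<^esub> N,
       mult = undefined,
       one = undefined,
       zero = N,
       add = (\<lambda>C D. C <+>\<^bsub>M\<^esub> D),
       smult = (\<lambda>r C. \<Union>c\<in>C. N +>\<^bsub>M\<^esub> (r \<odot>\<^bsub>M\<^esub> c)) \<rparr>"

definition Qp_module :: "nat \<Rightarrow> (nat \<Rightarrow> int, ((nat \<Rightarrow> int) \<times> (nat \<Rightarrow> int)) set) module" where
  "Qp_module p = ring.extend (Qp p) \<lparr> smult = (\<lambda>r X. frac_emb (Zp p) r \<otimes>\<^bsub>Qp p\<^esub> X) \<rparr>"

definition QpZp :: "nat \<Rightarrow> (nat \<Rightarrow> int, ((nat \<Rightarrow> int) \<times> (nat \<Rightarrow> int)) set set) module" where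
  "QpZp p = quot_module (Qp_module p) (frac_emb (Zp p) ` carrier (Zp p))"


section \<open>Filtered modules\<close>

text \<open>The carrier is \<open>M\<^sub>1\<close>; only the members \<open>fil M i\<close> with \<open>i \<ge> 1\<close> are meaningful. Maps between modules
  are extensional functions, undefined outside \<open>M\<^sub>1\<close>, so that HOL equality is equality of maps.\<close>

record ('a, 'b) fmodule = "('a, 'b) module" +
  fil :: "nat \<Rightarrow> 'b set"

locale filtered_module = module R M for R (structure) and M :: "('a, 'b, 'n) fmodule_scheme" (structure) +
  assumes fil_submodule: "i \<ge> 1 \<Longrightarrow> submodule (fil M i) R M"
    and fil_1: "fil M 1 = carrier M"
    and fil_Suc: "i \<ge> 1 \<Longrightarrow> fil M (Suc i) \<subseteq> fil M i"
    and fil_Inter: "(\<Inter>i\<in>{1..}. fil M i) = {\<zero>\<^bsub>M\<^esub>}"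

definition fil_topology :: "('a, 'b, 'n) fmodule_scheme \<Rightarrow> 'b topology" where
  "fil_topology M = topology (\<lambda>U. U \<subseteq> carrier M \<and> (\<forall>x\<in>U. \<exists>i\<ge>1. x <+\<^bsub>M\<^esub> fil M i \<subseteq> U))"

definition fil_maps ::
  "('a, 'm) ring_scheme \<Rightarrow> ('a, 'b, 'n) fmodule_scheme \<Rightarrow> ('a, 'c, 'k) fmodule_scheme \<Rightarrow> ('b \<Rightarrow> 'c) set" where
  "fil_maps R M N = {\<phi> \<in> linear_maps R M N. \<forall>i\<ge>1. \<phi> ` fil M i \<subseteq> fil N i}"

definition fil_end :: "('a, 'm) ring_scheme \<Rightarrow> ('a, 'b, 'n) fmodule_scheme \<Rightarrow> ('b \<Rightarrow> 'b) monoid" where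
  "fil_end R M = \<lparr> carrier = fil_maps R M M,
                   mult = compose (carrier M),
                   one = (\<lambda>x\<in>carrier M. x) \<rparr>"

definition Aut_filt :: "('a, 'm) ring_scheme \<Rightarrow> ('a, 'b, 'n) fmodule_scheme \<Rightarrow> ('b \<Rightarrow> 'b) monoid" where
  "Aut_filt R M = units_of (fil_end R M)"

definition fil_prod :: "'i set \<Rightarrow> ('i \<Rightarrow> ('a, 'b) fmodule) \<Rightarrow> ('a, 'i \<Rightarrow> 'b) fmodule" where
  "fil_prod I N =
     \<lparr> carrier = (\<Pi>\<^sub>E i\<in>I. carrier (N i)),
       mult = undefined,
       one = undefined,
       zero = (\<lambda>i\<in>I. \<zero>\<^bsub>N i\<^esub>),
       add = (\<lambda>x y. \<lambda>i\<in>I. x i \<oplus>\<^bsub>N i\<^esub> y i),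
       smult = (\<lambda>r x. \<lambda>i\<in>I. r \<odot>\<^bsub>N i\<^esub> x i),
       fil = (\<lambda>j. \<Pi>\<^sub>E i\<in>I. fil (N i) j) \<rparr>"

definition fil_sum :: "('a, 'b) fmodule \<Rightarrow> ('a, 'c) fmodule \<Rightarrow> ('a, 'b \<times> 'c) fmodule" where
  "fil_sum M N =
     \<lparr> carrier = carrier M \<times> carrier N,
       mult = undefined,
       one = undefined,
       zero = (\<zero>\<^bsub>M\<^esub>, \<zero>\<^bsub>N\<^esub>),
       add = (\<lambda>(x, y) (x', y'). (x \<oplus>\<^bsub>M\<^esub> x', y \<oplus>\<^bsub>N\<^esub> y')),
       smult = (\<lambda>r (x, y). (r \<odot>\<^bsub>M\<^esub> x, r \<odot>\<^bsub>N\<^esub> y)),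
       fil = (\<lambda>j. fil M j \<times> fil N j) \<rparr>"


section \<open>Characters and jumps\<close>

definition characters ::
  "nat \<Rightarrow> (nat \<Rightarrow> int, 'b, 'n) fmodule_scheme \<Rightarrow> ('b \<Rightarrow> ((nat \<Rightarrow> int) \<times> (nat \<Rightarrow> int)) set set) set" where
  "characters p M = {\<chi> \<in> linear_maps (Zp p) M (QpZp p).
      continuous_map (fil_topology M) (discrete_topology (carrier (QpZp p))) \<chi>}"

definition jumps :: "('a, 'b, 'n) fmodule_scheme \<Rightarrow> ('b \<Rightarrow> 'c) \<Rightarrow> nat set" where
  "jumps M \<chi> = {i. i \<ge> 1 \<and> \<chi> ` fil M i \<noteq> \<chi> ` fil M (i + 1)}"

definition precomp :: "('a, 'b, 'n) fmodule_scheme \<Rightarrow> ('b \<Rightarrow> 'b) \<Rightarrow> ('b \<Rightarrow> 'c) \<Rightarrow> ('b \<Rightarrow> 'c)" where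
  "precomp M \<phi> \<chi> = compose (carrier M) \<chi> \<phi>"


section \<open>Shifts, jump sets, and the modules \<open>M\<^sub>\<rho>\<close> and \<open>M\<^sub>\<rho>\<^sup>*\<close>\<close>

text \<open>A shift is a function on the positive integers; its value at 0 is irrelevant.\<close>

definition is_shift :: "(nat \<Rightarrow> nat) \<Rightarrow> bool" where
  "is_shift \<rho> \<longleftrightarrow> strict_mono_on {1..} \<rho> \<and> \<rho> 1 > 1"

definition T_set :: "(nat \<Rightarrow> nat) \<Rightarrow> nat set" where
  "T_set \<rho> = {1..} - \<rho> ` {1..}"

definition e_star :: "(nat \<Rightarrow> nat) \<Rightarrow> nat" where
  "e_star \<rho> = Max (T_set \<rho>) + 1"

definition T_star :: "(nat \<Rightarrow> nat) \<Rightarrow> nat set" where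
  "T_star \<rho> = T_set \<rho> \<union> {e_star \<rho>}"

text \<open>\<open>S_weight p \<rho> i\<close> is the weight map of \<open>S\<^sub>i\<close>; the filtration is recovered from it, the \<open>j\<close>-th member
  being the set of elements of weight at least \<open>j\<close>.\<close>

definition S_weight :: "nat \<Rightarrow> (nat \<Rightarrow> nat) \<Rightarrow> nat \<Rightarrow> (nat \<Rightarrow> int) \<Rightarrow> enat" where
  "S_weight p \<rho> i x = (if x = \<zero>\<^bsub>Zp p\<^esub> then \<infinity> else enat ((\<rho> ^^ ord_Zp p x) i))"

definition S_mod :: "nat \<Rightarrow> (nat \<Rightarrow> nat) \<Rightarrow> nat \<Rightarrow> (nat \<Rightarrow> int, nat \<Rightarrow> int) fmodule" where
  "S_mod p \<rho> i = ring.extend (Zp p)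
     \<lparr> smult = (\<lambda>r x. r \<otimes>\<^bsub>Zp p\<^esub> x),
       fil = (\<lambda>j. {x \<in> carrier (Zp p). enat j \<le> S_weight p \<rho> i x}) \<rparr>"

definition M_rho :: "nat \<Rightarrow> (nat \<Rightarrow> nat) \<Rightarrow> (nat \<Rightarrow> int, nat \<Rightarrow> nat \<Rightarrow> int) fmodule" where
  "M_rho p \<rho> = fil_prod (T_set \<rho>) (S_mod p \<rho>)"

definition M_rho_star :: "nat \<Rightarrow> (nat \<Rightarrow> nat) \<Rightarrow> (nat \<Rightarrow> int, nat \<Rightarrow> nat \<Rightarrow> int) fmodule" where
  "M_rho_star p \<rho> = fil_prod (T_star \<rho>) (S_mod p \<rho>)"

text \<open>\<open>M\<^sub>\<rho>\<^sup>f\<^sup>-\<^sup>1 \<oplus> M\<^sub>\<rho>\<^sup>*\<close>; the finite direct sum of \<open>f - 1\<close> copies is the product over \<open>{..<f - 1}\<close>.\<close>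

definition M_free ::
  "nat \<Rightarrow> (nat \<Rightarrow> nat) \<Rightarrow> nat \<Rightarrow> (nat \<Rightarrow> int, (nat \<Rightarrow> nat \<Rightarrow> nat \<Rightarrow> int) \<times> (nat \<Rightarrow> nat \<Rightarrow> int)) fmodule" where
  "M_free p \<rho> f = fil_sum (fil_prod {..<f - 1} (\<lambda>_. M_rho p \<rho>)) (M_rho_star p \<rho>)"

definition Jump_star :: "(nat \<Rightarrow> nat) \<Rightarrow> nat set set" where
  "Jump_star \<rho> = {A. finite A \<and> A \<subseteq> {1..} \<and>
      (\<forall>a\<in>A. \<forall>b\<in>A. a < b \<longrightarrow> \<rho> a \<le> b) \<and> A - \<rho> ` A \<subseteq> T_star \<rho>}"

end

theory Submission
  imports Defs "HOL-Algebra.Divisibility" "HOL-Number_Theory.Cong"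
begin

text \<open>
  Write \<open>M\<close> for the module and \<open>\<chi>\<close> for a character. Everything is read off from the decreasing chain of
  submodules \<open>\<chi>(M\<^sub>1) \<supseteq> \<chi>(M\<^sub>2) \<supseteq> \<dots>\<close> of \<open>\<rat>\<^sub>p/\<int>\<^sub>p\<close>. The only facts about \<open>\<rat>\<^sub>p/\<int>\<^sub>p\<close> that matter are that of
  any two elements one is a multiple of the other, and that it has elements of every order \<open>p\<^sup>n\<close>
  (locale \<open>uniserial_module\<close>, lemma \<open>QpZp_uniserial\<close>). The only facts about \<open>M\<close> that matter are that it has
  finitely many coordinates in \<open>\<int>\<^sub>p\<close>, each with a level \<open>i\<close>, and that \<open>M\<^sub>j\<close> is cut out by requiring the
  coordinates of level \<open>i\<close> to be divisible by \<open>p\<^sup>k\<close> for some \<open>k\<close> with \<open>\<rho>\<^sup>k(i) \<ge> j\<close> (locale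
  \<open>filtered_coordinates\<close>, lemma \<open>M_free_coordinates\<close>). The levels that occur are the elements of \<open>T\<^sub>\<rho>\<^sup>*\<close>.

  Jumps are extended jump sets (\<open>jumps_in_jump_sets\<close>). Since \<open>p M\<^sub>a \<subseteq> M\<^bsub>\<rho>(a)\<^esub>\<close>, a jump at \<open>a\<close> leaves no room
  for another jump before \<open>\<rho>(a)\<close>: it would produce a multiple of \<open>p \<chi>(M\<^sub>a)\<close> outside \<open>\<chi>(M\<^bsub>\<rho>(a)\<^esub>)\<close>. If no
  coordinate has level \<open>b\<close>, then \<open>M\<^sub>b\<close> is \<open>M\<^bsub>b+1\<^esub>\<close>, or \<open>p M\<^sub>a + M\<^bsub>b+1\<^esub>\<close> with \<open>b = \<rho>(a)\<close>, so that a jump at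
  \<open>b\<close> forces one at \<open>a\<close>.

  Every extended jump set \<open>A\<close> occurs (\<open>jump_set_attained\<close>). Put \<open>N(i) = #{b \<in> A. b \<ge> i}\<close>, send the basis
  vectors of level \<open>a \<in> A - \<rho>(A)\<close> to an element of order \<open>p\<^bsup>N(a)\<^esup>\<close> and the others to \<open>0\<close>. The spacing of \<open>A\<close>
  makes \<open>N\<close> drop by at most one from \<open>j\<close> to \<open>\<rho>(j)\<close>, and by exactly one if both are in \<open>A\<close>; hence
  \<open>\<chi>(M\<^sub>i)\<close> is exactly the \<open>p\<^bsup>N(i)\<^esup>\<close>-torsion.

  Equal jumps give equal orbits. First, the jumps determine all the images \<open>\<chi>(M\<^sub>i)\<close>, by descending
  induction on \<open>i\<close> (\<open>same_jumps_same_images\<close>). Then \<open>\<chi>\<close> is deformed into \<open>\<chi>'\<close> one basis vector at a time.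
  A basis vector \<open>e\<^sub>b\<close> of level \<open>i\<close> can be moved, by an automorphism that fixes the other basis vectors, to
  any \<open>w \<in> M\<^sub>i\<close> whose \<open>b\<close>-coordinate is a unit (\<open>move_basis_vector\<close>). If \<open>\<chi>\<close> and \<open>\<chi>'\<close> differ on some basis
  vector, then they differ on one for which such a \<open>w\<close> with \<open>\<chi>(w) = \<chi>'(e\<^sub>b)\<close> exists
  (\<open>adjustable_basis_vector\<close>), and the number of disagreements drops.
\<close>

(* The prime elements of a monoid would otherwise capture the name of the prime numbers. *)
hide_const (open) Divisibility.prime

section \<open>Discrete valuation rings\<close>

text \<open>A domain with one prime \<open>\<pi>\<close> that divides every non-unit, and no nonzero element divisible by all powers
  of \<open>\<pi>\<close>. This is a discrete valuation ring; the axioms are the properties of \<open>\<int>\<^sub>p\<close> that its description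
  by residues yields directly.\<close>

locale dvr = R?: domain R for R (structure) +
  fixes \<pi>
  assumes pi_closed [simp, intro]: "\<pi> \<in> carrier R"
    and pi_nonzero: "\<pi> \<noteq> \<zero>"
    and pi_not_unit: "\<pi> \<notin> Units R"
    and unit_or_pi_divides: "x \<in> carrier R \<Longrightarrow> x \<in> Units R \<or> \<pi> divides x"
    and pi_separated: "x \<in> carrier R \<Longrightarrow> (\<And>n::nat. \<pi> [^] n divides x) \<Longrightarrow> x = \<zero>"
begin

lemma pi_pow_nonzero: "\<pi> [^] (n::nat) \<noteq> \<zero>"
  by (induction n) (auto simp: pi_nonzero integral_iff)

lemma pi_pow_cancel:
  assumes "a \<in> carrier R" "b \<in> carrier R" "\<pi> [^] (n::nat) \<otimes> a = \<pi> [^] n \<otimes> b"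
  shows "a = b"
  using assms m_lcancel[of "\<pi> [^] n" a b] pi_pow_nonzero by auto

text \<open>The ring is local: a non-unit \<open>u + x\<close> would be divisible by \<open>\<pi>\<close>, and then so would \<open>u\<close>.\<close>

lemma unit_plus_pi_multiple:
  assumes u: "u \<in> Units R" and x: "x \<in> carrier R" "\<pi> divides x"
  shows "u \<oplus> x \<in> Units R"
proof (rule ccontr)
  assume "u \<oplus> x \<notin> Units R"
  then obtain y where y: "y \<in> carrier R" "u \<oplus> x = \<pi> \<otimes> y"
    using unit_or_pi_divides[of "u \<oplus> x"] u x by (auto elim!: dividesE)
  obtain z where z: "z \<in> carrier R" "x = \<pi> \<otimes> z" using x by (auto elim!: dividesE)
  have uc: "u \<in> carrier R" using u by auto
  have "u = (u \<oplus> x) \<ominus> x" using uc x by algebra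
  also have "\<dots> = \<pi> \<otimes> y \<ominus> x" by (simp only: y)
  also have "\<dots> = \<pi> \<otimes> (y \<ominus> z)" using y(1) z by (simp add: minus_eq r_distr r_minus)
  finally show False
    using u pi_not_unit unit_factor[of \<pi> "y \<ominus> z"] y z by auto
qed

text \<open>Separatedness bounds the powers of \<open>\<pi>\<close> that divide \<open>x\<close>; dividing by the largest one leaves an element
  that \<open>\<pi>\<close> does not divide, which is a unit.\<close>

lemma pi_power_unit_factor:
  assumes x: "x \<in> carrier R" "x \<noteq> \<zero>"
  obtains n u where "u \<in> Units R" "x = \<pi> [^] (n::nat) \<otimes> u"
proof -
  obtain m where m: "\<not> \<pi> [^] (m::nat) divides x" using pi_separated x by blast
  \<comment> \<open>the largest exponent whose power of \<open>\<pi>\<close> divides \<open>x\<close>\<close>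
  define n where "n = (LEAST n. \<not> \<pi> [^] (Suc n) divides x)"
  have "\<pi> [^] (0::nat) divides x" using x by (auto intro: dividesI[of x])
  then obtain k where "m = Suc k" using m by (cases m) auto
  then have n1: "\<not> \<pi> [^] (Suc n) divides x"
    unfolding n_def using m by (intro LeastI[of "\<lambda>n. \<not> \<pi> [^] (Suc n) divides x" k]) simp
  have n2: "\<pi> [^] n divides x"
  proof (cases n)
    case 0 then show ?thesis using x by (auto intro: dividesI[of x])
  next
    case (Suc k)
    then have "k < n" by simp
    then show ?thesis
      using not_less_Least[of k "\<lambda>n. \<not> \<pi> [^] (Suc n) divides x"] Suc unfolding n_def by simp
  qed
  then obtain u where u: "u \<in> carrier R" "x = \<pi> [^] n \<otimes> u" by (auto elim!: dividesE)
  have "u \<in> Units R"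
  proof (rule ccontr)
    assume "u \<notin> Units R"
    then obtain v where "v \<in> carrier R" "u = \<pi> \<otimes> v"
      using unit_or_pi_divides[OF u(1)] by (auto elim!: dividesE)
    then have "\<pi> [^] (Suc n) divides x"
      using u by (intro dividesI[of v]) (auto simp: m_assoc)
    then show False using n1 by simp
  qed
  then show ?thesis using u that by blast
qed

lemma divides_chain:
  assumes "x \<in> carrier R" "y \<in> carrier R"
  shows "x divides y \<or> y divides x"
proof (cases "x = \<zero> \<or> y = \<zero>")
  case True
  then show ?thesis using assms by (auto intro!: dividesI[of \<zero>])
next
  case False
  have *: "\<pi> [^] (n::nat) \<otimes> u divides \<pi> [^] (m::nat) \<otimes> v"
    if "u \<in> Units R" "v \<in> Units R" "n \<le> m" for n m u v
  proof (rule dividesI)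
    show "\<pi> [^] (m - n) \<otimes> (inv u \<otimes> v) \<in> carrier R" using that by auto
    have "\<pi> [^] m = \<pi> [^] n \<otimes> \<pi> [^] (m - n)" using that by (simp add: nat_pow_mult)
    moreover have "\<pi> [^] n \<otimes> u \<otimes> (\<pi> [^] (m - n) \<otimes> (inv u \<otimes> v))
        = \<pi> [^] n \<otimes> \<pi> [^] (m - n) \<otimes> (u \<otimes> inv u) \<otimes> v"
      using that Units_inv_closed[of u] Units_closed nat_pow_closed[OF pi_closed] by algebra
    ultimately show "\<pi> [^] m \<otimes> v = \<pi> [^] n \<otimes> u \<otimes> (\<pi> [^] (m - n) \<otimes> (inv u \<otimes> v))"
      using that by simp
  qed
  obtain n u where "u \<in> Units R" "x = \<pi> [^] (n::nat) \<otimes> u"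
    using pi_power_unit_factor[of x] assms False by metis
  moreover obtain m v where "v \<in> Units R" "y = \<pi> [^] (m::nat) \<otimes> v"
    using pi_power_unit_factor[of y] assms False by metis
  ultimately show ?thesis using * by (cases "n \<le> m") auto
qed

lemma pi_pow_divides_closed:
  assumes "x \<in> carrier R" "y \<in> carrier R" "\<pi> [^] (n::nat) divides x" "\<pi> [^] n divides y"
  shows "\<pi> [^] n divides (x \<oplus> y)"
  using assms by (auto elim!: dividesE simp flip: r_distr)

end

section \<open>Uniserial torsion modules\<close>

text \<open>The properties of \<open>\<rat>\<^sub>p/\<int>\<^sub>p\<close> that the classification rests on. Uniseriality makes the submodules a
  chain; \<open>exact_order\<close> makes the \<open>\<pi>\<^sup>n\<close>-torsion submodules pairwise different.\<close>

locale uniserial_module = dvr R \<pi> + module R Q for R (structure) and \<pi> and Q (structure) +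
  assumes uniserial: "x \<in> carrier Q \<Longrightarrow> y \<in> carrier Q \<Longrightarrow>
      (\<exists>r\<in>carrier R. x = r \<odot>\<^bsub>Q\<^esub> y) \<or> (\<exists>r\<in>carrier R. y = r \<odot>\<^bsub>Q\<^esub> x)"
    and exact_order: "\<exists>g\<in>carrier Q. \<forall>k::nat. \<pi> [^] k \<odot>\<^bsub>Q\<^esub> g = \<zero>\<^bsub>Q\<^esub> \<longleftrightarrow> n \<le> k"
begin

definition ann :: "nat \<Rightarrow> 'c set" where
  "ann n = {x \<in> carrier Q. \<pi> [^] n \<odot>\<^bsub>Q\<^esub> x = \<zero>\<^bsub>Q\<^esub>}"

lemma smult_unit_solve:
  assumes "r \<in> Units R" "x \<in> carrier Q" "y \<in> carrier Q" "x = r \<odot>\<^bsub>Q\<^esub> y"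
  shows "y = inv r \<odot>\<^bsub>Q\<^esub> x"
  using assms smult_assoc1[of "inv r" r y] by auto

text \<open>One of \<open>x\<close> and \<open>h\<close> is a multiple of the other. It must be \<open>h = s x\<close> with \<open>s\<close> a non-unit, since otherwise
  \<open>x\<close> would lie in \<open>H\<close>. So an element outside a submodule dominates it strictly.\<close>

lemma outside_submodule:
  assumes H: "submodule H R Q" and x: "x \<in> carrier Q" "x \<notin> H" and h: "h \<in> H"
  obtains r where "r \<in> carrier R" "h = (\<pi> \<otimes> r) \<odot>\<^bsub>Q\<^esub> x"
proof -
  note HE = submoduleE[OF H]
  have hc: "h \<in> carrier Q" using HE(1) h by auto
  have "\<not> (\<exists>r\<in>carrier R. x = r \<odot>\<^bsub>Q\<^esub> h)" using HE(4) x h by auto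
  then obtain s where s: "s \<in> carrier R" "h = s \<odot>\<^bsub>Q\<^esub> x" using uniserial[OF x(1) hc] by blast
  have "s \<notin> Units R"
    using smult_unit_solve[OF _ hc x(1) s(2)] HE(4) h x(2) by auto
  then show ?thesis using unit_or_pi_divides[OF s(1)] s that by (auto elim!: dividesE)
qed

text \<open>Nakayama for a cyclic module: \<open>1 - \<pi> r\<close> is a unit that kills \<open>x\<close>.\<close>

lemma not_pi_multiple_of_itself:
  assumes "x \<in> carrier Q" "r \<in> carrier R" "x = (\<pi> \<otimes> r) \<odot>\<^bsub>Q\<^esub> x"
  shows "x = \<zero>\<^bsub>Q\<^esub>"
proof -
  have u: "\<one> \<oplus> (\<ominus> (\<pi> \<otimes> r)) \<in> Units R"
    using assms by (intro unit_plus_pi_multiple) (auto intro!: dividesI[of "\<ominus> r"] simp: r_minus)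
  have "(\<one> \<oplus> (\<ominus> (\<pi> \<otimes> r))) \<odot>\<^bsub>Q\<^esub> x = x \<oplus>\<^bsub>Q\<^esub> \<ominus>\<^bsub>Q\<^esub> ((\<pi> \<otimes> r) \<odot>\<^bsub>Q\<^esub> x)"
    using assms(1,2) by (simp add: smult_l_distr smult_l_minus)
  also have "\<dots> = \<zero>\<^bsub>Q\<^esub>" using assms by (simp add: M.r_neg)
  finally have "\<zero>\<^bsub>Q\<^esub> = (\<one> \<oplus> (\<ominus> (\<pi> \<otimes> r))) \<odot>\<^bsub>Q\<^esub> x" ..
  from smult_unit_solve[OF u _ _ this] show ?thesis using assms u by simp
qed

lemma ann_submodule: "submodule (ann n) R Q"
proof (rule submoduleI)
  fix a x assume "a \<in> carrier R" "x \<in> ann n"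
  moreover from this have "\<pi> [^] n \<odot>\<^bsub>Q\<^esub> (a \<odot>\<^bsub>Q\<^esub> x) = a \<odot>\<^bsub>Q\<^esub> (\<pi> [^] n \<odot>\<^bsub>Q\<^esub> x)"
    using smult_assoc1[of "\<pi> [^] n" a x] smult_assoc1[of a "\<pi> [^] n" x] m_comm[of a "\<pi> [^] n"]
    by (simp add: ann_def)
  ultimately show "a \<odot>\<^bsub>Q\<^esub> x \<in> ann n" by (auto simp: ann_def)
qed (auto simp: ann_def smult_r_distr smult_r_minus)

text \<open>If \<open>g\<close> were a multiple \<open>s x\<close> with \<open>s\<close> divisible by \<open>\<pi>\<close>, then \<open>\<pi>\<^bsup>n-1\<^esup> g\<close> would be a multiple of \<open>\<pi>\<^sup>n x = 0\<close>.\<close>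

lemma ann_generator:
  assumes g: "g \<in> carrier Q" "\<And>k. k < n \<Longrightarrow> \<pi> [^] k \<odot>\<^bsub>Q\<^esub> g \<noteq> \<zero>\<^bsub>Q\<^esub>" and x: "x \<in> ann n"
  shows "\<exists>r\<in>carrier R. x = r \<odot>\<^bsub>Q\<^esub> g"
proof (rule ccontr)
  assume neg: "\<not> ?thesis"
  have xc: "x \<in> carrier Q" using x by (auto simp: ann_def)
  have n: "n \<noteq> 0"
  proof
    assume "n = 0"
    then have "x = \<zero> \<odot>\<^bsub>Q\<^esub> g" using x g by (auto simp: ann_def)
    then show False using neg by blast
  qed
  obtain s where s: "s \<in> carrier R" "g = s \<odot>\<^bsub>Q\<^esub> x" using uniserial[OF g(1) xc] neg by blast
  have "s \<notin> Units R" using smult_unit_solve[OF _ g(1) xc s(2)] neg by auto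
  then obtain r where r: "r \<in> carrier R" "s = \<pi> \<otimes> r"
    using unit_or_pi_divides[OF s(1)] by (auto elim!: dividesE)
  have "\<pi> [^] (n - 1) \<odot>\<^bsub>Q\<^esub> g = (r \<otimes> (\<pi> [^] (n - 1) \<otimes> \<pi>)) \<odot>\<^bsub>Q\<^esub> x"
    using s r xc by (simp add: smult_assoc1[symmetric] m_ac)
  also have "\<pi> [^] (n - 1) \<otimes> \<pi> = \<pi> [^] n" using n by (cases n) auto
  also have "(r \<otimes> \<pi> [^] n) \<odot>\<^bsub>Q\<^esub> x = \<zero>\<^bsub>Q\<^esub>"
    using r x by (auto simp: ann_def smult_assoc1)
  finally show False using g(2)[of "n - 1"] n by auto
qed

lemma ann_inj: "ann m = ann n \<longleftrightarrow> m = n"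
proof
  assume eq: "ann m = ann n"
  have "m \<le> n" if eq: "ann m = ann n" for m n
  proof -
    obtain g where "g \<in> carrier Q" "\<forall>k::nat. \<pi> [^] k \<odot>\<^bsub>Q\<^esub> g = \<zero>\<^bsub>Q\<^esub> \<longleftrightarrow> m \<le> k"
      using exact_order[of m] by blast
    then have "g \<in> ann m" by (auto simp: ann_def)
    then show ?thesis using eq \<open>\<forall>k. _ k\<close> by (auto simp: ann_def)
  qed
  from this[OF eq] this[OF eq[symmetric]] show "m = n" by simp
qed auto

end

section \<open>Linear maps\<close>

lemma linear_mapsD:
  assumes "h \<in> linear_maps R M N"
  shows "x \<in> carrier M \<Longrightarrow> h x \<in> carrier N"
    and "x \<in> carrier M \<Longrightarrow> y \<in> carrier M \<Longrightarrow> h (x \<oplus>\<^bsub>M\<^esub> y) = h x \<oplus>\<^bsub>N\<^esub> h y"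
    and "r \<in> carrier R \<Longrightarrow> x \<in> carrier M \<Longrightarrow> h (r \<odot>\<^bsub>M\<^esub> x) = r \<odot>\<^bsub>N\<^esub> h x"
    and "x \<notin> carrier M \<Longrightarrow> h x = undefined"
  using assms by (auto simp: linear_maps_def)

lemma linear_map_zero:
  assumes "module R M" "module R N" "h \<in> linear_maps R M N"
  shows "h \<zero>\<^bsub>M\<^esub> = \<zero>\<^bsub>N\<^esub>"
proof -
  interpret M: module R M by fact
  interpret N: module R N by fact
  show ?thesis
    using linear_mapsD(3)[OF assms(3), of "\<zero>\<^bsub>R\<^esub>" "\<zero>\<^bsub>M\<^esub>"] linear_mapsD(1)[OF assms(3), of "\<zero>\<^bsub>M\<^esub>"]
    by simp
qed

lemma linear_map_minus:
  assumes "module R M" "module R N" "h \<in> linear_maps R M N" "x \<in> carrier M"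
  shows "h (\<ominus>\<^bsub>M\<^esub> x) = \<ominus>\<^bsub>N\<^esub> h x"
proof -
  interpret M: module R M by fact
  interpret N: module R N by fact
  show ?thesis
    using linear_mapsD(3)[OF assms(3), of "\<ominus>\<^bsub>R\<^esub> \<one>\<^bsub>R\<^esub>" x] linear_mapsD(1)[OF assms(3,4)] assms(4)
    by (simp add: M.smult_l_minus N.smult_l_minus)
qed

lemma linear_map_image_submodule:
  assumes "module R M" "module R N" and h: "h \<in> linear_maps R M N" and H: "submodule H R M"
  shows "submodule (h ` H) R N"
proof -
  interpret M: module R M by fact
  interpret N: module R N by fact
  note HE = M.submoduleE[OF H]
  have sub: "x \<in> H \<Longrightarrow> x \<in> carrier M" for x using HE(1) by auto
  show ?thesis
  proof (rule N.submoduleI)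
    show "h ` H \<subseteq> carrier N" using sub linear_mapsD(1)[OF h] by auto
    have "\<zero>\<^bsub>M\<^esub> \<in> H" using HE(2,4) sub M.smult_l_null[of "SOME x. x \<in> H"]
      by (metis M.smult_l_null M.R.zero_closed ex_in_conv)
    then show "\<zero>\<^bsub>N\<^esub> \<in> h ` H" using linear_map_zero[OF assms(1-3)] by force
  next
    fix a assume "a \<in> h ` H"
    then obtain x where "x \<in> H" "a = h x" by auto
    then show "\<ominus>\<^bsub>N\<^esub> a \<in> h ` H" using linear_map_minus[OF assms(1-3)] sub HE(3) by (metis imageI)
  next
    fix a b assume "a \<in> h ` H" "b \<in> h ` H"
    then obtain x y where "x \<in> H" "a = h x" "y \<in> H" "b = h y" by auto
    then show "a \<oplus>\<^bsub>N\<^esub> b \<in> h ` H" using linear_mapsD(2)[OF h] sub HE(5) by (metis imageI)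
  next
    fix r a assume "r \<in> carrier R" "a \<in> h ` H"
    then obtain x where "x \<in> H" "a = h x" by auto
    then show "r \<odot>\<^bsub>N\<^esub> a \<in> h ` H"
      using \<open>r \<in> carrier R\<close> linear_mapsD(3)[OF h] sub HE(4) by (metis imageI)
  qed
qed

lemma linear_map_finsum:
  assumes "module R M" "module R N" and h: "h \<in> linear_maps R M N"
    and "finite A" "f \<in> A \<rightarrow> carrier M"
  shows "h (\<Oplus>\<^bsub>M\<^esub>b\<in>A. f b) = (\<Oplus>\<^bsub>N\<^esub>b\<in>A. h (f b))"
proof -
  interpret M: module R M by fact
  interpret N: module R N by fact
  show ?thesis using assms(4,5)
  proof (induction A)
    case empty
    then show ?case using linear_map_zero[OF assms(1-3)] by simp
  next
    case (insert x F)
    then have "f \<in> F \<rightarrow> carrier M" "f x \<in> carrier M" by auto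
    moreover from this have "(\<lambda>b. h (f b)) \<in> F \<rightarrow> carrier N" "h (f x) \<in> carrier N"
      using linear_mapsD(1)[OF h] by auto
    ultimately show ?case using insert linear_mapsD(2)[OF h] by simp
  qed
qed

lemma linear_map_compose:
  assumes "g \<in> linear_maps R M N" "h \<in> linear_maps R N P"
    and closed: "\<And>x y. x \<in> carrier M \<Longrightarrow> y \<in> carrier M \<Longrightarrow> x \<oplus>\<^bsub>M\<^esub> y \<in> carrier M"
      "\<And>r x. r \<in> carrier R \<Longrightarrow> x \<in> carrier M \<Longrightarrow> r \<odot>\<^bsub>M\<^esub> x \<in> carrier M"
  shows "compose (carrier M) h g \<in> linear_maps R M P"
proof -
  have c: "g x \<in> carrier N" if "x \<in> carrier M" for x using linear_mapsD(1)[OF assms(1) that] .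
  have "h (g (x \<oplus>\<^bsub>M\<^esub> y)) = h (g x) \<oplus>\<^bsub>P\<^esub> h (g y)" if "x \<in> carrier M" "y \<in> carrier M" for x y
    using linear_mapsD(2)[OF assms(1) that] linear_mapsD(2)[OF assms(2) c c] that by simp
  moreover have "h (g (r \<odot>\<^bsub>M\<^esub> x)) = r \<odot>\<^bsub>P\<^esub> h (g x)" if "r \<in> carrier R" "x \<in> carrier M" for r x
    using linear_mapsD(3)[OF assms(1) that] linear_mapsD(3)[OF assms(2) that(1) c] that by simp
  ultimately show ?thesis
    using c linear_mapsD(1)[OF assms(2)] closed
    unfolding linear_maps_def by (auto simp: compose_def)
qed

section \<open>Shifts and their filtrations of a discrete valuation ring\<close>

lemma shift_less:
  assumes "is_shift \<rho>" "1 \<le> i"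
  shows "i < \<rho> i"
  using assms(2)
proof (induction i rule: nat_induct_at_least)
  case base
  then show ?case using assms(1) by (auto simp: is_shift_def)
next
  case (Suc n)
  then have "\<rho> n < \<rho> (Suc n)" using assms(1) by (auto simp: is_shift_def strict_mono_on_def)
  then show ?case using Suc by linarith
qed

lemma shift_strict_mono:
  assumes "is_shift \<rho>" "1 \<le> i" "i < j"
  shows "\<rho> i < \<rho> j"
  using assms by (auto simp: is_shift_def strict_mono_on_def)

lemma shift_mono:
  assumes "is_shift \<rho>" "1 \<le> i" "i \<le> j"
  shows "\<rho> i \<le> \<rho> j"
  using shift_strict_mono[OF assms(1,2), of j] assms(3) by (cases "i = j") auto

lemma shift_inj:
  assumes "is_shift \<rho>" "1 \<le> i" "1 \<le> j" "\<rho> i = \<rho> j"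
  shows "i = j"
  using shift_strict_mono[OF assms(1), of i j] shift_strict_mono[OF assms(1), of j i] assms(2-4)
  by (cases i j rule: linorder_cases) auto

lemma shift_pow_ge:
  assumes "is_shift \<rho>" "1 \<le> i"
  shows "i + k \<le> (\<rho> ^^ k) i"
proof (induction k)
  case (Suc k)
  then show ?case using shift_less[OF assms(1), of "(\<rho> ^^ k) i"] assms(2) by simp
qed simp

locale shifted_dvr = dvr R \<pi> for R (structure) and \<pi> +
  fixes \<rho> :: "nat \<Rightarrow> nat"
  assumes shift: "is_shift \<rho>"
begin

text \<open>The \<open>j\<close>-th step of the filtration on the rank one module \<open>S\<^sub>i\<close>, expressed by divisibility so that zero
  needs no separate treatment.\<close>

definition level_ideal :: "nat \<Rightarrow> nat \<Rightarrow> 'a set" where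
  "level_ideal i j = {a \<in> carrier R. \<exists>k. j \<le> (\<rho> ^^ k) i \<and> \<pi> [^] k divides a}"

lemma level_ideal_carrier: "a \<in> level_ideal i j \<Longrightarrow> a \<in> carrier R"
  by (simp add: level_ideal_def)

lemma level_ideal_add:
  assumes "a \<in> level_ideal i j" "b \<in> level_ideal i j"
  shows "a \<oplus> b \<in> level_ideal i j"
proof -
  have *: "a \<oplus> b \<in> level_ideal i j"
    if ab: "a \<in> carrier R" "b \<in> carrier R" "j \<le> (\<rho> ^^ k) i" "\<pi> [^] k divides a"
      "\<pi> [^] m divides b" "k \<le> m" for a b k m
  proof -
    have "\<pi> [^] k divides \<pi> [^] m" using that
      by (intro dividesI[of "\<pi> [^] (m - k)"]) (auto simp: nat_pow_mult)
    then have "\<pi> [^] k divides b" using ab divides_trans by (meson nat_pow_closed pi_closed)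
    then show ?thesis
      using ab pi_pow_divides_closed[of a b k] by (auto simp: level_ideal_def)
  qed
  obtain k m where km: "j \<le> (\<rho> ^^ k) i" "\<pi> [^] k divides a" "j \<le> (\<rho> ^^ m) i" "\<pi> [^] m divides b"
    using assms by (auto simp: level_ideal_def)
  have c: "a \<in> carrier R" "b \<in> carrier R" using assms by (auto simp: level_ideal_def)
  show ?thesis
  proof (cases "k \<le> m")
    case True
    then show ?thesis using *[of a b k m] km c by auto
  next
    case False
    then show ?thesis using *[of b a m k] km c a_comm[of a b] by auto
  qed
qed

lemma level_ideal_mult:
  assumes "r \<in> carrier R" "a \<in> level_ideal i j"
  shows "r \<otimes> a \<in> level_ideal i j"
  using assms divides_prod_l[of "\<pi> [^] (_::nat)" a r]
  by (auto simp: level_ideal_def intro: divides_prod_l)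

lemma level_ideal_top: "r \<in> carrier R \<Longrightarrow> j \<le> i \<Longrightarrow> r \<in> level_ideal i j"
  by (auto simp: level_ideal_def intro!: exI[of _ "0::nat"] dividesI[of r])

lemma level_ideal_zero: "1 \<le> i \<Longrightarrow> \<zero> \<in> level_ideal i j"
  using shift_pow_ge[OF shift, of i j]
  by (auto simp: level_ideal_def intro!: exI[of _ j] dividesI[of \<zero>])

lemma level_ideal_antimono: "j \<le> j' \<Longrightarrow> level_ideal i j' \<subseteq> level_ideal i j"
  by (auto simp: level_ideal_def intro: order_trans)

lemma level_ideal_pi:
  assumes "1 \<le> j" "a \<in> level_ideal i j"
  shows "\<pi> \<otimes> a \<in> level_ideal i (\<rho> j)"
proof -
  obtain k where k: "j \<le> (\<rho> ^^ k) i" "\<pi> [^] k divides a" and a: "a \<in> carrier R"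
    using assms(2) by (auto simp: level_ideal_def)
  obtain c where c: "c \<in> carrier R" "a = \<pi> [^] k \<otimes> c" using k by (auto elim!: dividesE)
  have "\<rho> j \<le> (\<rho> ^^ Suc k) i" using shift_mono[OF shift assms(1) k(1)] by simp
  moreover have "\<pi> [^] (Suc k) divides \<pi> \<otimes> a"
    using c by (intro dividesI[of c]) (auto simp: m_ac)
  ultimately show ?thesis using a unfolding level_ideal_def by blast
qed

text \<open>The numbers \<open>\<rho>\<^sup>k(i)\<close> are the indices at which the filtration of \<open>S\<^sub>i\<close> drops. An element of step \<open>m\<close>
  therefore lies in step \<open>m + 1\<close>, unless \<open>m = \<rho>\<^sup>k(i)\<close>; for \<open>k > 0\<close> it is then \<open>\<pi>\<close> times an element of step
  \<open>\<rho>\<^bsup>k-1\<^esup>(i)\<close>, and the case \<open>k = 0\<close> is what the hypothesis \<open>top\<close> takes care of.\<close>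

lemma level_ideal_split:
  assumes i: "1 \<le> i" and a: "a \<in> level_ideal i m" and top: "i = m \<Longrightarrow> \<pi> divides a"
  shows "a \<in> level_ideal i (m + 1) \<or>
    (\<exists>j\<ge>1. m = \<rho> j \<and> (\<exists>u \<in> level_ideal i j. a = \<pi> \<otimes> u))"
proof -
  obtain k where k: "m \<le> (\<rho> ^^ k) i" "\<pi> [^] k divides a" and ac: "a \<in> carrier R"
    using a by (auto simp: level_ideal_def)
  show ?thesis
  proof (cases "m < (\<rho> ^^ k) i")
    case True
    then show ?thesis using k ac by (auto simp: level_ideal_def)
  next
    case False
    then have m: "m = (\<rho> ^^ k) i" using k by simp
    show ?thesis
    proof (cases k)
      case 0
      then have "m + 1 \<le> (\<rho> ^^ 1) i" using m shift_less[OF shift i] by simp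
      moreover have "\<pi> [^] (1::nat) divides a" using top m 0 by simp
      ultimately show ?thesis using ac unfolding level_ideal_def by blast
    next
      case (Suc n)
      obtain c where c: "c \<in> carrier R" "a = \<pi> [^] k \<otimes> c" using k by (auto elim!: dividesE)
      have "1 \<le> (\<rho> ^^ n) i" using shift_pow_ge[OF shift i, of n] i by simp
      moreover have "m = \<rho> ((\<rho> ^^ n) i)" using m Suc by simp
      moreover have "\<pi> [^] n \<otimes> c \<in> level_ideal i ((\<rho> ^^ n) i)"
        using c by (auto simp: level_ideal_def)
      moreover have "a = \<pi> \<otimes> (\<pi> [^] n \<otimes> c)" using c Suc by (simp add: m_ac)
      ultimately show ?thesis by blast
    qed
  qed
qed

lemma level_ideal_Suc_self:
  assumes "1 \<le> i" "a \<in> level_ideal i (i + 1)"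
  shows "\<pi> divides a"
proof -
  obtain k where k: "i + 1 \<le> (\<rho> ^^ k) i" "\<pi> [^] k divides a" using assms by (auto simp: level_ideal_def)
  then obtain n where n: "k = Suc n" by (cases k) auto
  obtain c where "c \<in> carrier R" "a = \<pi> [^] k \<otimes> c" using k by (auto elim!: dividesE)
  then show ?thesis using n by (intro dividesI[of "\<pi> [^] n \<otimes> c"]) (auto simp: m_ac)
qed

end

section \<open>Free filtered modules in coordinates\<close>

text \<open>A finite direct sum of modules \<open>S\<^sub>i\<close>, given by its coordinate functions. This form hides how the sum is
  built, here as a product of products together with one more product.\<close>

locale filtered_coordinates = shifted_dvr R \<pi> \<rho> + module R M
  for R :: "('a, 'm) ring_scheme" (structure) and \<pi> and \<rho>
    and M :: "('a, 'b, 'n) fmodule_scheme" (structure) +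
  fixes B :: "'i set" and lev :: "'i \<Rightarrow> nat" and coord :: "'i \<Rightarrow> 'b \<Rightarrow> 'a"
  assumes finite_B: "finite B"
    and lev_pos: "b \<in> B \<Longrightarrow> 1 \<le> lev b"
    and coord_closed [simp]: "b \<in> B \<Longrightarrow> x \<in> carrier M \<Longrightarrow> coord b x \<in> carrier R"
    and coord_add [simp]: "b \<in> B \<Longrightarrow> x \<in> carrier M \<Longrightarrow> y \<in> carrier M \<Longrightarrow>
        coord b (x \<oplus>\<^bsub>M\<^esub> y) = coord b x \<oplus> coord b y"
    and coord_smult [simp]: "b \<in> B \<Longrightarrow> r \<in> carrier R \<Longrightarrow> x \<in> carrier M \<Longrightarrow>
        coord b (r \<odot>\<^bsub>M\<^esub> x) = r \<otimes> coord b x"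
    and coord_inj: "x \<in> carrier M \<Longrightarrow> y \<in> carrier M \<Longrightarrow> (\<And>b. b \<in> B \<Longrightarrow> coord b x = coord b y) \<Longrightarrow> x = y"
    and coord_surj: "g \<in> B \<rightarrow> carrier R \<Longrightarrow> \<exists>x\<in>carrier M. \<forall>b\<in>B. coord b x = g b"
    and fil_eq: "1 \<le> j \<Longrightarrow> fil M j = {x \<in> carrier M. \<forall>b\<in>B. coord b x \<in> level_ideal (lev b) j}"
begin

lemma coord_zero [simp]: "b \<in> B \<Longrightarrow> coord b \<zero>\<^bsub>M\<^esub> = \<zero>"
  using coord_smult[of b \<zero> "\<zero>\<^bsub>M\<^esub>"] by simp

lemma fil_carrier: "1 \<le> j \<Longrightarrow> fil M j \<subseteq> carrier M"
  by (auto simp: fil_eq)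

lemma fil_submodule: "1 \<le> j \<Longrightarrow> submodule (fil M j) R M"
proof (rule submoduleI)
  fix a assume j: "1 \<le> j" and a: "a \<in> fil M j"
  then have "(\<ominus> \<one>) \<odot>\<^bsub>M\<^esub> a = \<ominus>\<^bsub>M\<^esub> a" using smult_l_minus[of \<one> a] by (auto simp: fil_eq)
  moreover have "(\<ominus> \<one>) \<odot>\<^bsub>M\<^esub> a \<in> fil M j" using j a by (auto simp: fil_eq intro: level_ideal_mult)
  ultimately show "\<ominus>\<^bsub>M\<^esub> a \<in> fil M j" by simp
qed (use level_ideal_zero lev_pos in \<open>auto simp: fil_eq intro: level_ideal_add level_ideal_mult\<close>)

lemma fil_antimono: "1 \<le> i \<Longrightarrow> i \<le> j \<Longrightarrow> fil M j \<subseteq> fil M i"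
  using level_ideal_antimono[of i j] by (auto simp: fil_eq)

lemma fil_1: "fil M 1 = carrier M"
  using lev_pos by (auto simp: fil_eq level_ideal_top)

lemma pi_fil: "1 \<le> j \<Longrightarrow> x \<in> fil M j \<Longrightarrow> \<pi> \<odot>\<^bsub>M\<^esub> x \<in> fil M (\<rho> j)"
  using shift_less[OF shift, of j] by (auto simp: fil_eq intro: level_ideal_pi)

lemma pi_pow_fil:
  assumes "1 \<le> j" "x \<in> fil M j"
  shows "\<pi> [^] k \<odot>\<^bsub>M\<^esub> x \<in> fil M ((\<rho> ^^ k) j)"
proof (induction k)
  case 0
  then show ?case using assms fil_carrier[of j] by auto
next
  case (Suc k)
  have "1 \<le> (\<rho> ^^ k) j" using shift_pow_ge[OF shift assms(1), of k] assms(1) by simp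
  from pi_fil[OF this Suc] show ?case
    using assms fil_carrier[of j] smult_assoc1[of \<pi> "\<pi> [^] k" x] by (auto simp: m_comm)
qed

lemma smult_level_ideal_fil:
  assumes "1 \<le> i" "1 \<le> j" "a \<in> level_ideal i j" "x \<in> fil M i"
  shows "a \<odot>\<^bsub>M\<^esub> x \<in> fil M j"
proof -
  obtain k c where k: "j \<le> (\<rho> ^^ k) i" and c: "c \<in> carrier R" "a = \<pi> [^] k \<otimes> c"
    using assms(3) by (auto simp: level_ideal_def elim!: dividesE)
  have xc: "x \<in> carrier M" using assms fil_carrier by auto
  have "\<pi> [^] k \<odot>\<^bsub>M\<^esub> x \<in> fil M j"
    using pi_pow_fil[OF assms(1,4), of k] fil_antimono[OF assms(2) k] by auto
  then have "c \<odot>\<^bsub>M\<^esub> (\<pi> [^] k \<odot>\<^bsub>M\<^esub> x) \<in> fil M j" using c submoduleE(4)[OF fil_submodule[OF assms(2)]] by auto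
  then show ?thesis using c xc smult_assoc1[of c "\<pi> [^] k" x] by (simp add: m_comm)
qed

definition bvec :: "'i \<Rightarrow> 'b" where
  "bvec b = (SOME x. x \<in> carrier M \<and> (\<forall>c\<in>B. coord c x = (if c = b then \<one> else \<zero>)))"

lemma bvec: "bvec b \<in> carrier M" "c \<in> B \<Longrightarrow> coord c (bvec b) = (if c = b then \<one> else \<zero>)"
proof -
  have "\<exists>x. x \<in> carrier M \<and> (\<forall>c\<in>B. coord c x = (if c = b then \<one> else \<zero>))"
    using coord_surj[of "\<lambda>c. if c = b then \<one> else \<zero>"] by auto
  from someI_ex[OF this] show "bvec b \<in> carrier M" "c \<in> B \<Longrightarrow> coord c (bvec b) = (if c = b then \<one> else \<zero>)"
    unfolding bvec_def by blast+
qed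

lemma bvec_fil: "b \<in> B \<Longrightarrow> bvec b \<in> fil M (lev b)"
  using bvec lev_pos by (auto simp: fil_eq level_ideal_zero intro: level_ideal_top)

lemma coord_finsum:
  assumes "finite A" "f \<in> A \<rightarrow> carrier M" "c \<in> B"
  shows "coord c (\<Oplus>\<^bsub>M\<^esub>b\<in>A. f b) = (\<Oplus>b\<in>A. coord c (f b))"
  using assms by (induction A) (auto simp: Pi_iff)

lemma bvec_expansion:
  assumes x: "x \<in> carrier M"
  shows "x = (\<Oplus>\<^bsub>M\<^esub>b\<in>B. coord b x \<odot>\<^bsub>M\<^esub> bvec b)"
proof (rule coord_inj[OF x])
  show "(\<Oplus>\<^bsub>M\<^esub>b\<in>B. coord b x \<odot>\<^bsub>M\<^esub> bvec b) \<in> carrier M" using x bvec by (auto intro: M.finsum_closed)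
  fix c assume c: "c \<in> B"
  have "coord c (\<Oplus>\<^bsub>M\<^esub>b\<in>B. coord b x \<odot>\<^bsub>M\<^esub> bvec b) = (\<Oplus>b\<in>B. coord c (coord b x \<odot>\<^bsub>M\<^esub> bvec b))"
    using finite_B c x bvec by (intro coord_finsum) auto
  also have "\<dots> = (\<Oplus>b\<in>B. if c = b then coord b x else \<zero>)"
    using c x bvec by (intro R.finsum_cong') auto
  also have "\<dots> = coord c x" using finite_B c x by (intro R.finsum_singleton) auto
  finally show "coord c x = coord c (\<Oplus>\<^bsub>M\<^esub>b\<in>B. coord b x \<odot>\<^bsub>M\<^esub> bvec b)" ..
qed

text \<open>The part of \<open>M\<^sub>i\<close> to which basis vectors of level \<open>i\<close> contribute only their \<open>\<pi>\<close>-multiples. The next two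
  lemmas describe it through the filtration alone, so its image under a character depends only on the
  images of the filtration steps.\<close>

definition imprimitive :: "nat \<Rightarrow> 'b set" where
  "imprimitive i = {x \<in> fil M i. \<forall>b\<in>B. lev b = i \<longrightarrow> \<pi> divides coord b x}"

lemma imprimitive_not_in_range:
  assumes i: "1 \<le> i" "i \<notin> \<rho> ` {1..}"
  shows "imprimitive i = fil M (i + 1)"
proof
  show "imprimitive i \<subseteq> fil M (i + 1)"
  proof
    fix x assume x: "x \<in> imprimitive i"
    have "coord b x \<in> level_ideal (lev b) (i + 1)" if "b \<in> B" for b
      using level_ideal_split[OF lev_pos[OF that], of "coord b x" i] x i that by (auto simp: imprimitive_def fil_eq)
    then show "x \<in> fil M (i + 1)" using x i by (auto simp: imprimitive_def fil_eq)
  qed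
  show "fil M (i + 1) \<subseteq> imprimitive i"
    using i fil_antimono[of i "i + 1"] by (auto simp: imprimitive_def fil_eq intro: level_ideal_Suc_self)
qed

text \<open>Every coordinate splits as \<open>\<pi> u + v\<close> by \<open>level_ideal_split\<close>, where \<open>j\<close> is the same for all coordinates
  because \<open>\<rho>\<close> is injective; the coordinates \<open>u\<close> and \<open>v\<close> are then assembled into two vectors.\<close>

lemma imprimitive_in_range:
  assumes j: "1 \<le> j"
  shows "imprimitive (\<rho> j) = {\<pi> \<odot>\<^bsub>M\<^esub> u \<oplus>\<^bsub>M\<^esub> v | u v. u \<in> fil M j \<and> v \<in> fil M (\<rho> j + 1)}"
proof
  have i: "1 \<le> \<rho> j" using shift_less[OF shift j] by simp
  show "imprimitive (\<rho> j) \<subseteq> {\<pi> \<odot>\<^bsub>M\<^esub> u \<oplus>\<^bsub>M\<^esub> v | u v. u \<in> fil M j \<and> v \<in> fil M (\<rho> j + 1)}"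
  proof
    fix x assume x: "x \<in> imprimitive (\<rho> j)"
    have xc: "x \<in> carrier M" using x i by (auto simp: imprimitive_def fil_eq)
    have "\<exists>u v. u \<in> level_ideal (lev b) j \<and> v \<in> level_ideal (lev b) (\<rho> j + 1) \<and> coord b x = \<pi> \<otimes> u \<oplus> v"
      if b: "b \<in> B" for b
    proof -
      have "coord b x \<in> level_ideal (lev b) (\<rho> j + 1) \<or>
        (\<exists>j'\<ge>1. \<rho> j = \<rho> j' \<and> (\<exists>u \<in> level_ideal (lev b) j'. coord b x = \<pi> \<otimes> u))"
        using x i b by (intro level_ideal_split lev_pos) (auto simp: imprimitive_def fil_eq)
      then show ?thesis
      proof
        assume "coord b x \<in> level_ideal (lev b) (\<rho> j + 1)"
        then show ?thesis using b xc level_ideal_zero[OF lev_pos[OF b], of j]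
          by (intro exI[of _ \<zero>] exI[of _ "coord b x"]) auto
      next
        assume "\<exists>j'\<ge>1. \<rho> j = \<rho> j' \<and> (\<exists>u \<in> level_ideal (lev b) j'. coord b x = \<pi> \<otimes> u)"
        then obtain u where u: "u \<in> level_ideal (lev b) j" "coord b x = \<pi> \<otimes> u"
          using shift_inj[OF shift j] by metis
        then show ?thesis using level_ideal_zero[OF lev_pos[OF b], of "\<rho> j + 1"] level_ideal_carrier[OF u(1)]
          by (intro exI[of _ u] exI[of _ \<zero>]) auto
      qed
    qed
    then obtain u v where uv: "\<And>b. b \<in> B \<Longrightarrow> u b \<in> level_ideal (lev b) j"
      "\<And>b. b \<in> B \<Longrightarrow> v b \<in> level_ideal (lev b) (\<rho> j + 1)"
      "\<And>b. b \<in> B \<Longrightarrow> coord b x = \<pi> \<otimes> u b \<oplus> v b" by metis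
    obtain y where y: "y \<in> carrier M" "\<And>b. b \<in> B \<Longrightarrow> coord b y = u b"
      using coord_surj[of u] uv level_ideal_carrier by blast
    obtain z where z: "z \<in> carrier M" "\<And>b. b \<in> B \<Longrightarrow> coord b z = v b"
      using coord_surj[of v] uv level_ideal_carrier by blast
    have "x = \<pi> \<odot>\<^bsub>M\<^esub> y \<oplus>\<^bsub>M\<^esub> z" using xc y z uv by (intro coord_inj) auto
    moreover have "y \<in> fil M j" "z \<in> fil M (\<rho> j + 1)" using y z uv j by (auto simp: fil_eq)
    ultimately show "x \<in> {\<pi> \<odot>\<^bsub>M\<^esub> u \<oplus>\<^bsub>M\<^esub> v | u v. u \<in> fil M j \<and> v \<in> fil M (\<rho> j + 1)}" by blast
  qed
  show "{\<pi> \<odot>\<^bsub>M\<^esub> u \<oplus>\<^bsub>M\<^esub> v | u v. u \<in> fil M j \<and> v \<in> fil M (\<rho> j + 1)} \<subseteq> imprimitive (\<rho> j)"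
  proof clarify
    fix u v assume u: "u \<in> fil M j" and v: "v \<in> fil M (\<rho> j + 1)"
    have uc: "u \<in> carrier M" "v \<in> carrier M" using u v j by (auto simp: fil_eq)
    have "\<pi> \<odot>\<^bsub>M\<^esub> u \<oplus>\<^bsub>M\<^esub> v \<in> fil M (\<rho> j)"
      using pi_fil[OF j u] v fil_antimono[OF i, of "\<rho> j + 1"] submoduleE(5)[OF fil_submodule[OF i]] by auto
    moreover have "\<pi> divides coord b (\<pi> \<odot>\<^bsub>M\<^esub> u \<oplus>\<^bsub>M\<^esub> v)" if b: "b \<in> B" "lev b = \<rho> j" for b
    proof -
      have "\<pi> divides coord b v"
        using b v i level_ideal_Suc_self[OF lev_pos[OF b(1)]] by (auto simp: fil_eq)
      then obtain c where "c \<in> carrier R" "coord b v = \<pi> \<otimes> c" by (auto elim!: dividesE)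
      then show ?thesis using b uc
        by (intro dividesI[of "coord b u \<oplus> c"]) (auto simp: r_distr)
    qed
    ultimately show "\<pi> \<odot>\<^bsub>M\<^esub> u \<oplus>\<^bsub>M\<^esub> v \<in> imprimitive (\<rho> j)" by (auto simp: imprimitive_def)
  qed
qed

end

section \<open>Filtered automorphisms\<close>

context filtered_coordinates
begin

lemma is_module: "module R M" ..

lemma fil_mapsD:
  assumes "\<phi> \<in> fil_maps R M M"
  shows "\<phi> \<in> linear_maps R M M" "x \<in> carrier M \<Longrightarrow> \<phi> x \<in> carrier M"
    "1 \<le> i \<Longrightarrow> x \<in> fil M i \<Longrightarrow> \<phi> x \<in> fil M i" "\<phi> \<in> extensional (carrier M)"
  using assms image_subset_iff[of \<phi> "fil M i" "fil M i"]
  unfolding fil_maps_def linear_maps_def by (auto simp: PiE_def)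

lemma fil_maps_compose:
  assumes "\<phi> \<in> fil_maps R M M" "\<psi> \<in> fil_maps R M M"
  shows "compose (carrier M) \<phi> \<psi> \<in> fil_maps R M M"
proof -
  have "compose (carrier M) \<phi> \<psi> x \<in> fil M i" if "1 \<le> i" "x \<in> fil M i" for i x
    using fil_mapsD[OF assms(1)] fil_mapsD[OF assms(2)] that fil_carrier[OF that(1)]
    by (auto simp: compose_def)
  then show ?thesis
    using fil_mapsD(1)[OF assms(1)] fil_mapsD(1)[OF assms(2)]
    by (auto simp: fil_maps_def intro: linear_map_compose)
qed

lemma fil_end_monoid: "monoid (fil_end R M)"
proof (rule monoidI)
  show "\<one>\<^bsub>fil_end R M\<^esub> \<in> carrier (fil_end R M)"
    using fil_carrier by (auto simp: fil_end_def fil_maps_def linear_maps_def)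
next
  fix x y z
  assume "x \<in> carrier (fil_end R M)" "y \<in> carrier (fil_end R M)" "z \<in> carrier (fil_end R M)"
  then show "x \<otimes>\<^bsub>fil_end R M\<^esub> y \<otimes>\<^bsub>fil_end R M\<^esub> z = x \<otimes>\<^bsub>fil_end R M\<^esub> (y \<otimes>\<^bsub>fil_end R M\<^esub> z)"
    using fil_mapsD(2)[of z] by (auto simp: fil_end_def compose_def fun_eq_iff)
next
  fix x assume x: "x \<in> carrier (fil_end R M)"
  then have x': "x \<in> fil_maps R M M" by (simp add: fil_end_def)
  show "\<one>\<^bsub>fil_end R M\<^esub> \<otimes>\<^bsub>fil_end R M\<^esub> x = x"
    using fil_mapsD(2,4)[OF x'] by (auto simp: fil_end_def compose_def fun_eq_iff extensional_def)
  show "x \<otimes>\<^bsub>fil_end R M\<^esub> \<one>\<^bsub>fil_end R M\<^esub> = x"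
    using fil_mapsD(2,4)[OF x'] by (auto simp: fil_end_def compose_def fun_eq_iff extensional_def)
qed (auto simp: fil_end_def intro: fil_maps_compose)

lemma Aut_filtI:
  assumes "\<phi> \<in> fil_maps R M M" "\<psi> \<in> fil_maps R M M"
    and "\<And>x. x \<in> carrier M \<Longrightarrow> \<phi> (\<psi> x) = x" "\<And>x. x \<in> carrier M \<Longrightarrow> \<psi> (\<phi> x) = x"
  shows "\<phi> \<in> carrier (Aut_filt R M)"
  unfolding Aut_filt_def units_of_carrier Units_def
  using assms by (auto simp: fil_end_def compose_def fun_eq_iff intro!: bexI[of _ \<psi>])

lemma Aut_filtE:
  assumes "\<phi> \<in> carrier (Aut_filt R M)"
  obtains \<psi> where "\<phi> \<in> fil_maps R M M" "\<psi> \<in> fil_maps R M M"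
    and "\<And>x. x \<in> carrier M \<Longrightarrow> \<phi> (\<psi> x) = x" "\<And>x. x \<in> carrier M \<Longrightarrow> \<psi> (\<phi> x) = x"
proof -
  obtain \<psi> where *: "\<phi> \<in> fil_maps R M M" "\<psi> \<in> fil_maps R M M"
    "compose (carrier M) \<phi> \<psi> = (\<lambda>x\<in>carrier M. x)" "compose (carrier M) \<psi> \<phi> = (\<lambda>x\<in>carrier M. x)"
    using assms unfolding Aut_filt_def units_of_carrier Units_def by (auto simp: fil_end_def)
  have "\<phi> (\<psi> x) = x" "\<psi> (\<phi> x) = x" if "x \<in> carrier M" for x
    using *(3,4)[THEN fun_cong, of x] that by (auto simp: compose_def)
  then show ?thesis using that *(1,2) by blast
qed

abbreviation orb where "orb \<chi> \<equiv> orbit (Aut_filt R M) (precomp M) \<chi>"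

lemma orbit_refl:
  assumes "\<chi> \<in> linear_maps R M N"
  shows "\<chi> \<in> orb \<chi>"
proof -
  have "(\<lambda>x\<in>carrier M. x) \<in> fil_maps R M M"
    using fil_carrier by (auto simp: fil_maps_def linear_maps_def)
  then have "(\<lambda>x\<in>carrier M. x) \<in> carrier (Aut_filt R M)"
    by (intro Aut_filtI[of _ "\<lambda>x\<in>carrier M. x"]) auto
  moreover have "precomp M (\<lambda>x\<in>carrier M. x) \<chi> = \<chi>"
    using linear_mapsD(4)[OF assms] by (auto simp: precomp_def compose_def fun_eq_iff)
  ultimately show ?thesis unfolding orbit_def by (intro CollectI exI[of _ "\<lambda>x\<in>carrier M. x"]) simp
qed

lemma orbit_trans:
  assumes "\<chi>' \<in> orb \<chi>" "\<chi>'' \<in> orb \<chi>'"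
  shows "\<chi>'' \<in> orb \<chi>"
proof -
  interpret E: monoid "fil_end R M" by (rule fil_end_monoid)
  obtain \<phi> \<psi> where *: "\<phi> \<in> carrier (Aut_filt R M)" "\<chi>' = precomp M \<phi> \<chi>"
    "\<psi> \<in> carrier (Aut_filt R M)" "\<chi>'' = precomp M \<psi> \<chi>'"
    using assms by (auto simp: orbit_def)
  have "\<phi> \<otimes>\<^bsub>fil_end R M\<^esub> \<psi> \<in> carrier (Aut_filt R M)"
    using *(1,3) E.Units_m_closed[of \<phi> \<psi>] by (simp add: Aut_filt_def units_of_carrier)
  then have "compose (carrier M) \<phi> \<psi> \<in> carrier (Aut_filt R M)" by (simp add: fil_end_def)
  moreover have "\<chi>'' = precomp M (compose (carrier M) \<phi> \<psi>) \<chi>"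
  proof -
    have "\<psi> \<in> fil_maps R M M" using *(3) by (rule Aut_filtE)
    then show ?thesis using * fil_mapsD(2)[of \<psi>] by (auto simp: precomp_def compose_def fun_eq_iff)
  qed
  ultimately show ?thesis unfolding orbit_def by blast
qed

text \<open>A perturbation of the identity that moves only the \<open>b\<close>-th basis vector, namely to \<open>e\<^sub>b + z\<close>.\<close>

definition rank_one_shift :: "'i \<Rightarrow> 'b \<Rightarrow> 'b \<Rightarrow> 'b" where
  "rank_one_shift b z = (\<lambda>x\<in>carrier M. x \<oplus>\<^bsub>M\<^esub> coord b x \<odot>\<^bsub>M\<^esub> z)"

text \<open>The filtration is respected because \<open>z\<close> has at least the weight of \<open>e\<^sub>b\<close>, so \<open>x\<^sub>b z\<close> has at least the weight
  of \<open>x\<^sub>b e\<^sub>b\<close>.\<close>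

lemma rank_one_shift_fil_map:
  assumes b: "b \<in> B" and z: "z \<in> fil M (lev b)"
  shows "rank_one_shift b z \<in> fil_maps R M M"
proof -
  have zc: "z \<in> carrier M" using z fil_carrier lev_pos b by blast
  have "rank_one_shift b z \<in> linear_maps R M M"
    unfolding linear_maps_def rank_one_shift_def using b zc
    by (auto simp: smult_l_distr smult_r_distr smult_assoc1 M.a_ac)
  moreover have "rank_one_shift b z x \<in> fil M j" if j: "1 \<le> j" and x: "x \<in> fil M j" for j x
  proof -
    have "coord b x \<in> level_ideal (lev b) j" using x j b by (auto simp: fil_eq)
    then have "coord b x \<odot>\<^bsub>M\<^esub> z \<in> fil M j"
      using smult_level_ideal_fil[OF lev_pos[OF b] j _ z] by simp
    then show ?thesis
      using x submoduleE(5)[OF fil_submodule[OF j]] fil_carrier[OF j] by (auto simp: rank_one_shift_def)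
  qed
  ultimately show ?thesis by (auto simp: fil_maps_def)
qed

lemma rank_one_shift_compose:
  assumes b: "b \<in> B" and z: "z \<in> carrier M" and w: "w \<in> carrier M" and x: "x \<in> carrier M"
  shows "rank_one_shift b z (rank_one_shift b w x)
    = x \<oplus>\<^bsub>M\<^esub> coord b x \<odot>\<^bsub>M\<^esub> (w \<oplus>\<^bsub>M\<^esub> (\<one> \<oplus> coord b w) \<odot>\<^bsub>M\<^esub> z)"
  using assms
  by (simp add: rank_one_shift_def smult_l_distr smult_r_distr smult_assoc1 M.a_ac)

text \<open>The inverse is again of this form, with \<open>z\<close> replaced by \<open>- (1 + z\<^sub>b)\<^sup>-\<^sup>1 z\<close>. This covers both rescaling of a
  basis vector by a unit and adding a vector without \<open>b\<close>-coordinate.\<close>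

lemma rank_one_shift_Aut:
  assumes b: "b \<in> B" and z: "z \<in> fil M (lev b)" and u: "\<one> \<oplus> coord b z \<in> Units R"
  shows "rank_one_shift b z \<in> carrier (Aut_filt R M)"
proof -
  define v where "v = \<one> \<oplus> coord b z"
  define c where "c = \<ominus> (inv v)"
  define w where "w = c \<odot>\<^bsub>M\<^esub> z"
  have zc: "z \<in> carrier M" using z fil_carrier lev_pos b by blast
  have v: "v \<in> Units R" "v \<in> carrier R" using u by (auto simp: v_def)
  have c: "c \<in> carrier R" using v by (auto simp: c_def)
  have vc: "v \<otimes> c = \<ominus> \<one>" using v by (simp add: c_def r_minus)
  have wF: "w \<in> fil M (lev b)"
    using submoduleE(4)[OF fil_submodule[OF lev_pos[OF b]]] z c by (auto simp: w_def)
  have wc: "w \<in> carrier M" using zc c by (simp add: w_def)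
  have cb: "coord b z \<in> carrier R" using b zc by simp
  have "z \<oplus>\<^bsub>M\<^esub> v \<odot>\<^bsub>M\<^esub> w = (\<one> \<oplus> v \<otimes> c) \<odot>\<^bsub>M\<^esub> z"
    using zc c v by (simp add: w_def smult_l_distr smult_assoc1)
  then have 1: "z \<oplus>\<^bsub>M\<^esub> (\<one> \<oplus> coord b z) \<odot>\<^bsub>M\<^esub> w = \<zero>\<^bsub>M\<^esub>"
    using vc zc by (simp add: v_def R.r_neg)
  have "c \<oplus> (\<one> \<oplus> c \<otimes> coord b z) = \<one> \<oplus> v \<otimes> c"
    using c cb unfolding v_def by algebra
  then have "c \<oplus> (\<one> \<oplus> c \<otimes> coord b z) = \<zero>" using vc by (simp add: R.r_neg)
  moreover have "w \<oplus>\<^bsub>M\<^esub> (\<one> \<oplus> coord b w) \<odot>\<^bsub>M\<^esub> z = (c \<oplus> (\<one> \<oplus> c \<otimes> coord b z)) \<odot>\<^bsub>M\<^esub> z"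
    using c zc b cb smult_l_distr[of c "\<one> \<oplus> c \<otimes> coord b z" z] by (simp add: w_def)
  ultimately have 2: "w \<oplus>\<^bsub>M\<^esub> (\<one> \<oplus> coord b w) \<odot>\<^bsub>M\<^esub> z = \<zero>\<^bsub>M\<^esub>" using zc by simp
  show ?thesis
  proof (rule Aut_filtI)
    show "rank_one_shift b z \<in> fil_maps R M M" "rank_one_shift b w \<in> fil_maps R M M"
      using b z wF by (auto intro: rank_one_shift_fil_map)
    show "rank_one_shift b z (rank_one_shift b w x) = x" if "x \<in> carrier M" for x
      using rank_one_shift_compose[OF b zc wc that] 2 that b by simp
    show "rank_one_shift b w (rank_one_shift b z x) = x" if "x \<in> carrier M" for x
      using rank_one_shift_compose[OF b wc zc that] 1 that b by simp
  qed
qed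

lemma move_basis_vector:
  assumes b: "b \<in> B" and y: "y \<in> fil M (lev b)" "coord b y \<in> Units R"
  obtains \<phi> where "\<phi> \<in> carrier (Aut_filt R M)" "\<phi> (bvec b) = y"
    "\<And>c. c \<in> B \<Longrightarrow> c \<noteq> b \<Longrightarrow> \<phi> (bvec c) = bvec c"
proof -
  define z where "z = y \<oplus>\<^bsub>M\<^esub> \<ominus>\<^bsub>M\<^esub> bvec b"
  have yc: "y \<in> carrier M" using y fil_carrier lev_pos b by blast
  have zF: "z \<in> fil M (lev b)"
    using y bvec_fil[OF b] submoduleE(3,5)[OF fil_submodule[OF lev_pos[OF b]]] by (auto simp: z_def)
  have zc: "z \<in> carrier M" using yc bvec by (simp add: z_def)
  have "y = bvec b \<oplus>\<^bsub>M\<^esub> z" using yc bvec(1)[of b] by (simp add: z_def M.a_ac M.r_neg)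
  moreover from this have "coord b y = \<one> \<oplus> coord b z" using b zc bvec by simp
  ultimately show ?thesis
    using that[of "rank_one_shift b z"] rank_one_shift_Aut[OF b zF] y b zc bvec
    by (simp add: rank_one_shift_def)
qed

lemma linear_map_eq_on_basis:
  assumes "module R N" "h \<in> linear_maps R M N" "h' \<in> linear_maps R M N"
    and eq: "\<And>b. b \<in> B \<Longrightarrow> h (bvec b) = h' (bvec b)"
  shows "h = h'"
proof
  interpret N: module R N by fact
  fix x
  show "h x = h' x"
  proof (cases "x \<in> carrier M")
    case True
    have *: "k x = (\<Oplus>\<^bsub>N\<^esub>b\<in>B. coord b x \<odot>\<^bsub>N\<^esub> k (bvec b))" if k: "k \<in> linear_maps R M N" for k
    proof -
      have "k x = k (\<Oplus>\<^bsub>M\<^esub>b\<in>B. coord b x \<odot>\<^bsub>M\<^esub> bvec b)" using bvec_expansion[OF True] by simp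
      also have "\<dots> = (\<Oplus>\<^bsub>N\<^esub>b\<in>B. k (coord b x \<odot>\<^bsub>M\<^esub> bvec b))"
        using True finite_B bvec by (intro linear_map_finsum[OF is_module assms(1) k]) auto
      also have "\<dots> = (\<Oplus>\<^bsub>N\<^esub>b\<in>B. coord b x \<odot>\<^bsub>N\<^esub> k (bvec b))"
        using True bvec linear_mapsD[OF k] by (intro N.M.finsum_cong') auto
      finally show ?thesis .
    qed
    show ?thesis unfolding *[OF assms(2)] *[OF assms(3)]
      using eq True bvec linear_mapsD(1)[OF assms(3)] by (intro N.M.finsum_cong') auto
  next
    case False
    then show ?thesis using linear_mapsD(4)[OF assms(2)] linear_mapsD(4)[OF assms(3)] by simp
  qed
qed

end

section \<open>Images of the filtration under a character\<close>

locale character_setting =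
  filtered_coordinates R \<pi> \<rho> M B lev coord + Q: uniserial_module R \<pi> Q
  for R :: "('a, 'm) ring_scheme" (structure) and \<pi> and \<rho>
    and M :: "('a, 'b, 'n) fmodule_scheme" (structure)
    and B :: "'i set" and lev :: "'i \<Rightarrow> nat" and coord :: "'i \<Rightarrow> 'b \<Rightarrow> 'a"
    and Q :: "('a, 'c, 'k) module_scheme"
begin

text \<open>The characters, with continuity stated as vanishing on some step of the filtration; see
  \<open>continuous_character_iff\<close>.\<close>

definition chars :: "('b \<Rightarrow> 'c) set" where
  "chars = {\<chi> \<in> linear_maps R M Q. \<exists>j\<ge>1. \<chi> ` fil M j \<subseteq> {\<zero>\<^bsub>Q\<^esub>}}"

definition jump_sets :: "nat set set" where
  "jump_sets = {A. finite A \<and> A \<subseteq> {1..} \<and>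
      (\<forall>a\<in>A. \<forall>b\<in>A. a < b \<longrightarrow> \<rho> a \<le> b) \<and> A - \<rho> ` A \<subseteq> lev ` B}"

lemma Q_module: "module R Q" ..

lemma zero_fil: "1 \<le> j \<Longrightarrow> \<zero>\<^bsub>M\<^esub> \<in> fil M j"
  using lev_pos level_ideal_zero by (simp add: fil_eq)

lemma image_submodule: "\<chi> \<in> linear_maps R M Q \<Longrightarrow> 1 \<le> i \<Longrightarrow> submodule (\<chi> ` fil M i) R Q"
  using linear_map_image_submodule[OF is_module Q_module] fil_submodule by blast

lemma zero_image:
  assumes "\<chi> \<in> linear_maps R M Q" "1 \<le> i"
  shows "\<zero>\<^bsub>Q\<^esub> \<in> \<chi> ` fil M i"
  using imageI[OF zero_fil[OF assms(2)], of \<chi>] linear_map_zero[OF is_module Q_module assms(1)] by simp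

lemma image_antimono: "1 \<le> i \<Longrightarrow> i \<le> j \<Longrightarrow> \<chi> ` fil M j \<subseteq> \<chi> ` fil M i"
  using fil_antimono by blast

lemma pi_image:
  assumes "\<chi> \<in> linear_maps R M Q" "1 \<le> i" "x \<in> \<chi> ` fil M i"
  shows "\<pi> \<odot>\<^bsub>Q\<^esub> x \<in> \<chi> ` fil M (\<rho> i)"
proof -
  obtain y where y: "y \<in> fil M i" "x = \<chi> y" using assms by auto
  then have "\<pi> \<odot>\<^bsub>Q\<^esub> x = \<chi> (\<pi> \<odot>\<^bsub>M\<^esub> y)"
    using linear_mapsD(3)[OF assms(1), of \<pi> y] fil_carrier[OF assms(2)] by auto
  then show ?thesis using pi_fil[OF assms(2) y(1)] by blast
qed

lemma jumpE:
  assumes "i \<in> jumps M \<chi>"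
  obtains y where "1 \<le> i" "y \<in> fil M i" "\<chi> y \<notin> \<chi> ` fil M (i + 1)"
  using assms image_antimono[of i "i + 1" \<chi>] by (auto simp: jumps_def)

lemma not_jump: "1 \<le> i \<Longrightarrow> i \<notin> jumps M \<chi> \<Longrightarrow> \<chi> ` fil M i = \<chi> ` fil M (i + 1)"
  by (auto simp: jumps_def)

text \<open>At a jump the image is as large as \<open>\<pi> M\<^sub>i \<subseteq> M\<^bsub>i+1\<^esub>\<close> permits: an \<open>x\<close> outside \<open>\<chi>(M\<^sub>i)\<close> with
  \<open>\<pi> x \<in> \<chi>(M\<^bsub>i+1\<^esub>)\<close> would make \<open>\<chi>(y)\<close>, with \<open>y\<close> a witness of the jump, a multiple of \<open>\<pi> x\<close>.\<close>

lemma jump_image: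
  assumes \<chi>: "\<chi> \<in> linear_maps R M Q" and i: "i \<in> jumps M \<chi>"
  shows "\<chi> ` fil M i = {x \<in> carrier Q. \<pi> \<odot>\<^bsub>Q\<^esub> x \<in> \<chi> ` fil M (i + 1)}"
proof -
  obtain y where y: "1 \<le> i" "y \<in> fil M i" "\<chi> y \<notin> \<chi> ` fil M (i + 1)" using i by (rule jumpE)
  have sub: "submodule (\<chi> ` fil M i) R Q" "submodule (\<chi> ` fil M (i + 1)) R Q"
    using image_submodule[OF \<chi>] y(1) by auto
  have yc: "\<chi> y \<in> carrier Q" using Q.submoduleE(1)[OF sub(1)] y by auto
  have "\<pi> \<odot>\<^bsub>Q\<^esub> x \<in> \<chi> ` fil M (i + 1)" if "x \<in> \<chi> ` fil M i" for x
    using pi_image[OF \<chi> y(1) that] image_antimono[of "i + 1" "\<rho> i" \<chi>] shift_less[OF shift y(1)] by auto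
  moreover have "x \<in> \<chi> ` fil M i"
    if x: "x \<in> carrier Q" "\<pi> \<odot>\<^bsub>Q\<^esub> x \<in> \<chi> ` fil M (i + 1)" for x
  proof (rule ccontr)
    assume "x \<notin> \<chi> ` fil M i"
    from Q.outside_submodule[OF sub(1) x(1) this, of "\<chi> y"] y
    obtain r where r: "r \<in> carrier R" "\<chi> y = (\<pi> \<otimes> r) \<odot>\<^bsub>Q\<^esub> x" by auto
    then have "\<chi> y = r \<odot>\<^bsub>Q\<^esub> (\<pi> \<odot>\<^bsub>Q\<^esub> x)" using x Q.smult_assoc1[of r \<pi> x] by (simp add: m_comm)
    then show False using y(3) Q.submoduleE(4)[OF sub(2) r(1) x(2)] by simp
  qed
  ultimately show ?thesis using Q.submoduleE(1)[OF sub(1)] by blast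
qed

text \<open>Descending induction from a step on which both characters vanish: off the jumps the image does not
  change, and at a jump \<open>jump_image\<close> recovers it from the next one.\<close>

lemma same_jumps_same_images:
  assumes \<chi>: "\<chi> \<in> chars" "\<chi>' \<in> chars" and jumps: "jumps M \<chi> = jumps M \<chi>'" and i: "1 \<le> i"
  shows "\<chi> ` fil M i = \<chi>' ` fil M i"
proof -
  have lin: "\<chi> \<in> linear_maps R M Q" "\<chi>' \<in> linear_maps R M Q" using \<chi> by (auto simp: chars_def)
  obtain j j' where j: "1 \<le> j" "\<chi> ` fil M j \<subseteq> {\<zero>\<^bsub>Q\<^esub>}" "1 \<le> j'" "\<chi>' ` fil M j' \<subseteq> {\<zero>\<^bsub>Q\<^esub>}"
    using \<chi> by (auto simp: chars_def)
  define m where "m = i + j + j'"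
  have "j \<le> m" "j' \<le> m" by (auto simp: m_def)
  then have sub: "\<chi> ` fil M m \<subseteq> {\<zero>\<^bsub>Q\<^esub>}" "\<chi>' ` fil M m \<subseteq> {\<zero>\<^bsub>Q\<^esub>}"
    using image_antimono[OF j(1), of m \<chi>] image_antimono[OF j(3), of m \<chi>'] j(2,4)
    by (blast intro: subset_trans)+
  have eq: "X = {\<zero>\<^bsub>Q\<^esub>}" if "X \<subseteq> {\<zero>\<^bsub>Q\<^esub>}" "\<zero>\<^bsub>Q\<^esub> \<in> X" for X using that by blast
  have "1 \<le> m" using i by (simp add: m_def)
  then have m: "\<chi> ` fil M m = \<chi>' ` fil M m"
    using eq[OF sub(1) zero_image[OF lin(1)]] eq[OF sub(2) zero_image[OF lin(2)]] by simp
  have "i \<le> m" by (simp add: m_def)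
  then show ?thesis
    using i
  proof (induction i rule: inc_induct)
    case base
    show ?case by (rule m)
  next
    case (step n)
    then have IH: "\<chi> ` fil M (n + 1) = \<chi>' ` fil M (n + 1)" by simp
    show ?case
    proof (cases "n \<in> jumps M \<chi>")
      case True
      then show ?thesis using jump_image[OF lin(1)] jump_image[OF lin(2)] IH jumps by simp
    next
      case False
      then show ?thesis using not_jump[of n \<chi>] not_jump[of n \<chi>'] IH jumps step by simp
    qed
  qed
qed

text \<open>Finiteness comes from continuity. For the spacing condition, a jump at \<open>b\<close> with \<open>a < b < \<rho>(a)\<close> has a
  witness whose value is a multiple of \<open>\<pi> \<chi>(y)\<close> for the witness \<open>y\<close> at \<open>a\<close>, hence lies in
  \<open>\<chi>(M\<^bsub>\<rho>(a)\<^esub>) \<subseteq> \<chi>(M\<^bsub>b+1\<^esub>)\<close>. For the condition on the starting points, if no basis vector has level \<open>b\<close> then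
  \<open>M\<^sub>b\<close> is imprimitive, so a jump at \<open>b\<close> requires \<open>b = \<rho>(a)\<close> with a jump at \<open>a\<close>.\<close>

lemma jumps_in_jump_sets:
  assumes \<chi>: "\<chi> \<in> chars"
  shows "jumps M \<chi> \<in> jump_sets"
proof -
  have lin: "\<chi> \<in> linear_maps R M Q" using \<chi> by (auto simp: chars_def)
  have pos: "jumps M \<chi> \<subseteq> {1..}" by (auto simp: jumps_def)
  obtain j where j: "1 \<le> j" "\<chi> ` fil M j \<subseteq> {\<zero>\<^bsub>Q\<^esub>}" using \<chi> by (auto simp: chars_def)
  have "i < j" if i: "i \<in> jumps M \<chi>" for i
  proof (rule ccontr)
    assume "\<not> i < j"
    obtain y where y: "1 \<le> i" "y \<in> fil M i" "\<chi> y \<notin> \<chi> ` fil M (i + 1)" using i by (rule jumpE)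
    have "\<chi> y \<in> \<chi> ` fil M j" using y fil_antimono[of j i] j \<open>\<not> i < j\<close> by auto
    then have "\<chi> y = \<zero>\<^bsub>Q\<^esub>" using j by blast
    then show False using y(3) zero_image[OF lin, of "i + 1"] by simp
  qed
  then have "jumps M \<chi> \<subseteq> {..<j}" by auto
  then have fin: "finite (jumps M \<chi>)" by (rule finite_subset) simp
  have gap: "\<rho> a \<le> b" if a: "a \<in> jumps M \<chi>" and b: "b \<in> jumps M \<chi>" and ab: "a < b" for a b
  proof (rule ccontr)
    assume "\<not> \<rho> a \<le> b"
    obtain y where y: "1 \<le> a" "y \<in> fil M a" "\<chi> y \<notin> \<chi> ` fil M (a + 1)" using a by (rule jumpE)
    obtain z where z: "1 \<le> b" "z \<in> fil M b" "\<chi> z \<notin> \<chi> ` fil M (b + 1)" using b by (rule jumpE)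
    have yc: "\<chi> y \<in> carrier Q" using linear_mapsD(1)[OF lin] y fil_carrier by blast
    have "\<chi> z \<in> \<chi> ` fil M (a + 1)" using z ab image_antimono[of "a + 1" b \<chi>] by auto
    then obtain r where r: "r \<in> carrier R" "\<chi> z = (\<pi> \<otimes> r) \<odot>\<^bsub>Q\<^esub> \<chi> y"
      using Q.outside_submodule[OF image_submodule[OF lin] yc y(3)] y(1) by auto
    have "\<chi> z = r \<odot>\<^bsub>Q\<^esub> (\<pi> \<odot>\<^bsub>Q\<^esub> \<chi> y)" using r yc Q.smult_assoc1[of r \<pi> "\<chi> y"] by (simp add: m_comm)
    moreover have "\<pi> \<odot>\<^bsub>Q\<^esub> \<chi> y \<in> \<chi> ` fil M (b + 1)"
      using pi_image[OF lin y(1), of "\<chi> y"] y(2) \<open>\<not> \<rho> a \<le> b\<close> z(1) image_antimono[of "b + 1" "\<rho> a" \<chi>] by auto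
    ultimately show False
      using z(3) Q.submoduleE(4)[OF image_submodule[OF lin] r(1)] z(1) by auto
  qed
  have "b \<in> lev ` B" if b: "b \<in> jumps M \<chi>" "b \<notin> \<rho> ` jumps M \<chi>" for b
  proof (rule ccontr)
    assume nb: "b \<notin> lev ` B"
    obtain z where z: "1 \<le> b" "z \<in> fil M b" "\<chi> z \<notin> \<chi> ` fil M (b + 1)" using b(1) by (rule jumpE)
    have z_imp: "z \<in> imprimitive b" using z nb by (auto simp: imprimitive_def)
    show False
    proof (cases "b \<in> \<rho> ` {1..}")
      case False
      then show False using imprimitive_not_in_range[OF z(1)] z_imp z(3) by auto
    next
      case True
      then obtain a where a: "1 \<le> a" "b = \<rho> a" by auto
      then have anj: "a \<notin> jumps M \<chi>" using b by auto
      obtain u v where uv: "u \<in> fil M a" "v \<in> fil M (b + 1)" "z = \<pi> \<odot>\<^bsub>M\<^esub> u \<oplus>\<^bsub>M\<^esub> v"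
        using z_imp imprimitive_in_range[OF a(1)] a(2) by auto
      have c: "u \<in> carrier M" "v \<in> carrier M" using uv a(1) by (auto simp: fil_eq)
      have "\<chi> u \<in> \<chi> ` fil M (a + 1)" using uv(1) not_jump[OF a(1) anj] by auto
      then have "\<pi> \<odot>\<^bsub>Q\<^esub> \<chi> u \<in> \<chi> ` fil M (\<rho> (a + 1))" using pi_image[OF lin] a(1) by simp
      then have "\<pi> \<odot>\<^bsub>Q\<^esub> \<chi> u \<in> \<chi> ` fil M (b + 1)"
        using image_antimono[of "b + 1" "\<rho> (a + 1)" \<chi>] shift_strict_mono[OF shift a(1), of "a + 1"] a(2) by auto
      moreover have "\<chi> z = \<pi> \<odot>\<^bsub>Q\<^esub> \<chi> u \<oplus>\<^bsub>Q\<^esub> \<chi> v"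
        using uv(3) c linear_mapsD[OF lin] by simp
      ultimately show False
        using z(3) uv(2) Q.submoduleE(5)[OF image_submodule[OF lin]] by auto
    qed
  qed
  then show ?thesis using pos fin gap by (auto simp: jump_sets_def)
qed

end

section \<open>Every extended jump set occurs\<close>

text \<open>Each interval \<open>[j, \<rho>(j))\<close> contains at most one element of \<open>A\<close>.\<close>

lemma gap_card_le:
  fixes A :: "nat set"
  assumes \<rho>: "is_shift \<rho>" and fin: "finite A"
    and gap: "\<And>a b. a \<in> A \<Longrightarrow> b \<in> A \<Longrightarrow> a < b \<Longrightarrow> \<rho> a \<le> b" and i: "1 \<le> i"
  shows "card {b \<in> A. i \<le> b} \<le> card {b \<in> A. (\<rho> ^^ k) i \<le> b} + k"
proof (induction k)
  case (Suc k)
  define j where "j = (\<rho> ^^ k) i"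
  have j: "1 \<le> j" using shift_pow_ge[OF \<rho> i, of k] i by (simp add: j_def)
  define D where "D = {b \<in> A. j \<le> b \<and> b < \<rho> j}"
  have finD: "finite D" using fin by (simp add: D_def)
  have "b = c" if "b \<in> D" "c \<in> D" for b c
  proof (rule ccontr)
    have *: False if "b \<in> D" "c \<in> D" "b < c" for b c
    proof -
      have "\<rho> j \<le> \<rho> b" using shift_mono[OF \<rho> j, of b] that by (simp add: D_def)
      also have "\<dots> \<le> c" using gap that by (simp add: D_def)
      finally show False using that by (simp add: D_def)
    qed
    assume "b \<noteq> c"
    then show False using *[of b c] *[of c b] that by (cases b c rule: linorder_cases) auto
  qed
  then have "card D \<le> 1" using finD by (simp add: card_le_Suc0_iff_eq)
  have "{b \<in> A. j \<le> b} \<subseteq> {b \<in> A. \<rho> j \<le> b} \<union> D" by (auto simp: D_def)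
  then have "card {b \<in> A. j \<le> b} \<le> card ({b \<in> A. \<rho> j \<le> b} \<union> D)"
    using fin finD by (intro card_mono) auto
  also have "\<dots> \<le> card {b \<in> A. \<rho> j \<le> b} + card D" by (rule card_Un_le)
  finally show ?case using Suc \<open>card D \<le> 1\<close> by (simp add: j_def)
qed simp

text \<open>Following \<open>\<rho>\<close> backwards inside \<open>A\<close> leads to a starting point, and \<open>A\<close> has no elements strictly between
  consecutive members of the chain, so each step changes the count by exactly one.\<close>

lemma gap_chain_start:
  fixes A :: "nat set"
  assumes \<rho>: "is_shift \<rho>" and fin: "finite A" and pos: "A \<subseteq> {1..}"
    and gap: "\<And>a b. a \<in> A \<Longrightarrow> b \<in> A \<Longrightarrow> a < b \<Longrightarrow> \<rho> a \<le> b"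
    and b: "b \<in> A"
  shows "\<exists>a \<in> A - \<rho> ` A. \<exists>k. b = (\<rho> ^^ k) a \<and> card {c \<in> A. a \<le> c} = card {c \<in> A. b \<le> c} + k"
  using b
proof (induction b rule: less_induct)
  case (less b)
  show ?case
  proof (cases "b \<in> \<rho> ` A")
    case False
    then show ?thesis using less.prems by (intro bexI[of _ b] exI[of _ "0::nat"]) auto
  next
    case True
    then obtain b' where b': "b' \<in> A" "b = \<rho> b'" by auto
    have lt: "b' < b" using shift_less[OF \<rho>, of b'] b' pos by auto
    obtain a k where a: "a \<in> A - \<rho> ` A" "b' = (\<rho> ^^ k) a"
      "card {c \<in> A. a \<le> c} = card {c \<in> A. b' \<le> c} + k"
      using less.IH[OF lt b'(1)] by auto
    have "{c \<in> A. b' \<le> c} = insert b' {c \<in> A. b \<le> c}"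
      using gap[OF b'(1)] b' lt by (auto simp: le_less)
    then have "card {c \<in> A. b' \<le> c} = Suc (card {c \<in> A. b \<le> c})" using fin lt by simp
    then show ?thesis using a b' by (intro bexI[OF _ a(1)] exI[of _ "Suc k"]) auto
  qed
qed

context character_setting
begin

lemma combination_linear:
  assumes v: "v \<in> B \<rightarrow> carrier Q"
  shows "(\<lambda>x\<in>carrier M. \<Oplus>\<^bsub>Q\<^esub>b\<in>B. coord b x \<odot>\<^bsub>Q\<^esub> v b) \<in> linear_maps R M Q"
proof -
  have vc: "b \<in> B \<Longrightarrow> v b \<in> carrier Q" for b using v by auto
  have "(\<Oplus>\<^bsub>Q\<^esub>b\<in>B. coord b (x \<oplus>\<^bsub>M\<^esub> y) \<odot>\<^bsub>Q\<^esub> v b)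
      = (\<Oplus>\<^bsub>Q\<^esub>b\<in>B. coord b x \<odot>\<^bsub>Q\<^esub> v b) \<oplus>\<^bsub>Q\<^esub> (\<Oplus>\<^bsub>Q\<^esub>b\<in>B. coord b y \<odot>\<^bsub>Q\<^esub> v b)"
    if "x \<in> carrier M" "y \<in> carrier M" for x y
  proof -
    have "(\<Oplus>\<^bsub>Q\<^esub>b\<in>B. coord b (x \<oplus>\<^bsub>M\<^esub> y) \<odot>\<^bsub>Q\<^esub> v b)
        = (\<Oplus>\<^bsub>Q\<^esub>b\<in>B. coord b x \<odot>\<^bsub>Q\<^esub> v b \<oplus>\<^bsub>Q\<^esub> coord b y \<odot>\<^bsub>Q\<^esub> v b)"
      using that vc by (intro Q.M.finsum_cong') (auto simp: Q.smult_l_distr)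
    also have "\<dots> = (\<Oplus>\<^bsub>Q\<^esub>b\<in>B. coord b x \<odot>\<^bsub>Q\<^esub> v b) \<oplus>\<^bsub>Q\<^esub> (\<Oplus>\<^bsub>Q\<^esub>b\<in>B. coord b y \<odot>\<^bsub>Q\<^esub> v b)"
      using that vc by (intro Q.M.finsum_addf) auto
    finally show ?thesis .
  qed
  moreover have "(\<Oplus>\<^bsub>Q\<^esub>b\<in>B. coord b (r \<odot>\<^bsub>M\<^esub> x) \<odot>\<^bsub>Q\<^esub> v b) = r \<odot>\<^bsub>Q\<^esub> (\<Oplus>\<^bsub>Q\<^esub>b\<in>B. coord b x \<odot>\<^bsub>Q\<^esub> v b)"
    if "r \<in> carrier R" "x \<in> carrier M" for r x
  proof -
    have "r \<odot>\<^bsub>Q\<^esub> (\<Oplus>\<^bsub>Q\<^esub>b\<in>B. coord b x \<odot>\<^bsub>Q\<^esub> v b) = (\<Oplus>\<^bsub>Q\<^esub>b\<in>B. r \<odot>\<^bsub>Q\<^esub> (coord b x \<odot>\<^bsub>Q\<^esub> v b))"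
      using that vc finite_B by (intro Q.finsum_smult_ldistr) auto
    also have "\<dots> = (\<Oplus>\<^bsub>Q\<^esub>b\<in>B. coord b (r \<odot>\<^bsub>M\<^esub> x) \<odot>\<^bsub>Q\<^esub> v b)"
      using that vc by (intro Q.M.finsum_cong') (auto simp: Q.smult_assoc1)
    finally show ?thesis ..
  qed
  ultimately show ?thesis
    unfolding linear_maps_def using vc by (auto intro!: Q.M.finsum_closed)
qed

lemma finsum_in_submodule:
  assumes "submodule H R Q" "finite A" "\<And>a. a \<in> A \<Longrightarrow> f a \<in> H"
  shows "(\<Oplus>\<^bsub>Q\<^esub>a\<in>A. f a) \<in> H"
  using assms(2,3)
proof (induction A)
  case empty
  interpret H: submodule H R Q by fact
  show ?case using H.one_closed by simp
next
  case (insert x F)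
  note HE = Q.submoduleE[OF assms(1)]
  have "f \<in> F \<rightarrow> carrier Q" "f x \<in> carrier Q" using insert HE(1) by auto
  then show ?case using insert HE(5) by simp
qed

text \<open>With \<open>N(i)\<close> the number of elements of \<open>A\<close> that are at least \<open>i\<close>, the character takes values of exact order
  \<open>\<pi>\<^bsup>N(a)\<^esup>\<close> on the basis vectors whose level \<open>a\<close> is a starting point of \<open>A\<close>. Its image of \<open>M\<^sub>i\<close> is the full
  \<open>\<pi>\<^bsup>N(i)\<^esup>\<close>-torsion: \<open>gap_card_le\<close> gives one inclusion and \<open>gap_chain_start\<close> the other.\<close>

lemma jump_set_attained:
  assumes A: "A \<in> jump_sets"
  shows "\<exists>\<chi>\<in>chars. jumps M \<chi> = A"
proof -
  define N where "N i = card {b \<in> A. i \<le> b}" for i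
  have fin: "finite A" and pos: "A \<subseteq> {1..}" and starts: "A - \<rho> ` A \<subseteq> lev ` B"
    and gap: "\<And>a b. a \<in> A \<Longrightarrow> b \<in> A \<Longrightarrow> a < b \<Longrightarrow> \<rho> a \<le> b"
    using A by (auto simp: jump_sets_def)
  obtain g where g: "\<And>n. g n \<in> carrier Q" "\<And>n k. \<pi> [^] (k::nat) \<odot>\<^bsub>Q\<^esub> g n = \<zero>\<^bsub>Q\<^esub> \<longleftrightarrow> n \<le> k"
    using Q.exact_order by metis
  define v where "v b = (if lev b \<in> A - \<rho> ` A then g (N (lev b)) else \<zero>\<^bsub>Q\<^esub>)" for b
  define \<chi> where "\<chi> = (\<lambda>x\<in>carrier M. \<Oplus>\<^bsub>Q\<^esub>b\<in>B. coord b x \<odot>\<^bsub>Q\<^esub> v b)"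
  have vc: "v b \<in> carrier Q" for b using g by (auto simp: v_def)
  have lin: "\<chi> \<in> linear_maps R M Q" unfolding \<chi>_def using vc by (intro combination_linear) auto
  have \<chi>_bvec: "\<chi> (bvec b) = v b" if b: "b \<in> B" for b
  proof -
    have "\<chi> (bvec b) = (\<Oplus>\<^bsub>Q\<^esub>c\<in>B. if b = c then v c else \<zero>\<^bsub>Q\<^esub>)"
      unfolding \<chi>_def using bvec b vc by (auto intro!: Q.M.finsum_cong')
    also have "\<dots> = v b" using finite_B b vc by (intro Q.M.finsum_singleton) auto
    finally show ?thesis .
  qed
  have N_mono: "N j \<le> N i" if "i \<le> j" for i j
    unfolding N_def using that fin by (intro card_mono) auto
  have upper: "\<chi> ` fil M i \<subseteq> Q.ann (N i)" if i: "1 \<le> i" for i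
  proof clarify
    fix x assume x: "x \<in> fil M i"
    have "coord b x \<odot>\<^bsub>Q\<^esub> v b \<in> Q.ann (N i)" if b: "b \<in> B" for b
    proof (cases "lev b \<in> A - \<rho> ` A")
      case False
      then have "v b = \<zero>\<^bsub>Q\<^esub>" by (auto simp: v_def)
      then show ?thesis using x b i by (auto simp: Q.ann_def fil_eq)
    next
      case True
      then have vb: "v b = g (N (lev b))" by (simp add: v_def)
      obtain k c where k: "i \<le> (\<rho> ^^ k) (lev b)" and c: "c \<in> carrier R" "coord b x = \<pi> [^] k \<otimes> c"
        using x b i by (auto simp: fil_eq level_ideal_def elim!: dividesE)
      have "N (lev b) \<le> N ((\<rho> ^^ k) (lev b)) + k"
        unfolding N_def using gap_card_le[OF shift fin gap lev_pos[OF b]] by simp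
      also have "\<dots> \<le> N i + k" using N_mono[OF k] by simp
      finally have le: "N (lev b) \<le> N i + k" .
      have "\<pi> [^] (N i) \<otimes> (\<pi> [^] k \<otimes> c) = c \<otimes> \<pi> [^] (N i + k)"
        using c by (simp add: nat_pow_mult[symmetric] m_ac)
      then have "\<pi> [^] (N i) \<odot>\<^bsub>Q\<^esub> (coord b x \<odot>\<^bsub>Q\<^esub> v b) = c \<odot>\<^bsub>Q\<^esub> (\<pi> [^] (N i + k) \<odot>\<^bsub>Q\<^esub> v b)"
        using c vc[of b] Q.smult_assoc1[of "\<pi> [^] (N i)" "\<pi> [^] k \<otimes> c" "v b"]
          Q.smult_assoc1[of c "\<pi> [^] (N i + k)" "v b"] by simp
      moreover have "\<pi> [^] (N i + k) \<odot>\<^bsub>Q\<^esub> v b = \<zero>\<^bsub>Q\<^esub>" using le g(2) vb by simp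
      ultimately show ?thesis using c vc[of b] by (simp add: Q.ann_def)
    qed
    then have "(\<Oplus>\<^bsub>Q\<^esub>b\<in>B. coord b x \<odot>\<^bsub>Q\<^esub> v b) \<in> Q.ann (N i)"
      by (intro finsum_in_submodule[OF Q.ann_submodule finite_B])
    then show "\<chi> x \<in> Q.ann (N i)" using x fil_carrier[OF i] by (auto simp: \<chi>_def)
  qed
  have lower: "Q.ann (N i) \<subseteq> \<chi> ` fil M i" if i: "1 \<le> i" for i
  proof (cases "N i = 0")
    case True
    have "Q.ann 0 = {\<zero>\<^bsub>Q\<^esub>}" by (auto simp: Q.ann_def)
    moreover have "\<zero>\<^bsub>Q\<^esub> \<in> \<chi> ` fil M i"
      by (rule zero_image[OF lin i])
    ultimately show ?thesis using True by simp
  next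
    case False
    \<comment> \<open>The first element of \<open>A\<close> from \<open>i\<close> on has the same count as \<open>i\<close> and lies on the chain of a starting point.\<close>
    define b where "b = Min {b \<in> A. i \<le> b}"
    have "{b \<in> A. i \<le> b} \<noteq> {}" using False by (auto simp: N_def simp del: Collect_empty_eq)
    then have b: "b \<in> A" "i \<le> b" "\<And>c. c \<in> A \<Longrightarrow> i \<le> c \<Longrightarrow> b \<le> c"
      using fin Min_in[of "{b \<in> A. i \<le> b}"] unfolding b_def by auto
    have Nb: "N b = N i" unfolding N_def by (rule arg_cong[of _ _ card]) (use b in auto)
    obtain a k where a: "a \<in> A - \<rho> ` A" "b = (\<rho> ^^ k) a" "N a = N b + k"
      using gap_chain_start[OF shift fin pos gap b(1)] unfolding N_def by blast
    obtain c where c: "c \<in> B" "lev c = a" using starts a by auto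
    define x where "x = \<pi> [^] k \<odot>\<^bsub>M\<^esub> bvec c"
    have "x \<in> fil M b" using pi_pow_fil[OF lev_pos[OF c(1)] bvec_fil[OF c(1)], of k] a c by (simp add: x_def)
    then have x: "x \<in> fil M i" using fil_antimono[OF i b(2)] by auto
    have "\<chi> x = \<pi> [^] k \<odot>\<^bsub>Q\<^esub> v c" using linear_mapsD(3)[OF lin] bvec \<chi>_bvec[OF c(1)] by (simp add: x_def)
    then have \<chi>x: "\<chi> x = \<pi> [^] k \<odot>\<^bsub>Q\<^esub> g (N i + k)" using a c Nb by (simp add: v_def)
    have "\<pi> [^] m \<odot>\<^bsub>Q\<^esub> \<chi> x \<noteq> \<zero>\<^bsub>Q\<^esub>" if "m < N i" for m
    proof -
      have "\<pi> [^] m \<odot>\<^bsub>Q\<^esub> \<chi> x = \<pi> [^] (m + k) \<odot>\<^bsub>Q\<^esub> g (N i + k)"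
        using \<chi>x g(1) by (simp add: Q.smult_assoc1[symmetric] nat_pow_mult)
      then show ?thesis using g(2) that by simp
    qed
    then have "\<exists>r\<in>carrier R. y = r \<odot>\<^bsub>Q\<^esub> \<chi> x" if "y \<in> Q.ann (N i)" for y
      using Q.ann_generator[of "\<chi> x" "N i" y] that \<chi>x g(1) by auto
    then show ?thesis
      using Q.submoduleE(4)[OF image_submodule[OF lin i]] x by blast
  qed
  have image: "\<chi> ` fil M i = Q.ann (N i)" if "1 \<le> i" for i
    using upper[OF that] lower[OF that] by blast
  have N_Suc: "N i = N (i + 1) \<longleftrightarrow> i \<notin> A" for i
  proof (cases "i \<in> A")
    case True
    then have "{b \<in> A. i \<le> b} = insert i {b \<in> A. i + 1 \<le> b}" by auto
    then show ?thesis using fin True by (simp add: N_def)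
  next
    case False
    then have "{b \<in> A. i \<le> b} = {b \<in> A. i + 1 \<le> b}" by (auto simp: le_less Suc_le_eq)
    then show ?thesis using False by (simp add: N_def)
  qed
  have "jumps M \<chi> = A"
  proof -
    have "\<chi> ` fil M i \<noteq> \<chi> ` fil M (i + 1) \<longleftrightarrow> i \<in> A" if "1 \<le> i" for i
      using image[of i] image[of "i + 1"] Q.ann_inj N_Suc[of i] that by simp
    then have "jumps M \<chi> = {i. 1 \<le> i \<and> i \<in> A}" unfolding jumps_def by (intro Collect_cong conj_cong) auto
    then show ?thesis using pos by auto
  qed
  moreover have "\<chi> \<in> chars"
  proof -
    define j where "j = Suc (Max (insert 0 A))"
    have "{b \<in> A. j \<le> b} = {}"
      using fin Max_ge[of "insert 0 A"] unfolding j_def by (auto simp: Suc_le_eq not_less)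
    then have "N j = 0" unfolding N_def by (simp only: card.empty)
    then have "\<chi> ` fil M j \<subseteq> {\<zero>\<^bsub>Q\<^esub>}" using image[of j] by (auto simp: Q.ann_def j_def)
    moreover have "1 \<le> j" by (simp add: j_def)
    ultimately show ?thesis unfolding chars_def using lin by blast
  qed
  ultimately show ?thesis by blast
qed

end

section \<open>Characters with the same jumps are conjugate\<close>

context character_setting
begin

lemma Aut_fil_image:
  assumes "\<phi> \<in> carrier (Aut_filt R M)" "1 \<le> i"
  shows "\<phi> ` fil M i = fil M i"
proof -
  obtain \<psi> where *: "\<phi> \<in> fil_maps R M M" "\<psi> \<in> fil_maps R M M"
    "\<And>x. x \<in> carrier M \<Longrightarrow> \<phi> (\<psi> x) = x" using assms(1) by (rule Aut_filtE) blast
  have "x \<in> \<phi> ` fil M i" if x: "x \<in> fil M i" for x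
  proof -
    have "x \<in> carrier M" using x fil_carrier[OF assms(2)] by blast
    then show ?thesis using *(3) fil_mapsD(3)[OF *(2) assms(2) x] by (metis imageI)
  qed
  then show ?thesis using fil_mapsD(3)[OF *(1) assms(2)] by blast
qed

lemma orbit_image:
  assumes "\<chi>' \<in> orb \<chi>" "1 \<le> i"
  shows "\<chi>' ` fil M i = \<chi> ` fil M i"
proof -
  obtain \<phi> where \<phi>: "\<phi> \<in> carrier (Aut_filt R M)" "\<chi>' = precomp M \<phi> \<chi>"
    using assms(1) by (auto simp: orbit_def)
  have "\<chi>' ` fil M i = \<chi> ` \<phi> ` fil M i"
    using fil_carrier[OF assms(2)] by (force simp: \<phi>(2) precomp_def compose_def image_image)
  then show ?thesis using Aut_fil_image[OF \<phi>(1) assms(2)] by simp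
qed

lemma orbit_jumps: "\<chi>' \<in> orb \<chi> \<Longrightarrow> jumps M \<chi>' = jumps M \<chi>"
  by (simp add: jumps_def orbit_image cong: conj_cong)

lemma orbit_chars:
  assumes "\<chi>' \<in> orb \<chi>" "\<chi> \<in> chars"
  shows "\<chi>' \<in> chars"
proof -
  obtain \<phi> where \<phi>: "\<phi> \<in> carrier (Aut_filt R M)" "\<chi>' = precomp M \<phi> \<chi>"
    using assms(1) by (auto simp: orbit_def)
  have "\<phi> \<in> linear_maps R M M" using \<phi>(1) by (rule Aut_filtE) (rule fil_mapsD)
  then have "\<chi>' \<in> linear_maps R M Q"
    unfolding \<phi>(2) precomp_def using assms(2) by (intro linear_map_compose) (auto simp: chars_def)
  moreover obtain j where "1 \<le> j" "\<chi> ` fil M j \<subseteq> {\<zero>\<^bsub>Q\<^esub>}" using assms(2) by (auto simp: chars_def)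
  ultimately show ?thesis unfolding chars_def using orbit_image[OF assms(1), of j] by blast
qed

text \<open>By \<open>imprimitive_in_range\<close> and \<open>imprimitive_not_in_range\<close> the imprimitive part is built from steps of the
  filtration, and on each of those the two characters have the same image.\<close>

lemma imprimitive_same_image:
  assumes lin: "\<chi> \<in> linear_maps R M Q" "\<chi>' \<in> linear_maps R M Q"
    and eq: "\<And>i. 1 \<le> i \<Longrightarrow> \<chi> ` fil M i = \<chi>' ` fil M i" and i: "1 \<le> i"
  shows "\<chi>' ` imprimitive i \<subseteq> \<chi> ` imprimitive i"
proof (cases "i \<in> \<rho> ` {1..}")
  case False
  then show ?thesis using imprimitive_not_in_range[OF i] eq[of "i + 1"] by simp
next
  case True
  then obtain j where j: "1 \<le> j" "i = \<rho> j" by auto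
  have expand: "f (\<pi> \<odot>\<^bsub>M\<^esub> u \<oplus>\<^bsub>M\<^esub> v) = \<pi> \<odot>\<^bsub>Q\<^esub> f u \<oplus>\<^bsub>Q\<^esub> f v"
    if "f \<in> linear_maps R M Q" "u \<in> fil M j" "v \<in> fil M (i + 1)" for f u v
    using linear_mapsD(2,3)[OF that(1)] that(2,3) j(1) by (simp add: fil_eq)
  show ?thesis
  proof clarify
    fix x assume "x \<in> imprimitive i"
    then obtain u v where uv: "u \<in> fil M j" "v \<in> fil M (i + 1)" "x = \<pi> \<odot>\<^bsub>M\<^esub> u \<oplus>\<^bsub>M\<^esub> v"
      using imprimitive_in_range[OF j(1)] j(2) by auto
    obtain u' where u': "u' \<in> fil M j" "\<chi>' u = \<chi> u'" using uv(1) eq[OF j(1)] by blast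
    obtain v' where v': "v' \<in> fil M (i + 1)" "\<chi>' v = \<chi> v'" using uv(2) eq[of "i + 1"] by auto
    have "\<chi>' x = \<chi> (\<pi> \<odot>\<^bsub>M\<^esub> u' \<oplus>\<^bsub>M\<^esub> v')"
      using expand[OF lin(1) u'(1) v'(1)] expand[OF lin(2) uv(1,2)] u' v' uv(3) by simp
    moreover have "\<pi> \<odot>\<^bsub>M\<^esub> u' \<oplus>\<^bsub>M\<^esub> v' \<in> imprimitive i"
      using imprimitive_in_range[OF j(1)] j(2) u'(1) v'(1) by blast
    ultimately show "\<chi>' x \<in> \<chi> ` imprimitive i" by blast
  qed
qed

lemma pi_divides_add: "a \<in> carrier R \<Longrightarrow> b \<in> carrier R \<Longrightarrow> \<pi> divides a \<Longrightarrow> \<pi> divides b \<Longrightarrow> \<pi> divides (a \<oplus> b)"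
  using pi_pow_divides_closed[of a b 1] by simp

lemma nonunit_coord_submodule:
  assumes b: "b \<in> B" and i: "1 \<le> i"
  shows "submodule {y \<in> fil M i. \<pi> divides coord b y} R M"
proof (rule submoduleI)
  note FE = submoduleE[OF fil_submodule[OF i]]
  have c: "y \<in> carrier M" if "y \<in> fil M i" for y using that FE(1) by blast
  show "{y \<in> fil M i. \<pi> divides coord b y} \<subseteq> carrier M" using c by auto
  show "\<zero>\<^bsub>M\<^esub> \<in> {y \<in> fil M i. \<pi> divides coord b y}"
    using zero_fil[OF i] b by (auto intro: dividesI[of \<zero>])
  have sm: "r \<odot>\<^bsub>M\<^esub> y \<in> {y \<in> fil M i. \<pi> divides coord b y}"
    if "r \<in> carrier R" "y \<in> {y \<in> fil M i. \<pi> divides coord b y}" for r y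
    using that FE(4) b c[of y] divides_prod_l[of \<pi> "coord b y" r] by auto
  then show "\<And>r y. \<lbrakk>r \<in> carrier R; y \<in> {y \<in> fil M i. \<pi> divides coord b y}\<rbrakk> \<Longrightarrow>
      r \<odot>\<^bsub>M\<^esub> y \<in> {y \<in> fil M i. \<pi> divides coord b y}" .
  show "\<ominus>\<^bsub>M\<^esub> y \<in> {y \<in> fil M i. \<pi> divides coord b y}"
    if "y \<in> {y \<in> fil M i. \<pi> divides coord b y}" for y
    using sm[of "\<ominus> \<one>" y] that c[of y] smult_l_minus[of \<one> y] by simp
  show "y \<oplus>\<^bsub>M\<^esub> z \<in> {y \<in> fil M i. \<pi> divides coord b y}"
    if "y \<in> {y \<in> fil M i. \<pi> divides coord b y}" "z \<in> {y \<in> fil M i. \<pi> divides coord b y}" for y z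
    using that FE(5) b c[of y] c[of z] pi_divides_add[of "coord b y" "coord b z"] by auto
qed

lemma pi_multiples_submodule:
  assumes g: "g \<in> carrier Q"
  shows "submodule {(\<pi> \<otimes> r) \<odot>\<^bsub>Q\<^esub> g | r. r \<in> carrier R} R Q" (is "submodule ?P R Q")
proof (rule Q.submoduleI)
  show "?P \<subseteq> carrier Q" using g by auto
  show "\<zero>\<^bsub>Q\<^esub> \<in> ?P" using g by (auto intro!: exI[of _ \<zero>])
  have sm: "r \<odot>\<^bsub>Q\<^esub> x \<in> ?P" if r: "r \<in> carrier R" and x: "x \<in> ?P" for r x
  proof -
    obtain s where s: "s \<in> carrier R" "x = (\<pi> \<otimes> s) \<odot>\<^bsub>Q\<^esub> g" using x by auto
    have "r \<odot>\<^bsub>Q\<^esub> x = (\<pi> \<otimes> (r \<otimes> s)) \<odot>\<^bsub>Q\<^esub> g"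
      using s r g Q.smult_assoc1[of r "\<pi> \<otimes> s" g] by (simp add: m_lcomm)
    then show ?thesis using s r by blast
  qed
  then show "\<And>r x. r \<in> carrier R \<Longrightarrow> x \<in> ?P \<Longrightarrow> r \<odot>\<^bsub>Q\<^esub> x \<in> ?P" .
  show "\<ominus>\<^bsub>Q\<^esub> x \<in> ?P" if x: "x \<in> ?P" for x
  proof -
    have "x \<in> carrier Q" using x g by auto
    then show ?thesis using sm[of "\<ominus> \<one>" x] x Q.smult_l_minus[of \<one> x] by simp
  qed
  show "x \<oplus>\<^bsub>Q\<^esub> y \<in> ?P" if xy: "x \<in> ?P" "y \<in> ?P" for x y
  proof -
    obtain r s where s: "s \<in> carrier R" "x = (\<pi> \<otimes> s) \<odot>\<^bsub>Q\<^esub> g" "r \<in> carrier R" "y = (\<pi> \<otimes> r) \<odot>\<^bsub>Q\<^esub> g"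
      using xy by auto
    have "x \<oplus>\<^bsub>Q\<^esub> y = (\<pi> \<otimes> (s \<oplus> r)) \<odot>\<^bsub>Q\<^esub> g"
      using s g by (simp add: R.r_distr Q.smult_l_distr)
    then show ?thesis using s by blast
  qed
qed

text \<open>Let \<open>g = \<chi>(e\<^sub>b)\<close>, let \<open>i\<close> be the level of \<open>b\<close>, and let \<open>K\<close> be the set of vectors in \<open>M\<^sub>i\<close> whose \<open>b\<close>-coordinate is
  a non-unit. The target value \<open>\<chi>'(e\<^sub>b)\<close> equals \<open>\<chi>(y\<^sub>0)\<close> for some \<open>y\<^sub>0 \<in> M\<^sub>i\<close>, and there is nothing more to do if
  the \<open>b\<close>-coordinate of \<open>y\<^sub>0\<close> is a unit. If \<open>y\<^sub>0 \<in> K\<close> and \<open>g \<in> \<chi>(K)\<close>, then adding to \<open>y\<^sub>0\<close> the difference of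
  \<open>e\<^sub>b\<close> and a vector of \<open>K\<close> with the same value \<open>g\<close> makes the coordinate a unit. In the remaining case \<open>g\<close> generates \<open>\<chi>(M\<^sub>i)\<close> while \<open>\<chi>'(e\<^sub>b)\<close> does not, so
  some other basis vector \<open>e\<^sub>c\<close> of the same level has a generating value under \<open>\<chi>'\<close> but not under \<open>\<chi>\<close>; it is
  \<open>e\<^sub>c\<close> that can be adjusted, by a multiple of \<open>e\<^sub>b\<close>.\<close>

lemma adjustable_basis_vector:
  assumes lin: "\<chi> \<in> linear_maps R M Q" "\<chi>' \<in> linear_maps R M Q"
    and eq: "\<And>i. 1 \<le> i \<Longrightarrow> \<chi> ` fil M i = \<chi>' ` fil M i"
    and b: "b \<in> B" "\<chi> (bvec b) \<noteq> \<chi>' (bvec b)"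
  shows "\<exists>c\<in>B. \<chi> (bvec c) \<noteq> \<chi>' (bvec c) \<and>
    (\<exists>w\<in>fil M (lev c). coord c w \<in> Units R \<and> \<chi> w = \<chi>' (bvec c))"
proof -
  define i where "i = lev b"
  have i: "1 \<le> i" using lev_pos b by (simp add: i_def)
  note FE = submoduleE[OF fil_submodule[OF i]]
  have Fc: "y \<in> carrier M" if "y \<in> fil M i" for y using that FE(1) by blast
  define K where "K = {y \<in> fil M i. \<pi> divides coord b y}"
  have K: "submodule K R M" unfolding K_def by (rule nonunit_coord_submodule[OF b(1) i])
  note KE = submoduleE[OF K]
  have H: "submodule (\<chi> ` K) R Q" by (rule linear_map_image_submodule[OF is_module Q_module lin(1) K])
  define g where "g = \<chi> (bvec b)"
  have ebF: "bvec b \<in> fil M i" using bvec_fil b by (simp add: i_def)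
  have gc: "g \<in> carrier Q" using linear_mapsD(1)[OF lin(1)] bvec by (simp add: g_def)
  have "\<chi>' (bvec b) \<in> \<chi> ` fil M i" using eq[OF i] ebF by blast
  then obtain y0 where y0: "y0 \<in> fil M i" "\<chi> y0 = \<chi>' (bvec b)" by auto
  show ?thesis
  proof (cases "coord b y0 \<in> Units R")
    case True
    then show ?thesis using b y0 by (auto simp: i_def)
  next
    case False
    then have y0K: "y0 \<in> K"
      using unit_or_pi_divides[of "coord b y0"] y0(1) Fc b(1) by (auto simp: K_def)
    show ?thesis
    proof (cases "g \<in> \<chi> ` K")
      case True
      then obtain y1 where y1: "y1 \<in> K" "\<chi> y1 = g" by auto
      \<comment> \<open>the value of \<open>y\<^sub>0\<close> is kept, and the \<open>b\<close>-coordinate becomes a unit\<close>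
      define w where "w = bvec b \<oplus>\<^bsub>M\<^esub> (y0 \<oplus>\<^bsub>M\<^esub> \<ominus>\<^bsub>M\<^esub> y1)"
      have d: "y0 \<oplus>\<^bsub>M\<^esub> \<ominus>\<^bsub>M\<^esub> y1 \<in> K" using KE(3,5) y0K y1 by blast
      have dc: "y0 \<in> carrier M" "y1 \<in> carrier M" using KE(1) y0K y1 by auto
      have "w \<in> fil M i" using d ebF FE(5) by (auto simp: w_def K_def)
      moreover have "coord b w \<in> Units R"
        using d b(1) dc bvec unit_plus_pi_multiple[of \<one> "coord b (y0 \<oplus>\<^bsub>M\<^esub> \<ominus>\<^bsub>M\<^esub> y1)"]
        by (simp add: w_def K_def del: coord_add) (simp add: dc bvec)
      moreover have "\<chi> w = g \<oplus>\<^bsub>Q\<^esub> (\<chi> y0 \<oplus>\<^bsub>Q\<^esub> \<ominus>\<^bsub>Q\<^esub> g)"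
        using dc y1 bvec linear_mapsD(2)[OF lin(1)] linear_map_minus[OF is_module Q_module lin(1)]
        by (simp add: w_def g_def)
      moreover have "\<chi> y0 \<in> carrier Q" using linear_mapsD(1)[OF lin(1)] dc by simp
      ultimately have "w \<in> fil M i" "coord b w \<in> Units R" "\<chi> w = \<chi> y0"
        using gc Q.M.a_lcomm[of g "\<chi> y0" "\<ominus>\<^bsub>Q\<^esub> g"] by (auto simp: Q.M.r_neg)
      then show ?thesis using b y0 by (auto simp: i_def)
    next
      case gK: False
      have pi_mult: "\<exists>r\<in>carrier R. \<chi> y = (\<pi> \<otimes> r) \<odot>\<^bsub>Q\<^esub> g" if "y \<in> K" for y
        using Q.outside_submodule[OF H gc gK, of "\<chi> y"] that by blast
      define P where "P = {(\<pi> \<otimes> r) \<odot>\<^bsub>Q\<^esub> g | r. r \<in> carrier R}"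
      have P: "submodule P R Q" unfolding P_def by (rule pi_multiples_submodule[OF gc])
      note PE = Q.submoduleE[OF P]
      have KP: "\<chi> y \<in> P" if "y \<in> K" for y using pi_mult[OF that] by (auto simp: P_def)
      \<comment> \<open>Splitting off the \<open>b\<close>-coordinate shows that \<open>g\<close> generates the image of the whole step.\<close>
      have gen: "\<exists>r\<in>carrier R. \<chi> y = r \<odot>\<^bsub>Q\<^esub> g" if y: "y \<in> fil M i" for y
      proof -
        define z where "z = y \<oplus>\<^bsub>M\<^esub> \<ominus>\<^bsub>M\<^esub> (coord b y \<odot>\<^bsub>M\<^esub> bvec b)"
        have yc: "coord b y \<in> carrier R" "y \<in> carrier M" using Fc[OF y] b(1) by auto
        have zF: "z \<in> fil M i" using y yc ebF FE(3,4,5) by (simp add: z_def)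
        have zc: "z \<in> carrier M" using Fc zF by simp
        have y_eq: "y = coord b y \<odot>\<^bsub>M\<^esub> bvec b \<oplus>\<^bsub>M\<^esub> z"
          using yc bvec(1)[of b] M.a_lcomm[of "coord b y \<odot>\<^bsub>M\<^esub> bvec b" y "\<ominus>\<^bsub>M\<^esub> (coord b y \<odot>\<^bsub>M\<^esub> bvec b)"]
          by (simp add: z_def M.r_neg)
        have "z = y \<oplus>\<^bsub>M\<^esub> (\<ominus> coord b y) \<odot>\<^bsub>M\<^esub> bvec b"
          using yc bvec(1)[of b] by (simp add: z_def smult_l_minus)
        then have "coord b z = \<zero>" using yc bvec b(1) by (simp add: R.r_neg)
        then have "z \<in> K" using zF by (auto simp: K_def intro: dividesI[of \<zero>])
        then obtain s where s: "s \<in> carrier R" "\<chi> z = (\<pi> \<otimes> s) \<odot>\<^bsub>Q\<^esub> g" using pi_mult by blast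
        have "\<chi> y = \<chi> (coord b y \<odot>\<^bsub>M\<^esub> bvec b) \<oplus>\<^bsub>Q\<^esub> \<chi> z"
          using linear_mapsD(2)[OF lin(1), of "coord b y \<odot>\<^bsub>M\<^esub> bvec b" z] y_eq yc zc bvec(1) by simp
        also have "\<dots> = (coord b y \<oplus> \<pi> \<otimes> s) \<odot>\<^bsub>Q\<^esub> g"
          using linear_mapsD(3)[OF lin(1)] yc bvec s gc by (simp add: Q.smult_l_distr g_def)
        finally show ?thesis using yc s by blast
      qed
      have bP: "\<chi>' (bvec b) \<in> P" using KP[OF y0K] y0 by simp
      \<comment> \<open>Otherwise all of \<open>\<chi>'(M\<^sub>i) = \<chi>(M\<^sub>i)\<close>, including \<open>g\<close> itself, would consist of \<open>\<pi>\<close>-multiples of \<open>g\<close>.\<close>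
      have "\<exists>c\<in>B. lev c = i \<and> \<chi>' (bvec c) \<notin> P"
      proof (rule ccontr)
        assume "\<not> ?thesis"
        then have allP: "\<chi>' (bvec c) \<in> P" if "c \<in> B" "lev c = i" for c using that by blast
        have "g \<in> \<chi>' ` fil M i" using eq[OF i] ebF by (auto simp: g_def)
        then obtain y where y: "y \<in> fil M i" "\<chi>' y = g" by auto
        have yc: "y \<in> carrier M" using y Fc by auto
        \<comment> \<open>The coordinates of level \<open>i\<close> give the summand \<open>s\<close>; the rest \<open>t\<close> is imprimitive.\<close>
        define C where "C = {c \<in> B. lev c = i}"
        define s where "s = (\<Oplus>\<^bsub>M\<^esub>c\<in>C. coord c y \<odot>\<^bsub>M\<^esub> bvec c)"
        define t where "t = (\<Oplus>\<^bsub>M\<^esub>c\<in>B - C. coord c y \<odot>\<^bsub>M\<^esub> bvec c)"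
        have sc: "s \<in> carrier M" "t \<in> carrier M"
          unfolding s_def t_def using yc bvec by (auto intro!: M.finsum_closed simp: C_def)
        have "y = (\<Oplus>\<^bsub>M\<^esub>c\<in>C \<union> (B - C). coord c y \<odot>\<^bsub>M\<^esub> bvec c)"
          using bvec_expansion[OF yc] by (simp add: C_def Un_absorb1)
        also have "\<dots> = s \<oplus>\<^bsub>M\<^esub> t"
          unfolding s_def t_def using finite_B yc bvec by (intro M.finsum_Un_disjoint) (auto simp: C_def)
        finally have yst: "y = s \<oplus>\<^bsub>M\<^esub> t" .
        have t_coord: "coord c t = (if c \<in> C then \<zero> else coord c y)" if c: "c \<in> B" for c
        proof -
          have "coord c t = (\<Oplus>d\<in>B - C. coord c (coord d y \<odot>\<^bsub>M\<^esub> bvec d))"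
            unfolding t_def using finite_B yc bvec c by (intro coord_finsum) auto
          also have "\<dots> = (\<Oplus>d\<in>B - C. if c = d then coord d y else \<zero>)"
            using c yc bvec by (intro R.finsum_cong') auto
          also have "\<dots> = (if c \<in> C then \<zero> else coord c y)"
          proof (cases "c \<in> C")
            case True
            then have "(\<Oplus>d\<in>B - C. if c = d then coord d y else \<zero>) = (\<Oplus>d\<in>B - C. \<zero>)"
              by (intro R.finsum_cong') auto
            then show ?thesis using True by simp
          next
            case False
            then show ?thesis using finite_B c yc by (auto intro!: R.finsum_singleton)
          qed
          finally show ?thesis .
        qed
        have "t \<in> imprimitive i"
          using sc y(1) i by (auto simp: imprimitive_def fil_eq t_coord C_def level_ideal_zero lev_pos intro: dividesI[of \<zero>])
        then have "\<chi>' t \<in> \<chi> ` imprimitive i" using imprimitive_same_image[OF lin eq i] by blast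
        moreover have "imprimitive i \<subseteq> K" using b(1) by (auto simp: imprimitive_def K_def i_def)
        ultimately have tP: "\<chi>' t \<in> P" using KP by auto
        have "\<chi>' s = (\<Oplus>\<^bsub>Q\<^esub>c\<in>C. \<chi>' (coord c y \<odot>\<^bsub>M\<^esub> bvec c))"
          unfolding s_def using finite_B yc bvec
          by (intro linear_map_finsum[OF is_module Q_module lin(2)]) (auto simp: C_def)
        moreover have "\<chi>' (coord c y \<odot>\<^bsub>M\<^esub> bvec c) \<in> P" if "c \<in> C" for c
          using that allP[of c] linear_mapsD(3)[OF lin(2), of "coord c y" "bvec c"] yc bvec PE(4)
          by (simp add: C_def)
        ultimately have "\<chi>' s \<in> P"
          using finsum_in_submodule[OF P, of C] finite_B by (simp add: C_def)
        then have "g \<in> P" using tP y(2) yst sc linear_mapsD(2)[OF lin(2)] PE(5)[of "\<chi>' s" "\<chi>' t"] by simp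
        then have "g = \<zero>\<^bsub>Q\<^esub>" using Q.not_pi_multiple_of_itself[OF gc] by (auto simp: P_def)
        moreover have "\<zero>\<^bsub>Q\<^esub> \<in> \<chi> ` K"
        proof -
          have "\<zero>\<^bsub>M\<^esub> \<in> K" using zero_fil[OF i] b(1) by (auto simp: K_def intro: dividesI[of \<zero>])
          then show ?thesis
            using imageI[of "\<zero>\<^bsub>M\<^esub>" K \<chi>] linear_map_zero[OF is_module Q_module lin(1)] by simp
        qed
        ultimately show False using gK by simp
      qed
      then obtain c where c: "c \<in> B" "lev c = i" "\<chi>' (bvec c) \<notin> P" by blast
      have cb: "c \<noteq> b" using c(3) bP by auto
      have ecF: "bvec c \<in> fil M i" using bvec_fil c by auto
      have "bvec c \<in> K" using ecF b(1) cb bvec by (auto simp: K_def intro: dividesI[of \<zero>])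
      then have neq: "\<chi> (bvec c) \<noteq> \<chi>' (bvec c)" using KP c(3) by metis
      obtain s where s: "s \<in> carrier R" "\<chi> (bvec c) = s \<odot>\<^bsub>Q\<^esub> g" using gen[OF ecF] by blast
      have "\<chi>' (bvec c) \<in> \<chi> ` fil M i" using eq[OF i] ecF by blast
      then obtain y where y: "\<chi>' (bvec c) = \<chi> y" "y \<in> fil M i" by (rule imageE)
      obtain t where t: "t \<in> carrier R" "\<chi>' (bvec c) = t \<odot>\<^bsub>Q\<^esub> g"
        unfolding y(1) using gen[OF y(2)] by blast
      define w where "w = bvec c \<oplus>\<^bsub>M\<^esub> (t \<oplus> \<ominus> s) \<odot>\<^bsub>M\<^esub> bvec b"
      have "w \<in> fil M (lev c)" using ecF ebF s t FE(4,5) c(2) by (simp add: w_def)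
      moreover have "coord c w \<in> Units R" using c(1) cb s t bvec by (simp add: w_def)
      moreover have "\<chi> w = \<chi>' (bvec c)"
      proof -
        have "\<chi> w = s \<odot>\<^bsub>Q\<^esub> g \<oplus>\<^bsub>Q\<^esub> (t \<oplus> \<ominus> s) \<odot>\<^bsub>Q\<^esub> g"
          using s t bvec linear_mapsD(2,3)[OF lin(1)] by (simp add: w_def g_def)
        also have "\<dots> = (s \<oplus> (t \<oplus> \<ominus> s)) \<odot>\<^bsub>Q\<^esub> g" using s t gc by (simp add: Q.smult_l_distr)
        also have "s \<oplus> (t \<oplus> \<ominus> s) = t" using s t R.a_lcomm[of s t "\<ominus> s"] by (simp add: R.r_neg)
        finally show ?thesis using t by simp
      qed
      ultimately show ?thesis using c(1) neq by blast
    qed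
  qed
qed

lemma same_jumps_same_orbit:
  assumes "\<chi> \<in> chars" "\<chi>' \<in> chars" "jumps M \<chi> = jumps M \<chi>'"
  shows "\<chi>' \<in> orb \<chi>"
  using assms
proof (induction "card {b \<in> B. \<chi> (bvec b) \<noteq> \<chi>' (bvec b)}" arbitrary: \<chi> rule: less_induct)
  case less
  have lin: "\<chi> \<in> linear_maps R M Q" "\<chi>' \<in> linear_maps R M Q" using less.prems by (auto simp: chars_def)
  show ?case
  proof (cases "\<forall>b\<in>B. \<chi> (bvec b) = \<chi>' (bvec b)")
    case True
    then have "\<chi> = \<chi>'" using linear_map_eq_on_basis[OF Q_module lin] by blast
    then show ?thesis using orbit_refl[OF lin(1)] by simp
  next
    case False
    then obtain c w where c: "c \<in> B" "\<chi> (bvec c) \<noteq> \<chi>' (bvec c)"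
      and w: "w \<in> fil M (lev c)" "coord c w \<in> Units R" "\<chi> w = \<chi>' (bvec c)"
      using adjustable_basis_vector[OF lin same_jumps_same_images[OF less.prems]] by blast
    obtain \<phi> where \<phi>: "\<phi> \<in> carrier (Aut_filt R M)" "\<phi> (bvec c) = w"
      "\<And>d. d \<in> B \<Longrightarrow> d \<noteq> c \<Longrightarrow> \<phi> (bvec d) = bvec d"
      using move_basis_vector[OF c(1) w(1,2)] by blast
    define \<chi>1 where "\<chi>1 = precomp M \<phi> \<chi>"
    have orb: "\<chi>1 \<in> orb \<chi>" using \<phi>(1) by (auto simp: \<chi>1_def orbit_def)
    have val: "\<chi>1 (bvec d) = (if d = c then \<chi>' (bvec c) else \<chi> (bvec d))" if "d \<in> B" for d
      using that \<phi> w bvec by (auto simp: \<chi>1_def precomp_def compose_def)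
    have "{b \<in> B. \<chi>1 (bvec b) \<noteq> \<chi>' (bvec b)} \<subseteq> {b \<in> B. \<chi> (bvec b) \<noteq> \<chi>' (bvec b)}"
      by (auto simp: val split: if_splits)
    moreover have "c \<notin> {b \<in> B. \<chi>1 (bvec b) \<noteq> \<chi>' (bvec b)}" by (simp add: val)
    ultimately have "{b \<in> B. \<chi>1 (bvec b) \<noteq> \<chi>' (bvec b)} \<subset> {b \<in> B. \<chi> (bvec b) \<noteq> \<chi>' (bvec b)}"
      using c by blast
    then have "card {b \<in> B. \<chi>1 (bvec b) \<noteq> \<chi>' (bvec b)} < card {b \<in> B. \<chi> (bvec b) \<noteq> \<chi>' (bvec b)}"
      using finite_B by (intro psubset_card_mono) auto
    from less.hyps[OF this orbit_chars[OF orb less.prems(1)] less.prems(2)]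
    have "\<chi>' \<in> orb \<chi>1" using orbit_jumps[OF orb] less.prems(3) by simp
    then show ?thesis using orbit_trans[OF orb] by blast
  qed
qed

lemma jumps_of_chars: "jumps M ` chars = jump_sets"
  using jumps_in_jump_sets jump_set_attained by blast

lemma same_jumps_iff_same_orbit:
  assumes "\<chi> \<in> chars" "\<chi>' \<in> chars"
  shows "jumps M \<chi> = jumps M \<chi>' \<longleftrightarrow> \<chi>' \<in> orb \<chi>"
  using same_jumps_same_orbit[OF assms] orbit_jumps[of \<chi>' \<chi>] by auto

end

section \<open>The fraction field modulo the ring\<close>

context domain
begin

lemma frac_rel_iff:
  "((a, b), (c, d)) \<in> frac_rel R \<longleftrightarrow> a \<in> carrier R \<and> c \<in> carrier R \<and>
    b \<in> carrier R \<and> b \<noteq> \<zero> \<and> d \<in> carrier R \<and> d \<noteq> \<zero> \<and> a \<otimes> d = c \<otimes> b"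
  by (auto simp: frac_rel_def)

lemma frac_rel_equiv: "equiv (carrier R \<times> (carrier R - {\<zero>})) (frac_rel R)"
proof (rule equivI)
  show "frac_rel R \<subseteq> (carrier R \<times> (carrier R - {\<zero>})) \<times> (carrier R \<times> (carrier R - {\<zero>}))"
    by (auto simp: frac_rel_def)
  show "refl_on (carrier R \<times> (carrier R - {\<zero>})) (frac_rel R)"
    by (auto simp: refl_on_def frac_rel_iff)
  show "sym (frac_rel R)" by (auto simp: sym_def frac_rel_iff)
  show "trans (frac_rel R)"
  proof (rule transI)
    fix x y z assume "(x, y) \<in> frac_rel R" "(y, z) \<in> frac_rel R"
    moreover obtain a b c d e h where [simp]: "x = (a, b)" "y = (c, d)" "z = (e, h)"
      by (metis prod.exhaust)
    ultimately have c: "a \<in> carrier R" "b \<in> carrier R" "c \<in> carrier R" "d \<in> carrier R" "e \<in> carrier R" "h \<in> carrier R"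
      and nz: "b \<noteq> \<zero>" "d \<noteq> \<zero>" "h \<noteq> \<zero>" and eq: "a \<otimes> d = c \<otimes> b" "c \<otimes> h = e \<otimes> d"
      by (auto simp: frac_rel_iff)
    have "d \<otimes> (a \<otimes> h) = (a \<otimes> d) \<otimes> h" using c by (simp add: m_ac)
    also have "\<dots> = (c \<otimes> h) \<otimes> b" using c eq by (simp add: m_ac)
    also have "\<dots> = d \<otimes> (e \<otimes> b)" using c eq by (simp add: m_ac)
    finally have "a \<otimes> h = e \<otimes> b" using c nz m_lcancel[of d] by simp
    then show "(x, z) \<in> frac_rel R" using c nz by (simp add: frac_rel_iff)
  qed
qed

lemma frac_class_eq:
  assumes "a \<in> carrier R" "b \<in> carrier R" "b \<noteq> \<zero>" "c \<in> carrier R" "d \<in> carrier R" "d \<noteq> \<zero>"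
  shows "frac_class R a b = frac_class R c d \<longleftrightarrow> a \<otimes> d = c \<otimes> b"
  unfolding frac_class_def using eq_equiv_class_iff[OF frac_rel_equiv, of "(a, b)" "(c, d)"] assms
  by (auto simp: frac_rel_iff)

lemma frac_class_mem: "(c, d) \<in> frac_class R a b \<longleftrightarrow> a \<in> carrier R \<and> c \<in> carrier R \<and>
    b \<in> carrier R \<and> b \<noteq> \<zero> \<and> d \<in> carrier R \<and> d \<noteq> \<zero> \<and> a \<otimes> d = c \<otimes> b"
  by (auto simp: frac_class_def frac_rel_iff)

lemma frac_class_self: "a \<in> carrier R \<Longrightarrow> b \<in> carrier R \<Longrightarrow> b \<noteq> \<zero> \<Longrightarrow> (a, b) \<in> frac_class R a b"
  by (simp add: frac_class_mem)

text \<open>The operations of the fraction field are unions over all representatives; such a union collapses to one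
  class as soon as the summands do not depend on the representatives.\<close>

lemma UN_frac_classes:
  assumes ab: "a \<in> carrier R" "b \<in> carrier R" "b \<noteq> \<zero>" and cd: "c \<in> carrier R" "d \<in> carrier R" "d \<noteq> \<zero>"
    and F: "\<And>a' b' c' d'. (a', b') \<in> frac_class R a b \<Longrightarrow> (c', d') \<in> frac_class R c d \<Longrightarrow>
      F a' b' c' d' = F a b c d"
  shows "(\<Union>(a', b')\<in>frac_class R a b. \<Union>(c', d')\<in>frac_class R c d. F a' b' c' d') = F a b c d"
proof -
  have "(\<Union>(c', d')\<in>frac_class R c d. F a' b' c' d') = F a b c d" if "(a', b') \<in> frac_class R a b" for a' b'
    using F[OF that] by (intro UN_constant_eq[OF frac_class_self[OF cd]]) auto
  then show ?thesis by (intro UN_constant_eq[OF frac_class_self[OF ab]]) auto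
qed

lemma frac_add:
  assumes ab: "a \<in> carrier R" "b \<in> carrier R" "b \<noteq> \<zero>" and cd: "c \<in> carrier R" "d \<in> carrier R" "d \<noteq> \<zero>"
  shows "frac_class R a b \<oplus>\<^bsub>frac_field R\<^esub> frac_class R c d = frac_class R (a \<otimes> d \<oplus> c \<otimes> b) (b \<otimes> d)"
  unfolding frac_field_def ring_record_simps
proof (rule UN_frac_classes[OF ab cd])
  fix a' b' c' d'
  assume "(a', b') \<in> frac_class R a b" "(c', d') \<in> frac_class R c d"
  then have h: "a' \<in> carrier R" "b' \<in> carrier R" "b' \<noteq> \<zero>" "a \<otimes> b' = a' \<otimes> b"
    "c' \<in> carrier R" "d' \<in> carrier R" "d' \<noteq> \<zero>" "c \<otimes> d' = c' \<otimes> d" by (auto simp: frac_class_mem)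
  have "(a' \<otimes> d' \<oplus> c' \<otimes> b') \<otimes> (b \<otimes> d) = (a' \<otimes> b) \<otimes> (d \<otimes> d') \<oplus> (c' \<otimes> d) \<otimes> (b \<otimes> b')"
    using h(1,2,5,6) ab cd by (simp add: l_distr r_distr m_ac a_ac)
  also have "\<dots> = (a \<otimes> b') \<otimes> (d \<otimes> d') \<oplus> (c \<otimes> d') \<otimes> (b \<otimes> b')" using h by simp
  also have "\<dots> = (a \<otimes> d \<oplus> c \<otimes> b) \<otimes> (b' \<otimes> d')"
    using h(1,2,5,6) ab cd by (simp add: l_distr r_distr m_ac a_ac)
  finally show "frac_class R (a' \<otimes> d' \<oplus> c' \<otimes> b') (b' \<otimes> d') = frac_class R (a \<otimes> d \<oplus> c \<otimes> b) (b \<otimes> d)"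
    using h ab cd by (subst frac_class_eq) (auto simp: integral_iff)
qed

lemma frac_mult:
  assumes ab: "a \<in> carrier R" "b \<in> carrier R" "b \<noteq> \<zero>" and cd: "c \<in> carrier R" "d \<in> carrier R" "d \<noteq> \<zero>"
  shows "frac_class R a b \<otimes>\<^bsub>frac_field R\<^esub> frac_class R c d = frac_class R (a \<otimes> c) (b \<otimes> d)"
  unfolding frac_field_def ring_record_simps monoid.simps
proof (rule UN_frac_classes[OF ab cd])
  fix a' b' c' d'
  assume "(a', b') \<in> frac_class R a b" "(c', d') \<in> frac_class R c d"
  then have h: "a' \<in> carrier R" "b' \<in> carrier R" "b' \<noteq> \<zero>" "a \<otimes> b' = a' \<otimes> b"
    "c' \<in> carrier R" "d' \<in> carrier R" "d' \<noteq> \<zero>" "c \<otimes> d' = c' \<otimes> d" by (auto simp: frac_class_mem)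
  have "(a' \<otimes> c') \<otimes> (b \<otimes> d) = (a' \<otimes> b) \<otimes> (c' \<otimes> d)" using h(1,2,5,6) ab cd by (simp add: m_ac)
  also have "\<dots> = (a \<otimes> b') \<otimes> (c \<otimes> d')" using h by simp
  also have "\<dots> = (a \<otimes> c) \<otimes> (b' \<otimes> d')" using h(1,2,5,6) ab cd by (simp add: m_ac)
  finally show "frac_class R (a' \<otimes> c') (b' \<otimes> d') = frac_class R (a \<otimes> c) (b \<otimes> d)"
    using h ab cd by (subst frac_class_eq) (auto simp: integral_iff)
qed

text \<open>The fraction field as a module over the ring; for \<open>R = \<int>\<^sub>p\<close> this is \<^const>\<open>Qp_module\<close>.\<close>

definition frac_module where
  "frac_module = ring.extend (frac_field R) \<lparr> smult = (\<lambda>r X. frac_emb R r \<otimes>\<^bsub>frac_field R\<^esub> X) \<rparr>"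

lemma frac_module_simps:
  "carrier frac_module = carrier (frac_field R)" "\<zero>\<^bsub>frac_module\<^esub> = frac_class R \<zero> \<one>"
  "X \<oplus>\<^bsub>frac_module\<^esub> Y = X \<oplus>\<^bsub>frac_field R\<^esub> Y"
  "r \<odot>\<^bsub>frac_module\<^esub> X = frac_class R r \<one> \<otimes>\<^bsub>frac_field R\<^esub> X"
  by (auto simp: frac_module_def ring.defs frac_emb_def frac_field_def)

lemma frac_carrier: "carrier (frac_field R) = {frac_class R a b | a b. a \<in> carrier R \<and> b \<in> carrier R \<and> b \<noteq> \<zero>}"
  unfolding frac_field_def ring_record_simps partial_object.simps quotient_def frac_class_def by blast

lemma frac_cases:
  assumes "X \<in> carrier (frac_field R)"
  obtains a b where "a \<in> carrier R" "b \<in> carrier R" "b \<noteq> \<zero>" "X = frac_class R a b"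
  using assms by (auto simp: frac_carrier)

lemma frac_closed: "a \<in> carrier R \<Longrightarrow> b \<in> carrier R \<Longrightarrow> b \<noteq> \<zero> \<Longrightarrow> frac_class R a b \<in> carrier (frac_field R)"
  by (auto simp: frac_carrier)

lemma frac_smult:
  assumes "r \<in> carrier R" "a \<in> carrier R" "b \<in> carrier R" "b \<noteq> \<zero>"
  shows "r \<odot>\<^bsub>frac_module\<^esub> frac_class R a b = frac_class R (r \<otimes> a) b"
  using assms by (simp add: frac_module_simps frac_mult)

lemma frac_module_is_module: "module R frac_module"
proof (rule moduleI)
  show "cring R" ..
  show "abelian_group frac_module"
  proof (rule abelian_groupI; unfold frac_module_simps)
    fix x y assume xy: "x \<in> carrier (frac_field R)" "y \<in> carrier (frac_field R)"
    show "x \<oplus>\<^bsub>frac_field R\<^esub> y \<in> carrier (frac_field R)"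
      using xy by (auto elim!: frac_cases simp: frac_add integral_iff intro!: frac_closed)
    show "x \<oplus>\<^bsub>frac_field R\<^esub> y = y \<oplus>\<^bsub>frac_field R\<^esub> x"
      using xy by (auto elim!: frac_cases simp: frac_add m_comm a_comm)
    fix z assume z: "z \<in> carrier (frac_field R)"
    show "x \<oplus>\<^bsub>frac_field R\<^esub> y \<oplus>\<^bsub>frac_field R\<^esub> z = x \<oplus>\<^bsub>frac_field R\<^esub> (y \<oplus>\<^bsub>frac_field R\<^esub> z)"
      using xy z by (auto elim!: frac_cases simp: frac_add integral_iff l_distr r_distr m_ac a_ac)
  next
    show "frac_class R \<zero> \<one> \<in> carrier (frac_field R)" by (intro frac_closed) auto
    fix x assume x: "x \<in> carrier (frac_field R)"
    show "frac_class R \<zero> \<one> \<oplus>\<^bsub>frac_field R\<^esub> x = x"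
      using x by (auto elim!: frac_cases simp: frac_add)
    obtain a b where ab: "a \<in> carrier R" "b \<in> carrier R" "b \<noteq> \<zero>" "x = frac_class R a b"
      using x by (rule frac_cases)
    have "frac_class R (\<ominus> a) b \<oplus>\<^bsub>frac_field R\<^esub> x = frac_class R \<zero> \<one>"
      using ab by (simp add: frac_add frac_class_eq integral_iff l_minus l_neg)
    then show "\<exists>y\<in>carrier (frac_field R). y \<oplus>\<^bsub>frac_field R\<^esub> x = frac_class R \<zero> \<one>"
      using ab frac_closed[of "\<ominus> a" b] by auto
  qed
next
  fix a x assume "a \<in> carrier R" "x \<in> carrier frac_module"
  then show "a \<odot>\<^bsub>frac_module\<^esub> x \<in> carrier frac_module"
    unfolding frac_module_simps(1) by (auto elim!: frac_cases simp: frac_smult intro!: frac_closed)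
next
  fix a b x assume ab: "a \<in> carrier R" "b \<in> carrier R" and "x \<in> carrier frac_module"
  then obtain c d where cd: "c \<in> carrier R" "d \<in> carrier R" "d \<noteq> \<zero>" "x = frac_class R c d"
    unfolding frac_module_simps(1) by (auto elim!: frac_cases)
  have "frac_class R ((a \<oplus> b) \<otimes> c) d = frac_class R (a \<otimes> c \<otimes> d \<oplus> b \<otimes> c \<otimes> d) (d \<otimes> d)"
    using ab cd(1-3) by (subst frac_class_eq) (auto simp: integral_iff l_distr r_distr m_ac)
  then show "(a \<oplus> b) \<odot>\<^bsub>frac_module\<^esub> x = a \<odot>\<^bsub>frac_module\<^esub> x \<oplus>\<^bsub>frac_module\<^esub> b \<odot>\<^bsub>frac_module\<^esub> x"
    using ab cd by (simp add: frac_module_simps(3) frac_smult frac_add)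
next
  fix a x y assume "a \<in> carrier R" "x \<in> carrier frac_module" "y \<in> carrier frac_module"
  then show "a \<odot>\<^bsub>frac_module\<^esub> (x \<oplus>\<^bsub>frac_module\<^esub> y) = a \<odot>\<^bsub>frac_module\<^esub> x \<oplus>\<^bsub>frac_module\<^esub> a \<odot>\<^bsub>frac_module\<^esub> y"
    unfolding frac_module_simps(1,3)
    by (auto elim!: frac_cases simp: frac_smult frac_add integral_iff r_distr m_ac)
next
  fix a b x assume "a \<in> carrier R" "b \<in> carrier R" "x \<in> carrier frac_module"
  then show "(a \<otimes> b) \<odot>\<^bsub>frac_module\<^esub> x = a \<odot>\<^bsub>frac_module\<^esub> (b \<odot>\<^bsub>frac_module\<^esub> x)"
    unfolding frac_module_simps(1) by (auto elim!: frac_cases simp: frac_smult m_ac)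
next
  fix x assume "x \<in> carrier frac_module"
  then show "\<one> \<odot>\<^bsub>frac_module\<^esub> x = x"
    unfolding frac_module_simps(1) by (auto elim!: frac_cases simp: frac_smult)
qed

lemma frac_emb_submodule: "submodule (frac_emb R ` carrier R) R frac_module"
proof -
  interpret F: module R frac_module by (rule frac_module_is_module)
  have sm: "r \<odot>\<^bsub>frac_module\<^esub> x \<in> frac_emb R ` carrier R" if "r \<in> carrier R" "x \<in> frac_emb R ` carrier R" for r x
    using that by (auto simp: frac_emb_def frac_smult)
  have sub: "frac_emb R ` carrier R \<subseteq> carrier frac_module"
    by (auto simp: frac_emb_def frac_module_simps intro: frac_closed)
  show ?thesis
  proof (rule F.submoduleI)
    fix x assume x: "x \<in> frac_emb R ` carrier R"
    then have "x \<in> carrier frac_module" using sub by blast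
    then show "\<ominus>\<^bsub>frac_module\<^esub> x \<in> frac_emb R ` carrier R"
      using sm[of "\<ominus> \<one>" x] x F.smult_l_minus[of \<one> x] by simp
  next
    fix x y assume "x \<in> frac_emb R ` carrier R" "y \<in> frac_emb R ` carrier R"
    then show "x \<oplus>\<^bsub>frac_module\<^esub> y \<in> frac_emb R ` carrier R"
      by (auto simp: frac_emb_def frac_module_simps frac_add)
  qed (use sm sub in \<open>auto simp: frac_emb_def frac_module_simps\<close>)
qed

end

lemma submodule_abelian_subgroup:
  assumes "module R M" "submodule N R M"
  shows "abelian_subgroup N M"
  using assms module.axioms(2)[OF assms(1)]
  by (intro abelian_subgroupI3) (auto simp: additive_subgroup_def submodule_def)

lemma quot_module_smult:
  assumes "module R M" and N: "submodule N R M" and r: "r \<in> carrier R" and x: "x \<in> carrier M"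
  shows "r \<odot>\<^bsub>quot_module M N\<^esub> (N +>\<^bsub>M\<^esub> x) = N +>\<^bsub>M\<^esub> (r \<odot>\<^bsub>M\<^esub> x)"
proof -
  interpret module R M by fact
  note NE = submoduleE[OF N]
  interpret N: abelian_subgroup N M
    by (rule submodule_abelian_subgroup) fact+
  have "N +>\<^bsub>M\<^esub> (r \<odot>\<^bsub>M\<^esub> c) = N +>\<^bsub>M\<^esub> (r \<odot>\<^bsub>M\<^esub> x)" if c: "c \<in> N +>\<^bsub>M\<^esub> x" for c
  proof -
    obtain n where n: "n \<in> N" "c = n \<oplus>\<^bsub>M\<^esub> x" using c by (auto simp: a_r_coset_def')
    have nc: "n \<in> carrier M" using n NE(1) by auto
    have "r \<odot>\<^bsub>M\<^esub> c = r \<odot>\<^bsub>M\<^esub> n \<oplus>\<^bsub>M\<^esub> r \<odot>\<^bsub>M\<^esub> x" using n nc r x by (simp add: smult_r_distr)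
    then have "r \<odot>\<^bsub>M\<^esub> c \<in> N +>\<^bsub>M\<^esub> (r \<odot>\<^bsub>M\<^esub> x)" using NE(4)[OF r n(1)] by (auto simp: a_r_coset_def')
    then show ?thesis using a_repr_independence[of "r \<odot>\<^bsub>M\<^esub> c" N "r \<odot>\<^bsub>M\<^esub> x"] r x N.a_subgroup by simp
  qed
  moreover have "x \<in> N +>\<^bsub>M\<^esub> x" using N.a_rcos_self[OF x] .
  ultimately have "(\<Union>c\<in>N +>\<^bsub>M\<^esub> x. N +>\<^bsub>M\<^esub> (r \<odot>\<^bsub>M\<^esub> c)) = N +>\<^bsub>M\<^esub> (r \<odot>\<^bsub>M\<^esub> x)"
    by (intro UN_constant_eq ballI)
  then show ?thesis by (simp add: quot_module_def)
qed

lemma quot_module_is_module: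
  assumes "module R M" and N: "submodule N R M"
  shows "module R (quot_module M N)"
proof -
  interpret module R M by fact
  interpret N: abelian_subgroup N M
    by (rule submodule_abelian_subgroup) fact+
  have car: "carrier (quot_module M N) = {N +>\<^bsub>M\<^esub> x | x. x \<in> carrier M}"
    by (auto simp: quot_module_def A_RCOSETS_def')
  have add: "(N +>\<^bsub>M\<^esub> x) \<oplus>\<^bsub>quot_module M N\<^esub> (N +>\<^bsub>M\<^esub> y) = N +>\<^bsub>M\<^esub> (x \<oplus>\<^bsub>M\<^esub> y)"
    if "x \<in> carrier M" "y \<in> carrier M" for x y
    using N.a_rcos_sum[OF that] by (simp add: quot_module_def)
  have zero: "\<zero>\<^bsub>quot_module M N\<^esub> = N +>\<^bsub>M\<^esub> \<zero>\<^bsub>M\<^esub>"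
    using a_coset_add_zero N.a_subset by (simp add: quot_module_def)
  note smult = quot_module_smult[OF assms]
  show ?thesis
  proof (rule moduleI)
    show "abelian_group (quot_module M N)"
    proof (rule abelian_groupI)
      fix x assume "x \<in> carrier (quot_module M N)"
      then obtain a where a: "a \<in> carrier M" "x = N +>\<^bsub>M\<^esub> a" by (auto simp: car)
      then show "\<exists>y\<in>carrier (quot_module M N). y \<oplus>\<^bsub>quot_module M N\<^esub> x = \<zero>\<^bsub>quot_module M N\<^esub>"
        by (intro bexI[of _ "N +>\<^bsub>M\<^esub> (\<ominus>\<^bsub>M\<^esub> a)"]) (auto simp: car add zero M.l_neg)
    qed (auto simp: car add zero M.a_ac intro: exI[of _ "\<zero>\<^bsub>M\<^esub>"])
  qed (auto simp: car add smult smult_l_distr smult_r_distr smult_assoc1 R.is_cring)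
qed

context dvr
begin

lemma pi_pow_divides_pi_pow: "\<pi> [^] (n::nat) divides \<pi> [^] (k::nat) \<longleftrightarrow> n \<le> k"
proof
  assume "n \<le> k"
  then show "\<pi> [^] n divides \<pi> [^] k"
    by (intro dividesI[of "\<pi> [^] (k - n)"]) (auto simp: nat_pow_mult)
next
  assume "\<pi> [^] n divides \<pi> [^] k"
  then obtain c where c: "c \<in> carrier R" "\<pi> [^] k = \<pi> [^] n \<otimes> c" by (auto elim!: dividesE)
  show "n \<le> k"
  proof (rule ccontr)
    assume "\<not> n \<le> k"
    then obtain m where m: "n = k + Suc m" using less_imp_Suc_add[of k n] by auto
    then have "\<pi> [^] k \<otimes> \<one> = \<pi> [^] k \<otimes> (\<pi> \<otimes> (\<pi> [^] m \<otimes> c))"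
      using c by (simp add: nat_pow_mult[symmetric] m_ac)
    from pi_pow_cancel[OF _ _ this] have "\<pi> \<otimes> (\<pi> [^] m \<otimes> c) = \<one>" using c by simp
    then have "\<pi> \<in> Units R" using c unit_factor[of \<pi> "\<pi> [^] m \<otimes> c"] by simp
    then show False using pi_not_unit by simp
  qed
qed

text \<open>Every element of \<open>K/R\<close> is the class of some \<open>a/\<pi>\<^sup>n\<close>, as units can be absorbed in the numerator. With a common
  denominator the comparison of two classes reduces to divisibility of numerators, which is total in a
  discrete valuation ring. The class of \<open>1/\<pi>\<^sup>n\<close> has exact order \<open>\<pi>\<^sup>n\<close>.\<close>

lemma fraction_quotient_uniserial:
  "uniserial_module R \<pi> (quot_module frac_module (frac_emb R ` carrier R))"
proof -
  define N where "N = frac_emb R ` carrier R"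
  define K where "K = frac_module"
  define Q where "Q = quot_module K N"
  have N: "submodule N R K" unfolding N_def K_def by (rule frac_emb_submodule)
  have Kmod: "module R K" unfolding K_def by (rule frac_module_is_module)
  interpret K: module R K by (rule Kmod)
  interpret N: abelian_subgroup N K
    by (rule submodule_abelian_subgroup[OF Kmod N])
  interpret Q: module R Q unfolding Q_def by (rule quot_module_is_module[OF Kmod N])
  define q where "q a n = N +>\<^bsub>K\<^esub> frac_class R a (\<pi> [^] n)" for a and n :: nat
  have Kc: "frac_class R a b \<in> carrier K" if "a \<in> carrier R" "b \<in> carrier R" "b \<noteq> \<zero>" for a b
    using frac_closed[OF that] by (simp add: K_def frac_module_simps)
  have car: "carrier Q = {N +>\<^bsub>K\<^esub> x | x. x \<in> carrier K}"
    by (auto simp: Q_def quot_module_def A_RCOSETS_def')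
  have qc: "q a n \<in> carrier Q" if "a \<in> carrier R" for a n
    using that Kc[of a "\<pi> [^] n"] pi_pow_nonzero by (auto simp: car q_def)
  have q_smult: "r \<odot>\<^bsub>Q\<^esub> q a n = q (r \<otimes> a) n" if "r \<in> carrier R" "a \<in> carrier R" for r a n
    using that Kc[of a "\<pi> [^] n"] pi_pow_nonzero quot_module_smult[OF Kmod N] frac_smult
    by (simp add: q_def Q_def K_def)
  have q_scale: "q a n = q (\<pi> [^] m \<otimes> a) (n + m)" if "a \<in> carrier R" for a n m
  proof -
    have "frac_class R a (\<pi> [^] n) = frac_class R (\<pi> [^] m \<otimes> a) (\<pi> [^] (n + m))"
      using that pi_pow_nonzero nat_pow_mult[OF pi_closed, of n m]
      by (subst frac_class_eq) (auto simp: m_ac)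
    then show ?thesis by (simp add: q_def)
  qed
  have q_cases: "\<exists>a\<in>carrier R. \<exists>n. x = q a n" if x: "x \<in> carrier Q" for x
  proof -
    obtain a b where ab: "a \<in> carrier R" "b \<in> carrier R" "b \<noteq> \<zero>" "x = N +>\<^bsub>K\<^esub> frac_class R a b"
      using x unfolding car K_def frac_module_simps(1) by (auto elim!: frac_cases)
    obtain n u where u: "u \<in> Units R" "b = \<pi> [^] (n::nat) \<otimes> u" using pi_power_unit_factor[OF ab(2,3)] .
    have "(inv u \<otimes> a) \<otimes> b = (u \<otimes> inv u) \<otimes> (a \<otimes> \<pi> [^] n)"
      using u ab(1) Units_closed Units_inv_closed by (simp add: m_ac del: Units_r_inv Units_l_inv)
    then have "frac_class R a b = frac_class R (inv u \<otimes> a) (\<pi> [^] n)"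
      using u ab pi_pow_nonzero by (subst frac_class_eq) auto
    then show ?thesis using ab u by (intro bexI[of _ "inv u \<otimes> a"] exI[of _ n]) (auto simp: q_def)
  qed
  have q_zero: "q a n = \<zero>\<^bsub>Q\<^esub> \<longleftrightarrow> \<pi> [^] n divides a" if a: "a \<in> carrier R" for a n
  proof -
    have "q a n = \<zero>\<^bsub>Q\<^esub> \<longleftrightarrow> frac_class R a (\<pi> [^] n) \<in> N"
      using K.a_coset_join1[of N "frac_class R a (\<pi> [^] n)"] K.a_coset_join2[of "frac_class R a (\<pi> [^] n)" N]
        Kc[of a "\<pi> [^] n"] a pi_pow_nonzero N.a_subgroup
      by (auto simp: q_def Q_def quot_module_def)
    also have "\<dots> \<longleftrightarrow> (\<exists>c\<in>carrier R. a = c \<otimes> \<pi> [^] n)"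
      using a pi_pow_nonzero by (auto simp: N_def frac_emb_def image_iff frac_class_eq)
    also have "\<dots> \<longleftrightarrow> \<pi> [^] n divides a" by (auto simp: factor_def m_comm)
    finally show ?thesis .
  qed
  have "uniserial_module R \<pi> Q"
  proof
    fix x y assume "x \<in> carrier Q" "y \<in> carrier Q"
    then obtain a b m n where ab: "a \<in> carrier R" "b \<in> carrier R" "x = q a n" "y = q b m"
      using q_cases by metis
    define a' b' where "a' = \<pi> [^] m \<otimes> a" and "b' = \<pi> [^] n \<otimes> b"
    have xy: "x = q a' (n + m)" "y = q b' (n + m)"
      using q_scale[of a n m] q_scale[of b m n] ab by (simp_all add: a'_def b'_def add.commute)
    have c: "a' \<in> carrier R" "b' \<in> carrier R" using ab by (auto simp: a'_def b'_def)
    have "\<exists>r\<in>carrier R. q d k = r \<odot>\<^bsub>Q\<^esub> q c k"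
      if "c divides d" "c \<in> carrier R" for c d k
      using that q_smult by (auto elim!: dividesE simp: m_comm)
    then show "(\<exists>r\<in>carrier R. x = r \<odot>\<^bsub>Q\<^esub> y) \<or> (\<exists>r\<in>carrier R. y = r \<odot>\<^bsub>Q\<^esub> x)"
      using divides_chain[OF c] c xy by blast
  next
    fix n
    have "\<pi> [^] k \<odot>\<^bsub>Q\<^esub> q \<one> n = \<zero>\<^bsub>Q\<^esub> \<longleftrightarrow> n \<le> k" for k :: nat
      by (simp add: q_smult q_zero pi_pow_divides_pi_pow)
    then show "\<exists>g\<in>carrier Q. \<forall>k::nat. \<pi> [^] k \<odot>\<^bsub>Q\<^esub> g = \<zero>\<^bsub>Q\<^esub> \<longleftrightarrow> n \<le> k" using qc by blast
  qed
  then show ?thesis by (simp add: Q_def K_def N_def)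
qed

end

section \<open>The p-adic integers\<close>

definition residue_system :: "nat \<Rightarrow> (nat \<Rightarrow> int) set" where
  "residue_system p = {x. (\<forall>n. 0 \<le> x n \<and> x n < int p ^ n) \<and> (\<forall>n. x (Suc n) mod int p ^ n = x n)}"

lemma Zp_simps:
  "carrier (Zp p) = residue_system p"
  "x \<otimes>\<^bsub>Zp p\<^esub> y = (\<lambda>n. (x n * y n) mod int p ^ n)"
  "\<one>\<^bsub>Zp p\<^esub> = (\<lambda>n. 1 mod int p ^ n)"
  "\<zero>\<^bsub>Zp p\<^esub> = (\<lambda>n. 0)"
  "x \<oplus>\<^bsub>Zp p\<^esub> y = (\<lambda>n. (x n + y n) mod int p ^ n)"
  by (simp_all add: Zp_def residue_system_def)

lemma residue_systemD:
  assumes "x \<in> residue_system p"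
  shows "0 \<le> x n" "x n < int p ^ n" "x n mod int p ^ n = x n" "x (Suc n) mod int p ^ n = x n"
  using assms by (auto simp: residue_system_def)

lemma residue_system_mod:
  assumes x: "x \<in> residue_system p" and "n \<le> m"
  shows "x m mod int p ^ n = x n"
  using \<open>n \<le> m\<close>
proof (induction m rule: dec_induct)
  case base
  then show ?case using residue_systemD[OF x] by simp
next
  case (step m)
  have "x (Suc m) mod int p ^ n = x (Suc m) mod int p ^ m mod int p ^ n"
    using step by (intro mod_mod_cancel[symmetric] le_imp_power_dvd) auto
  also have "\<dots> = x n" using residue_systemD(4)[OF x, of m] step by simp
  finally show ?case .
qed

lemma reduced_in_residue_system:
  assumes "0 < p" and "\<And>n. y (Suc n) mod int p ^ n = y n mod int p ^ n"
  shows "(\<lambda>n. y n mod int p ^ n) \<in> residue_system p"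
  using assms by (auto simp: residue_system_def mod_mod_cancel)

lemma Zp_cring:
  assumes p: "0 < p"
  shows "cring (Zp p)"
proof (rule cringI)
  have add: "(\<lambda>n. (x n + y n) mod int p ^ n) \<in> residue_system p"
    if "x \<in> residue_system p" "y \<in> residue_system p" for x y
    using that p by (intro reduced_in_residue_system) (auto simp: residue_systemD intro: mod_add_cong)
  have mult: "(\<lambda>n. (x n * y n) mod int p ^ n) \<in> residue_system p"
    if "x \<in> residue_system p" "y \<in> residue_system p" for x y
    using that p by (intro reduced_in_residue_system) (auto simp: residue_systemD intro: mod_mult_cong)
  have zero: "(\<lambda>n. 0) \<in> residue_system p" using p by (auto simp: residue_system_def)
  have one: "(\<lambda>n. 1 mod int p ^ n) \<in> residue_system p" using p by (intro reduced_in_residue_system) auto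
  show "abelian_group (Zp p)"
  proof (rule abelian_groupI; unfold Zp_simps)
    fix x assume x: "x \<in> residue_system p"
    have "(\<lambda>n. (- x n) mod int p ^ n) \<in> residue_system p"
      using x p by (intro reduced_in_residue_system) (auto simp: residue_systemD intro: mod_minus_cong)
    then show "\<exists>y\<in>residue_system p. (\<lambda>n. (y n + x n) mod int p ^ n) = (\<lambda>n. 0)"
      by (rule bexI[rotated]) (simp add: mod_simps)
    show "(\<lambda>n. (0 + x n) mod int p ^ n) = x" using x by (simp add: residue_systemD)
  qed (auto intro: add zero simp: mod_simps add_ac)
  show "Group.comm_monoid (Zp p)"
    by (rule comm_monoidI; unfold Zp_simps)
      (auto intro: mult one simp: mod_simps mult_ac residue_systemD)
  show "(x \<oplus>\<^bsub>Zp p\<^esub> y) \<otimes>\<^bsub>Zp p\<^esub> z = x \<otimes>\<^bsub>Zp p\<^esub> z \<oplus>\<^bsub>Zp p\<^esub> y \<otimes>\<^bsub>Zp p\<^esub> z" for x y z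
    by (simp add: Zp_simps mod_simps distrib_right)
qed

definition Zp_prime :: "nat \<Rightarrow> nat \<Rightarrow> int" where
  "Zp_prime p = [p] \<cdot>\<^bsub>Zp p\<^esub> \<one>\<^bsub>Zp p\<^esub>"

lemma Zp_nat_multiple:
  assumes p: "0 < p"
  shows "[k] \<cdot>\<^bsub>Zp p\<^esub> \<one>\<^bsub>Zp p\<^esub> = (\<lambda>n. int k mod int p ^ n)"
proof -
  interpret cring "Zp p" by (rule Zp_cring[OF p])
  show ?thesis
    by (induction k) (simp_all add: Zp_simps mod_simps add_ac)
qed

lemma Zp_prime_val: "0 < p \<Longrightarrow> Zp_prime p = (\<lambda>n. int p mod int p ^ n)"
  by (simp only: Zp_prime_def Zp_nat_multiple)

lemma Zp_prime_closed: "0 < p \<Longrightarrow> Zp_prime p \<in> carrier (Zp p)"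
proof -
  assume "0 < p"
  then interpret cring "Zp p" by (rule Zp_cring)
  show ?thesis by (simp add: Zp_prime_def)
qed

lemma Zp_prime_pow:
  assumes p: "0 < p"
  shows "Zp_prime p [^]\<^bsub>Zp p\<^esub> (k::nat) = (\<lambda>n. int p ^ k mod int p ^ n)"
proof -
  interpret cring "Zp p" by (rule Zp_cring[OF p])
  show ?thesis
    by (induction k) (simp_all add: Zp_prime_val[OF p] Zp_simps mod_simps mult_ac)
qed

text \<open>If \<open>x\<close> vanishes modulo \<open>p\<^sup>k\<close>, the quotient has \<open>x\<^bsub>n+k\<^esub> / p\<^sup>k\<close> as its residue modulo \<open>p\<^sup>n\<close>.\<close>

lemma Zp_prime_pow_divides:
  assumes p: "0 < p" and x: "x \<in> residue_system p"
  shows "Zp_prime p [^]\<^bsub>Zp p\<^esub> (k::nat) divides\<^bsub>Zp p\<^esub> x \<longleftrightarrow> x k = 0"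
proof
  assume "Zp_prime p [^]\<^bsub>Zp p\<^esub> k divides\<^bsub>Zp p\<^esub> x"
  then show "x k = 0" by (auto simp: factor_def Zp_prime_pow[OF p] Zp_simps)
next
  assume xk: "x k = 0"
  define y where "y n = x (n + k) div int p ^ k" for n
  have py: "int p ^ k * y n = x (n + k)" for n
    using residue_system_mod[OF x, of k "n + k"] xk by (auto simp: y_def)
  have "y n < int p ^ n" for n
  proof -
    have "int p ^ k * y n < int p ^ k * int p ^ n"
      using residue_systemD(2)[OF x, of "n + k"] unfolding py by (simp add: power_add mult.commute)
    then show ?thesis using p by simp
  qed
  moreover have "0 \<le> y n" for n using residue_systemD(1)[OF x] by (simp add: y_def pos_imp_zdiv_nonneg_iff p)
  moreover have "y (Suc n) mod int p ^ n = y n" for n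
  proof -
    have "int p ^ k * (y (Suc n) mod int p ^ n) = x (Suc (n + k)) mod int p ^ (n + k)"
      using py[of "Suc n"] by (simp add: mult_mod_right power_add mult_ac)
    also have "\<dots> = int p ^ k * y n" using residue_systemD(4)[OF x] py by simp
    finally show ?thesis using p by simp
  qed
  ultimately have y: "y \<in> residue_system p" by (auto simp: residue_system_def)
  have "x = Zp_prime p [^]\<^bsub>Zp p\<^esub> k \<otimes>\<^bsub>Zp p\<^esub> y"
  proof
    fix n
    have "x n = (int p ^ k * y n) mod int p ^ n" using py residue_system_mod[OF x, of n "n + k"] by simp
    then show "x n = (Zp_prime p [^]\<^bsub>Zp p\<^esub> k \<otimes>\<^bsub>Zp p\<^esub> y) n"
      by (simp add: Zp_prime_pow[OF p] Zp_simps mod_simps)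
  qed
  then show "Zp_prime p [^]\<^bsub>Zp p\<^esub> k divides\<^bsub>Zp p\<^esub> x" using y by (auto simp: factor_def Zp_simps)
qed

text \<open>The residues of \<open>x\<close> are prime to \<open>p\<close>, hence invertible modulo each \<open>p\<^sup>n\<close>; uniqueness of inverses makes the
  inverses compatible.\<close>

lemma Zp_unit:
  assumes p: "prime p" and x: "x \<in> residue_system p" "x 1 \<noteq> 0"
  shows "x \<in> Units (Zp p)"
proof -
  have p0: "0 < p" using p prime_gt_0_nat by blast
  interpret cring "Zp p" by (rule Zp_cring[OF p0])
  have cop: "coprime (x n) (int p ^ n)" for n
  proof (cases n)
    case (Suc m)
    have "x n mod int p = x 1" using residue_system_mod[OF x(1), of 1 n] Suc by simp
    then have "\<not> int p dvd x n" using x(2) by auto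
    then have "coprime (int p) (x n)" using p by (intro prime_imp_coprime) auto
    then show ?thesis by (simp add: coprime_commute)
  qed simp
  have "\<exists>y. [x n * y = 1] (mod int p ^ n)" for n using cong_solve_coprime_int[OF cop] by blast
  then obtain y where y: "\<And>n. [x n * y n = 1] (mod int p ^ n)" by metis
  have "y (Suc n) mod int p ^ n = y n mod int p ^ n" for n
  proof -
    have "[x (Suc n) * y (Suc n) = 1] (mod int p ^ n)"
      using y[of "Suc n"] by (rule cong_dvd_modulus) (simp add: le_imp_power_dvd)
    moreover have "[x (Suc n) = x n] (mod int p ^ n)"
      using residue_systemD(3,4)[OF x(1)] by (simp add: cong_def)
    ultimately have "[x n * y (Suc n) = x n * y n] (mod int p ^ n)"
      using y[of n] by (meson cong_scalar_right cong_sym cong_trans)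
    then show ?thesis using cong_mult_lcancel[OF cop] by (simp add: cong_def)
  qed
  then have "(\<lambda>n. y n mod int p ^ n) \<in> residue_system p" by (rule reduced_in_residue_system[OF p0])
  moreover have "x \<otimes>\<^bsub>Zp p\<^esub> (\<lambda>n. y n mod int p ^ n) = \<one>\<^bsub>Zp p\<^esub>"
    using y by (auto simp: Zp_simps mod_simps cong_def)
  ultimately show ?thesis
    unfolding Units_def using x(1) m_comm by (auto simp: Zp_simps(1) intro!: bexI[of _ "\<lambda>n. y n mod int p ^ n"])
qed

text \<open>There are no zero divisors because nonzero elements are powers of \<open>p\<close> times units and no power of \<open>p\<close>
  vanishes.\<close>

lemma Zp_dvr:
  assumes p: "prime p"
  shows "dvr (Zp p) (Zp_prime p)"
proof -
  have p0: "0 < p" and p1: "1 < p" using p prime_gt_0_nat prime_gt_1_nat by blast+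
  interpret cring "Zp p" by (rule Zp_cring[OF p0])
  note pc = Zp_prime_closed[OF p0] and prime_val = Zp_prime_val[OF p0]
  have div1: "Zp_prime p divides\<^bsub>Zp p\<^esub> x \<longleftrightarrow> x 1 = 0" if "x \<in> residue_system p" for x
    using Zp_prime_pow_divides[OF p0 that, of 1] pc by simp
  have sep: "x = \<zero>\<^bsub>Zp p\<^esub>" if "x \<in> residue_system p" "\<And>n::nat. Zp_prime p [^]\<^bsub>Zp p\<^esub> n divides\<^bsub>Zp p\<^esub> x" for x
    using that Zp_prime_pow_divides[OF p0 that(1)] by (auto simp: Zp_simps)
  have not_unit: "x 1 \<noteq> 0" if x: "x \<in> Units (Zp p)" for x
  proof
    assume "x 1 = 0"
    obtain y where y: "x \<otimes>\<^bsub>Zp p\<^esub> y = \<one>\<^bsub>Zp p\<^esub>" using x by (auto simp: Units_def)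
    from fun_cong[OF this, of 1] \<open>x 1 = 0\<close> p1 show False by (simp add: Zp_simps)
  qed
  have nz: "\<one>\<^bsub>Zp p\<^esub> \<noteq> \<zero>\<^bsub>Zp p\<^esub>"
  proof
    assume "\<one>\<^bsub>Zp p\<^esub> = \<zero>\<^bsub>Zp p\<^esub>"
    from fun_cong[OF this, of 1] p1 show False by (simp add: Zp_simps)
  qed
  have factor: "\<exists>n u. u \<in> residue_system p \<and> u 1 \<noteq> 0 \<and> x = Zp_prime p [^]\<^bsub>Zp p\<^esub> (n::nat) \<otimes>\<^bsub>Zp p\<^esub> u"
    if x: "x \<in> residue_system p" "x \<noteq> \<zero>\<^bsub>Zp p\<^esub>" for x
  proof -
    obtain m where "x m \<noteq> 0" using x(2) by (auto simp: Zp_simps fun_eq_iff)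
    define k where "k = (LEAST m. x m \<noteq> 0)"
    have k: "x k \<noteq> 0" unfolding k_def using \<open>x m \<noteq> 0\<close> by (rule LeastI)
    have "x 0 = 0" using residue_systemD(1,2)[OF x(1), of 0] by simp
    then obtain n where n: "k = Suc n" using k by (cases k) auto
    have "x n = 0" using not_less_Least[of n "\<lambda>m. x m \<noteq> 0"] n by (simp add: k_def)
    then obtain u where u: "u \<in> residue_system p" "x = Zp_prime p [^]\<^bsub>Zp p\<^esub> n \<otimes>\<^bsub>Zp p\<^esub> u"
      using Zp_prime_pow_divides[OF p0 x(1), of n] by (auto simp: factor_def Zp_simps(1))
    have "u 1 \<noteq> 0"
    proof
      assume "u 1 = 0"
      then obtain v where "v \<in> residue_system p" "u = Zp_prime p \<otimes>\<^bsub>Zp p\<^esub> v"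
        using div1[OF u(1)] by (auto simp: factor_def Zp_simps(1))
      then have "x = Zp_prime p [^]\<^bsub>Zp p\<^esub> (Suc n) \<otimes>\<^bsub>Zp p\<^esub> v"
        using u(2) pc nat_pow_closed[OF pc, of n] m_assoc[of "Zp_prime p [^]\<^bsub>Zp p\<^esub> n" "Zp_prime p" v] by (simp add: Zp_simps(1))
      then have "x (Suc n) = 0" using Zp_prime_pow_divides[OF p0 x(1), of "Suc n"] \<open>v \<in> residue_system p\<close>
        by (auto simp: factor_def Zp_simps(1))
      then show False using k n by simp
    qed
    then show ?thesis using u by blast
  qed
  show ?thesis
  proof
    show "\<one>\<^bsub>Zp p\<^esub> \<noteq> \<zero>\<^bsub>Zp p\<^esub>" by (rule nz)
    show "Zp_prime p \<in> carrier (Zp p)" by (rule pc)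
    show "Zp_prime p \<noteq> \<zero>\<^bsub>Zp p\<^esub>"
    proof
      assume "Zp_prime p = \<zero>\<^bsub>Zp p\<^esub>"
      from fun_cong[OF this, of 2] show False
        using p1 by (simp add: prime_val Zp_simps power2_eq_square)
    qed
    show "Zp_prime p \<notin> Units (Zp p)"
      using not_unit[of "Zp_prime p"] by (auto simp: prime_val)
    fix x assume x: "x \<in> carrier (Zp p)"
    then have x': "x \<in> residue_system p" by (simp add: Zp_simps)
    show "x \<in> Units (Zp p) \<or> Zp_prime p divides\<^bsub>Zp p\<^esub> x"
      using Zp_unit[OF p x'] div1[OF x'] by blast
    show "x = \<zero>\<^bsub>Zp p\<^esub>" if "\<And>n::nat. Zp_prime p [^]\<^bsub>Zp p\<^esub> n divides\<^bsub>Zp p\<^esub> x"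
      using sep[OF x' that] .
  next
    fix a b assume ab: "a \<otimes>\<^bsub>Zp p\<^esub> b = \<zero>\<^bsub>Zp p\<^esub>" "a \<in> carrier (Zp p)" "b \<in> carrier (Zp p)"
    show "a = \<zero>\<^bsub>Zp p\<^esub> \<or> b = \<zero>\<^bsub>Zp p\<^esub>"
    proof (rule ccontr)
      assume neg: "\<not> ?thesis"
      obtain n u where u: "u \<in> residue_system p" "u 1 \<noteq> 0" "a = Zp_prime p [^]\<^bsub>Zp p\<^esub> (n::nat) \<otimes>\<^bsub>Zp p\<^esub> u"
        using factor[of a] ab neg by (auto simp: Zp_simps(1))
      obtain m v where v: "v \<in> residue_system p" "v 1 \<noteq> 0" "b = Zp_prime p [^]\<^bsub>Zp p\<^esub> (m::nat) \<otimes>\<^bsub>Zp p\<^esub> v"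
        using factor[of b] ab neg by (auto simp: Zp_simps(1))
      have uv: "u \<in> Units (Zp p)" "v \<in> Units (Zp p)" using Zp_unit[OF p] u v by auto
      have "\<zero>\<^bsub>Zp p\<^esub> = Zp_prime p [^]\<^bsub>Zp p\<^esub> (n + m) \<otimes>\<^bsub>Zp p\<^esub> (u \<otimes>\<^bsub>Zp p\<^esub> v)"
        unfolding ab(1)[symmetric] u(3) v(3) using uv[THEN Units_closed] pc
        by (simp add: nat_pow_mult[symmetric] m_ac)
      then have "\<zero>\<^bsub>Zp p\<^esub> \<otimes>\<^bsub>Zp p\<^esub> inv\<^bsub>Zp p\<^esub> (u \<otimes>\<^bsub>Zp p\<^esub> v) = Zp_prime p [^]\<^bsub>Zp p\<^esub> (n + m)"
        using uv Units_m_closed[OF uv] Units_closed pc by (simp add: m_assoc)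
      then have "Zp_prime p [^]\<^bsub>Zp p\<^esub> (n + m) = \<zero>\<^bsub>Zp p\<^esub>" using uv by simp
      from fun_cong[OF this, of "Suc (n + m)"] show False
        using p1 by (simp add: Zp_prime_pow[OF p0] Zp_simps)
    qed
  qed
qed

lemma QpZp_uniserial:
  assumes "prime p"
  shows "uniserial_module (Zp p) (Zp_prime p) (QpZp p)"
proof -
  interpret dvr "Zp p" "Zp_prime p" by (rule Zp_dvr[OF assms])
  show ?thesis
    using fraction_quotient_uniserial unfolding QpZp_def Qp_module_def frac_module_def .
qed

lemma ord_Zp_ge:
  assumes p: "prime p" and x: "x \<in> carrier (Zp p)" "x \<noteq> \<zero>\<^bsub>Zp p\<^esub>"
  shows "k \<le> ord_Zp p x \<longleftrightarrow> Zp_prime p [^]\<^bsub>Zp p\<^esub> k divides\<^bsub>Zp p\<^esub> x"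
proof -
  have p0: "0 < p" using p prime_gt_0_nat by blast
  have x': "x \<in> residue_system p" using x by (simp add: Zp_simps)
  let ?P = "\<lambda>n. x n = 0"
  have ord: "ord_Zp p x = Greatest ?P"
    unfolding ord_Zp_def using Zp_prime_pow_divides[OF p0 x'] by (simp add: factor_def Zp_prime_def)
  obtain m where m: "x m \<noteq> 0" using x(2) by (auto simp: Zp_simps fun_eq_iff)
  have down: "x i = 0" if "i \<le> j" "x j = 0" for i j
    using residue_system_mod[OF x' that(1)] that(2) by simp
  have bound: "\<forall>n. ?P n \<longrightarrow> n \<le> m"
    using down[of m] m by (metis nat_le_linear)
  have "?P 0" using residue_systemD(1,2)[OF x', of 0] by simp
  then have "?P (Greatest ?P)" using bound by (intro GreatestI_nat[of ?P 0 m]) auto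
  moreover have "n \<le> Greatest ?P" if "?P n" for n using that bound by (intro Greatest_le_nat[of ?P n m]) auto
  ultimately show ?thesis unfolding ord Zp_prime_pow_divides[OF p0 x'] using down by blast
qed

section \<open>Continuity of characters\<close>

context filtered_coordinates
begin

lemma openin_fil_topology:
  "openin (fil_topology M) U \<longleftrightarrow> U \<subseteq> carrier M \<and> (\<forall>x\<in>U. \<exists>i\<ge>1. x <+\<^bsub>M\<^esub> fil M i \<subseteq> U)"
proof -
  define L where "L U \<longleftrightarrow> U \<subseteq> carrier M \<and> (\<forall>x\<in>U. \<exists>i\<ge>1. x <+\<^bsub>M\<^esub> fil M i \<subseteq> U)" for U
  have mono: "x <+\<^bsub>M\<^esub> fil M j \<subseteq> x <+\<^bsub>M\<^esub> fil M i" if "1 \<le> i" "i \<le> j" for x i j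
    using fil_antimono[OF that] by (auto simp: a_l_coset_def')
  have "L (U \<inter> V)" if "L U" "L V" for U V
  proof -
    have "\<exists>k\<ge>1. x <+\<^bsub>M\<^esub> fil M k \<subseteq> U \<inter> V" if x: "x \<in> U \<inter> V" for x
    proof -
      obtain i j where ij: "1 \<le> i" "x <+\<^bsub>M\<^esub> fil M i \<subseteq> U" "1 \<le> j" "x <+\<^bsub>M\<^esub> fil M j \<subseteq> V"
        using x \<open>L U\<close> \<open>L V\<close> unfolding L_def by blast
      show ?thesis
        using mono[of i "max i j" x] mono[of j "max i j" x] ij by (intro exI[of _ "max i j"]) auto
    qed
    then show ?thesis using \<open>L U\<close> unfolding L_def by blast
  qed
  moreover have "L (\<Union>\<U>)" if \<U>: "\<forall>U\<in>\<U>. L U" for \<U>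
    unfolding L_def
  proof (intro conjI ballI)
    show "\<Union>\<U> \<subseteq> carrier M" using \<U> by (auto simp: L_def)
    fix x assume "x \<in> \<Union>\<U>"
    then obtain U where U: "U \<in> \<U>" "x \<in> U" by auto
    then obtain i where "1 \<le> i" "x <+\<^bsub>M\<^esub> fil M i \<subseteq> U" using \<U> unfolding L_def by blast
    then show "\<exists>i\<ge>1. x <+\<^bsub>M\<^esub> fil M i \<subseteq> \<Union>\<U>" using U by blast
  qed
  ultimately have "istopology L" unfolding istopology_def by blast
  from topology_inverse'[OF this] show ?thesis by (simp add: fil_topology_def L_def[abs_def])
qed

lemma topspace_fil_topology: "topspace (fil_topology M) = carrier M"
proof
  show "topspace (fil_topology M) \<subseteq> carrier M"
    using openin_topspace[of "fil_topology M"] by (simp only: openin_fil_topology)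
  have "openin (fil_topology M) (carrier M)"
    unfolding openin_fil_topology
    by (auto simp: a_l_coset_def' fil_1 simp del: One_nat_def intro!: exI[of _ "1::nat"])
  then show "carrier M \<subseteq> topspace (fil_topology M)" by (rule openin_subset)
qed

end

context character_setting
begin

text \<open>A map to a discrete space is continuous if and only if its fibres are open; by linearity the fibre over
  zero decides this.\<close>

lemma continuous_character_iff:
  assumes lin: "\<chi> \<in> linear_maps R M Q"
  shows "continuous_map (fil_topology M) (discrete_topology (carrier Q)) \<chi>
    \<longleftrightarrow> (\<exists>j\<ge>1. \<chi> ` fil M j \<subseteq> {\<zero>\<^bsub>Q\<^esub>})"
proof
  assume "continuous_map (fil_topology M) (discrete_topology (carrier Q)) \<chi>"
  then have "openin (fil_topology M) {x \<in> carrier M. \<chi> x \<in> {\<zero>\<^bsub>Q\<^esub>}}"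
    using openin_continuous_map_preimage[of "fil_topology M" "discrete_topology (carrier Q)" \<chi> "{\<zero>\<^bsub>Q\<^esub>}"]
    by (simp add: topspace_fil_topology)
  then obtain i where i: "1 \<le> i" "\<zero>\<^bsub>M\<^esub> <+\<^bsub>M\<^esub> fil M i \<subseteq> {x \<in> carrier M. \<chi> x \<in> {\<zero>\<^bsub>Q\<^esub>}}"
    using linear_map_zero[OF is_module Q_module lin] unfolding openin_fil_topology by auto
  have "x \<in> \<zero>\<^bsub>M\<^esub> <+\<^bsub>M\<^esub> fil M i" if "x \<in> fil M i" for x
    using that fil_carrier[OF i(1)] by (force simp: a_l_coset_def')
  then show "\<exists>j\<ge>1. \<chi> ` fil M j \<subseteq> {\<zero>\<^bsub>Q\<^esub>}" using i by blast
next
  assume "\<exists>j\<ge>1. \<chi> ` fil M j \<subseteq> {\<zero>\<^bsub>Q\<^esub>}"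
  then obtain j where j: "1 \<le> j" "\<chi> ` fil M j \<subseteq> {\<zero>\<^bsub>Q\<^esub>}" by blast
  have "openin (fil_topology M) {x \<in> carrier M. \<chi> x \<in> U}" for U
  proof -
    have "x <+\<^bsub>M\<^esub> fil M j \<subseteq> {x \<in> carrier M. \<chi> x \<in> U}" if x: "x \<in> carrier M" "\<chi> x \<in> U" for x
    proof
      fix y assume "y \<in> x <+\<^bsub>M\<^esub> fil M j"
      then obtain h where h: "h \<in> fil M j" "y = x \<oplus>\<^bsub>M\<^esub> h" by (auto simp: a_l_coset_def')
      have hc: "h \<in> carrier M" using h fil_carrier[OF j(1)] by blast
      have "\<chi> h = \<zero>\<^bsub>Q\<^esub>" using j(2) h(1) by blast
      then have "\<chi> y = \<chi> x" using x hc h linear_mapsD(1,2)[OF lin] by simp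
      then show "y \<in> {x \<in> carrier M. \<chi> x \<in> U}" using x hc h by simp
    qed
    then show ?thesis unfolding openin_fil_topology using j(1) by blast
  qed
  then show "continuous_map (fil_topology M) (discrete_topology (carrier Q)) \<chi>"
    unfolding continuous_map_def topspace_fil_topology using linear_mapsD(1)[OF lin] by auto
qed

end

section \<open>The free module with its coordinates\<close>

lemma fil_prod_module:
  assumes "cring R" and N: "\<And>i. i \<in> I \<Longrightarrow> module R (N i)"
  shows "module R (fil_prod I N)"
proof -
  note closed = module.smult_closed[OF N] abelian_monoid.a_closed[OF abelian_group.axioms(1)[OF module.axioms(2)[OF N]]]
    abelian_monoid.zero_closed[OF abelian_group.axioms(1)[OF module.axioms(2)[OF N]]]
    abelian_group.a_inv_closed[OF module.axioms(2)[OF N]]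
  note assoc = abelian_monoid.a_assoc[OF abelian_group.axioms(1)[OF module.axioms(2)[OF N]]]
  note comm = abelian_monoid.a_comm[OF abelian_group.axioms(1)[OF module.axioms(2)[OF N]]]
  note zero = abelian_monoid.l_zero[OF abelian_group.axioms(1)[OF module.axioms(2)[OF N]]]
  note neg = abelian_group.l_neg[OF module.axioms(2)[OF N]]
  note smult = module.smult_l_distr[OF N] module.smult_r_distr[OF N] module.smult_assoc1[OF N] module.smult_one[OF N]
  show ?thesis
  proof (rule moduleI)
    show "cring R" by fact
    show "abelian_group (fil_prod I N)"
    proof (rule abelian_groupI)
      fix x assume x: "x \<in> carrier (fil_prod I N)"
      then have xi: "x i \<in> carrier (N i)" if "i \<in> I" for i using that by (auto simp: fil_prod_def)
      show "\<exists>y\<in>carrier (fil_prod I N). y \<oplus>\<^bsub>fil_prod I N\<^esub> x = \<zero>\<^bsub>fil_prod I N\<^esub>"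
        by (rule bexI[of _ "\<lambda>i\<in>I. \<ominus>\<^bsub>N i\<^esub> x i"]) (auto simp: fil_prod_def fun_eq_iff xi neg closed)
      show "\<zero>\<^bsub>fil_prod I N\<^esub> \<oplus>\<^bsub>fil_prod I N\<^esub> x = x"
        using x by (auto simp: fil_prod_def fun_eq_iff zero PiE_iff extensional_def)
    next
      fix x y z assume "x \<in> carrier (fil_prod I N)" "y \<in> carrier (fil_prod I N)" "z \<in> carrier (fil_prod I N)"
      then show "x \<oplus>\<^bsub>fil_prod I N\<^esub> y \<oplus>\<^bsub>fil_prod I N\<^esub> z = x \<oplus>\<^bsub>fil_prod I N\<^esub> (y \<oplus>\<^bsub>fil_prod I N\<^esub> z)"
        by (auto simp: fil_prod_def fun_eq_iff PiE_iff assoc)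
    next
      fix x y assume "x \<in> carrier (fil_prod I N)" "y \<in> carrier (fil_prod I N)"
      then show "x \<oplus>\<^bsub>fil_prod I N\<^esub> y = y \<oplus>\<^bsub>fil_prod I N\<^esub> x"
        by (auto simp: fil_prod_def fun_eq_iff PiE_iff comm)
    qed (auto simp: fil_prod_def PiE_iff closed)
  qed (auto simp: fil_prod_def PiE_iff closed smult fun_eq_iff extensional_def
      intro: cring.axioms assms(1) ring.axioms)
qed

lemma fil_sum_module:
  assumes "module R M" "module R N"
  shows "module R (fil_sum M N)"
proof -
  interpret M: module R M by fact
  interpret N: module R N by fact
  show ?thesis
  proof (rule moduleI)
    show "cring R" by (rule M.is_cring)
    show "abelian_group (fil_sum M N)"
    proof (rule abelian_groupI)
      fix x assume "x \<in> carrier (fil_sum M N)"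
      then show "\<exists>y\<in>carrier (fil_sum M N). y \<oplus>\<^bsub>fil_sum M N\<^esub> x = \<zero>\<^bsub>fil_sum M N\<^esub>"
        by (intro bexI[of _ "(\<ominus>\<^bsub>M\<^esub> fst x, \<ominus>\<^bsub>N\<^esub> snd x)"]) (auto simp: fil_sum_def M.l_neg N.l_neg)
    qed (auto simp: fil_sum_def M.a_ac N.a_ac)
  qed (auto simp: fil_sum_def M.smult_l_distr N.smult_l_distr M.smult_r_distr N.smult_r_distr
      M.smult_assoc1 N.smult_assoc1)
qed

lemma S_mod_simps:
  "carrier (S_mod p \<rho> i) = carrier (Zp p)" "x \<oplus>\<^bsub>S_mod p \<rho> i\<^esub> y = x \<oplus>\<^bsub>Zp p\<^esub> y"
  "\<zero>\<^bsub>S_mod p \<rho> i\<^esub> = \<zero>\<^bsub>Zp p\<^esub>" "r \<odot>\<^bsub>S_mod p \<rho> i\<^esub> x = r \<otimes>\<^bsub>Zp p\<^esub> x"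
  "fil (S_mod p \<rho> i) j = {x \<in> carrier (Zp p). enat j \<le> S_weight p \<rho> i x}"
  by (simp_all add: S_mod_def ring.defs)

lemma S_mod_module:
  assumes "0 < p"
  shows "module (Zp p) (S_mod p \<rho> i)"
proof -
  interpret cring "Zp p" by (rule Zp_cring[OF assms])
  show ?thesis
  proof (rule moduleI)
    show "cring (Zp p)" ..
    show "abelian_group (S_mod p \<rho> i)"
      by (rule abelian_groupI)
        (auto simp: S_mod_simps a_ac intro: bexI[of _ "\<ominus>\<^bsub>Zp p\<^esub> _"] l_neg)
  qed (auto simp: S_mod_simps l_distr r_distr m_assoc)
qed

text \<open>The iterates \<open>\<rho>\<^sup>k(i)\<close> increase with \<open>k\<close>, so the condition on the valuation of \<open>x\<close> amounts to divisibility by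
  some \<open>p\<^sup>k\<close> with \<open>\<rho>\<^sup>k(i) \<ge> j\<close>.\<close>

lemma S_mod_fil:
  assumes p: "prime p" and \<rho>: "is_shift \<rho>" and i: "1 \<le> i"
  shows "fil (S_mod p \<rho> i) j = shifted_dvr.level_ideal (Zp p) (Zp_prime p) \<rho> i j"
proof -
  interpret dvr "Zp p" "Zp_prime p" by (rule Zp_dvr[OF p])
  interpret shifted_dvr "Zp p" "Zp_prime p" \<rho> by unfold_locales (rule \<rho>)
  have mono: "(\<rho> ^^ k) i \<le> (\<rho> ^^ m) i" if "k \<le> m" for k m
    using that
  proof (induction m rule: dec_induct)
    case (step m)
    have "1 \<le> (\<rho> ^^ m) i" using shift_pow_ge[OF \<rho> i, of m] i by simp
    from shift_less[OF \<rho> this] show ?case using step by simp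
  qed simp
  have "enat j \<le> S_weight p \<rho> i x \<longleftrightarrow> x \<in> level_ideal i j" if x: "x \<in> carrier (Zp p)" for x
  proof (cases "x = \<zero>\<^bsub>Zp p\<^esub>")
    case True
    then show ?thesis using level_ideal_zero[OF i] by (simp add: S_weight_def)
  next
    case False
    then have "enat j \<le> S_weight p \<rho> i x \<longleftrightarrow> j \<le> (\<rho> ^^ ord_Zp p x) i" by (simp add: S_weight_def)
    also have "\<dots> \<longleftrightarrow> (\<exists>k. j \<le> (\<rho> ^^ k) i \<and> k \<le> ord_Zp p x)"
      using mono by (meson order_refl order_trans)
    finally show ?thesis using x False by (simp add: level_ideal_def ord_Zp_ge[OF p])
  qed
  then show ?thesis using level_ideal_carrier by (auto simp: S_mod_simps)
qed

text \<open>The first component numbers the copies; the last number \<open>f - 1\<close> belongs to \<open>M\<^sub>\<rho>\<^sup>*\<close>. The second component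
  is the level.\<close>

definition free_index :: "(nat \<Rightarrow> nat) \<Rightarrow> nat \<Rightarrow> (nat \<times> nat) set" where
  "free_index \<rho> f = {..<f - 1} \<times> T_set \<rho> \<union> {f - 1} \<times> T_star \<rho>"

definition free_coord :: "nat \<Rightarrow> nat \<times> nat \<Rightarrow> (nat \<Rightarrow> nat \<Rightarrow> 'a) \<times> (nat \<Rightarrow> 'a) \<Rightarrow> 'a" where
  "free_coord f b x = (if fst b < f - 1 then fst x (fst b) (snd b) else snd x (snd b))"

lemma M_free_simps:
  "carrier (M_free p \<rho> f) = (\<Pi>\<^sub>E c\<in>{..<f - 1}. \<Pi>\<^sub>E i\<in>T_set \<rho>. carrier (Zp p)) \<times> (\<Pi>\<^sub>E i\<in>T_star \<rho>. carrier (Zp p))"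
  "(x, y) \<oplus>\<^bsub>M_free p \<rho> f\<^esub> (x', y') =
    ((\<lambda>c\<in>{..<f - 1}. \<lambda>i\<in>T_set \<rho>. x c i \<oplus>\<^bsub>Zp p\<^esub> x' c i), (\<lambda>i\<in>T_star \<rho>. y i \<oplus>\<^bsub>Zp p\<^esub> y' i))"
  "r \<odot>\<^bsub>M_free p \<rho> f\<^esub> (x, y) =
    ((\<lambda>c\<in>{..<f - 1}. \<lambda>i\<in>T_set \<rho>. r \<otimes>\<^bsub>Zp p\<^esub> x c i), (\<lambda>i\<in>T_star \<rho>. r \<otimes>\<^bsub>Zp p\<^esub> y i))"
  "fil (M_free p \<rho> f) j =
    (\<Pi>\<^sub>E c\<in>{..<f - 1}. \<Pi>\<^sub>E i\<in>T_set \<rho>. fil (S_mod p \<rho> i) j) \<times> (\<Pi>\<^sub>E i\<in>T_star \<rho>. fil (S_mod p \<rho> i) j)"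
  by (simp_all add: M_free_def M_rho_def M_rho_star_def fil_sum_def fil_prod_def S_mod_simps(1-4))

lemma M_free_coordinates:
  assumes p: "prime p" and \<rho>: "is_shift \<rho>" and fin: "finite (T_set \<rho>)"
  shows "filtered_coordinates (Zp p) (Zp_prime p) \<rho> (M_free p \<rho> f) (free_index \<rho> f) snd (free_coord f)"
proof -
  have p0: "0 < p" using p prime_gt_0_nat by blast
  interpret dvr "Zp p" "Zp_prime p" by (rule Zp_dvr[OF p])
  interpret shifted_dvr "Zp p" "Zp_prime p" \<rho> by unfold_locales (rule \<rho>)
  interpret module "Zp p" "M_free p \<rho> f"
    unfolding M_free_def M_rho_def M_rho_star_def
    by (intro fil_sum_module fil_prod_module S_mod_module p0 Zp_cring)
  have T_pos: "1 \<le> i" if "i \<in> T_star \<rho>" for i using that by (auto simp: T_star_def T_set_def e_star_def)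
  have T_sub: "T_set \<rho> \<subseteq> T_star \<rho>" by (auto simp: T_star_def)
  show ?thesis
  proof
    show "finite (free_index \<rho> f)" using fin by (simp add: free_index_def T_star_def)
    show "1 \<le> snd b" if "b \<in> free_index \<rho> f" for b
      using that T_pos T_sub by (auto simp: free_index_def)
    show "free_coord f b x \<in> carrier (Zp p)" if "b \<in> free_index \<rho> f" "x \<in> carrier (M_free p \<rho> f)" for b x
      using that by (cases x) (fastforce simp: free_index_def free_coord_def M_free_simps PiE_iff)
    show "free_coord f b (x \<oplus>\<^bsub>M_free p \<rho> f\<^esub> y) = free_coord f b x \<oplus>\<^bsub>Zp p\<^esub> free_coord f b y"
      if "b \<in> free_index \<rho> f" for b x y
      using that by (cases x; cases y) (auto simp: free_index_def free_coord_def M_free_simps)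
    show "free_coord f b (r \<odot>\<^bsub>M_free p \<rho> f\<^esub> x) = r \<otimes>\<^bsub>Zp p\<^esub> free_coord f b x"
      if "b \<in> free_index \<rho> f" for b r x
      using that by (cases x) (auto simp: free_index_def free_coord_def M_free_simps)
    show "x = y"
      if xy: "x \<in> carrier (M_free p \<rho> f)" "y \<in> carrier (M_free p \<rho> f)"
        and eq: "\<And>b. b \<in> free_index \<rho> f \<Longrightarrow> free_coord f b x = free_coord f b y" for x y
    proof -
      obtain x1 x2 y1 y2 where [simp]: "x = (x1, x2)" "y = (y1, y2)" by (metis prod.exhaust)
      have "x1 c i = y1 c i" if "c < f - 1" "i \<in> T_set \<rho>" for c i
        using eq[of "(c, i)"] that by (simp add: free_index_def free_coord_def)
      moreover have "x1 c \<in> extensional (T_set \<rho>)" "y1 c \<in> extensional (T_set \<rho>)" if "c < f - 1" for c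
        using xy that by (auto simp: M_free_simps PiE_iff)
      ultimately have "x1 c = y1 c" if "c < f - 1" for c
        using that by (intro extensionalityI[of "x1 c" "T_set \<rho>" "y1 c"]) auto
      moreover have "x1 \<in> extensional {..<f - 1}" "y1 \<in> extensional {..<f - 1}"
        using xy by (auto simp: M_free_simps PiE_iff)
      ultimately have "x1 = y1" by (intro extensionalityI[of x1 "{..<f - 1}" y1]) auto
      moreover have "x2 i = y2 i" if "i \<in> T_star \<rho>" for i
        using eq[of "(f - 1, i)"] that by (simp add: free_index_def free_coord_def)
      moreover have "x2 \<in> extensional (T_star \<rho>)" "y2 \<in> extensional (T_star \<rho>)"
        using xy by (auto simp: M_free_simps PiE_iff)
      ultimately have "x2 = y2" by (intro extensionalityI[of x2 "T_star \<rho>" y2]) auto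
      then show ?thesis using \<open>x1 = y1\<close> by simp
    qed
    show "\<exists>x\<in>carrier (M_free p \<rho> f). \<forall>b\<in>free_index \<rho> f. free_coord f b x = g b"
      if g: "g \<in> free_index \<rho> f \<rightarrow> carrier (Zp p)" for g
      using g by (intro bexI[of _ "(\<lambda>c\<in>{..<f - 1}. \<lambda>i\<in>T_set \<rho>. g (c, i), \<lambda>i\<in>T_star \<rho>. g (f - 1, i))"])
        (auto simp: free_index_def free_coord_def M_free_simps)
    show "fil (M_free p \<rho> f) j = {x \<in> carrier (M_free p \<rho> f).
        \<forall>b\<in>free_index \<rho> f. free_coord f b x \<in> level_ideal (snd b) j}" for j
    proof -
      have S: "fil (S_mod p \<rho> i) j = carrier (Zp p) \<inter> level_ideal i j" if "i \<in> T_star \<rho>" for i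
        using S_mod_fil[OF p \<rho> T_pos[OF that], of j] level_ideal_carrier by blast
      have "x \<in> fil (M_free p \<rho> f) j \<longleftrightarrow> x \<in> carrier (M_free p \<rho> f) \<and>
          (\<forall>b\<in>free_index \<rho> f. free_coord f b x \<in> level_ideal (snd b) j)" for x
      proof -
        obtain x1 x2 where [simp]: "x = (x1, x2)" by (cases x)
        have "x1 \<in> (\<Pi>\<^sub>E c\<in>{..<f - 1}. \<Pi>\<^sub>E i\<in>T_set \<rho>. fil (S_mod p \<rho> i) j) \<longleftrightarrow>
            x1 \<in> (\<Pi>\<^sub>E c\<in>{..<f - 1}. \<Pi>\<^sub>E i\<in>T_set \<rho>. carrier (Zp p)) \<and>
            (\<forall>c<f - 1. \<forall>i\<in>T_set \<rho>. x1 c i \<in> level_ideal i j)"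
          using S T_sub by (auto simp: PiE_iff subset_iff)
        moreover have "x2 \<in> (\<Pi>\<^sub>E i\<in>T_star \<rho>. fil (S_mod p \<rho> i) j) \<longleftrightarrow>
            x2 \<in> (\<Pi>\<^sub>E i\<in>T_star \<rho>. carrier (Zp p)) \<and> (\<forall>i\<in>T_star \<rho>. x2 i \<in> level_ideal i j)"
          using S by (auto simp: PiE_iff)
        moreover have "(\<forall>b\<in>free_index \<rho> f. free_coord f b x \<in> level_ideal (snd b) j) \<longleftrightarrow>
            (\<forall>c<f - 1. \<forall>i\<in>T_set \<rho>. x1 c i \<in> level_ideal i j) \<and> (\<forall>i\<in>T_star \<rho>. x2 i \<in> level_ideal i j)"
          by (auto simp: free_index_def free_coord_def ball_Un split_paired_Ball_Sigma)
        ultimately show ?thesis unfolding M_free_simps by auto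
      qed
      then show ?thesis by blast
    qed
  qed
qed

section \<open>The classification\<close>

theorem theorem1p17:
  fixes p f :: nat and \<rho> :: "nat \<Rightarrow> nat"
  assumes "prime p" and "is_shift \<rho>" and "finite (T_set \<rho>)" and "f \<ge> 1"
  shows "jumps (M_free p \<rho> f) ` characters p (M_free p \<rho> f) = Jump_star \<rho> \<and>
    (\<forall>\<chi>\<in>characters p (M_free p \<rho> f). \<forall>\<chi>'\<in>characters p (M_free p \<rho> f).
       jumps (M_free p \<rho> f) \<chi> = jumps (M_free p \<rho> f) \<chi>' \<longleftrightarrow>
       \<chi>' \<in> orbit (Aut_filt (Zp p) (M_free p \<rho> f)) (precomp (M_free p \<rho> f)) \<chi>)"
proof -
  interpret filtered_coordinates "Zp p" "Zp_prime p" \<rho> "M_free p \<rho> f" "free_index \<rho> f" snd "free_coord f"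
    using assms by (intro M_free_coordinates)
  interpret Q: uniserial_module "Zp p" "Zp_prime p" "QpZp p"
    by (rule QpZp_uniserial[OF assms(1)])
  interpret character_setting "Zp p" "Zp_prime p" \<rho> "M_free p \<rho> f" "free_index \<rho> f" snd "free_coord f" "QpZp p"
    ..
  have "characters p (M_free p \<rho> f) = chars"
    using continuous_character_iff by (auto simp: characters_def chars_def)
  moreover have "snd ` free_index \<rho> f = T_star \<rho>"
    by (auto simp: free_index_def T_star_def image_Un)
  then have "jump_sets = Jump_star \<rho>" by (simp add: jump_sets_def Jump_star_def)
  ultimately show ?thesis using jumps_of_chars same_jumps_iff_same_orbit by simp
qed

end
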